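(* Let $n_1,n_2,n_3$ be integers such that $n_1>0$, $n_2>0$ and $n_3\ge 0$, and let $n=n_1+n_2+n_3$. Let $a_1,a_2,a_3$ be non-zero integers, and let $d_{ij}$ be natural numbers for $i=1,2,3$ and $j=1,\ldots,n_i$. Then for a positive proportion of $n$-tuples $(P_{ij})\in\mathbb{Z}[t]^n$ with $\deg(P_{ij}(t))=d_{ij}$, ordered by height, the conic bundle surface $$a_1\prod_{j=1}^{n_1}P_{1,j}(t)\,x^2+a_2\prod_{k=1}^{n_2}P_{2,k}(t)\,y^2+a_3\prod_{l=1}^{n_3}P_{3,l}(t)\,z^2=0$$ has a $\mathbb{Q}$-point contained in a smooth fibre.
   Context: Natural numbers are positive integers; an empty product equals $1$. The surface lies in $\mathbb{P}^2\times\mathbb{A}^1$ with homogeneous coordinates $(x:y:z)$ on $\mathbb{P}^2$ and coordinate $t$ on $\mathbb{A}^1$; the fibres are those of the projection to $t$, and the fibre at $t_0$ is smooth exactly when all three coefficients are non-zero at $t=t_0$. The height of a tuple of integer polynomials is the maximum of the absolute values of all their coefficients. "For a positive proportion ... ordered by height" means that the proportion, among all $n$-tuples of integer polynomials with the prescribed degrees and height at most $H$, of those with the property has positive $\liminf$ as $H\to\infty$. *)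

theory Defs
  imports "HOL-Analysis.Analysis" "HOL-Computational_Algebra.Polynomial"
begin

definition tuple_index :: "(nat \<Rightarrow> nat) \<Rightarrow> (nat \<times> nat) set" where
  "tuple_index n = (SIGMA i:{1, 2, 3}. {1..n i})"

(* Tuples are extensional functions on the index set, so that each tuple is counted exactly once. *)
definition poly_tuples ::
    "(nat \<Rightarrow> nat) \<Rightarrow> (nat \<Rightarrow> nat \<Rightarrow> nat) \<Rightarrow> (nat \<times> nat \<Rightarrow> int poly) set" where
  "poly_tuples n d = (\<Pi>\<^sub>E (i, j) \<in> tuple_index n. {p. degree p = d i j})"

definition tuple_height :: "(nat \<Rightarrow> nat) \<Rightarrow> (nat \<times> nat \<Rightarrow> int poly) \<Rightarrow> int" where
  "tuple_height n P = Max (\<Union>ij \<in> tuple_index n. {\<bar>coeff (P ij) k\<bar> | k. k \<le> degree (P ij)})"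

definition poly_tuples_le ::
    "(nat \<Rightarrow> nat) \<Rightarrow> (nat \<Rightarrow> nat \<Rightarrow> nat) \<Rightarrow> nat \<Rightarrow> (nat \<times> nat \<Rightarrow> int poly) set" where
  "poly_tuples_le n d H = {P \<in> poly_tuples n d. tuple_height n P \<le> int H}"

definition positive_proportion ::
    "(nat \<Rightarrow> nat) \<Rightarrow> (nat \<Rightarrow> nat \<Rightarrow> nat) \<Rightarrow> ((nat \<times> nat \<Rightarrow> int poly) \<Rightarrow> bool) \<Rightarrow> bool" where
  "positive_proportion n d Q \<longleftrightarrow>
     0 < liminf (\<lambda>H. ereal (real (card {P \<in> poly_tuples_le n d H. Q P})
                            / real (card (poly_tuples_le n d H))))"

definition conic_coeff ::
    "(nat \<Rightarrow> int) \<Rightarrow> (nat \<Rightarrow> nat) \<Rightarrow> (nat \<times> nat \<Rightarrow> int poly) \<Rightarrow> nat \<Rightarrow> rat poly" where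
  "conic_coeff a n P i = map_poly rat_of_int (smult (a i) (\<Prod>j = 1..n i. P (i, j)))"

(* A rational point of the projective plane times the affine line is given by t and a
   representative (x, y, z) of its homogeneous coordinates; the equation is homogeneous
   in x, y, z, so the choice of representative is immaterial. *)
definition on_surface ::
    "(nat \<Rightarrow> int) \<Rightarrow> (nat \<Rightarrow> nat) \<Rightarrow> (nat \<times> nat \<Rightarrow> int poly) \<Rightarrow> rat \<times> rat \<times> rat \<Rightarrow> rat \<Rightarrow> bool" where
  "on_surface a n P = (\<lambda>(x, y, z) t. (x, y, z) \<noteq> (0, 0, 0) \<and>
     poly (conic_coeff a n P 1) t * x\<^sup>2 + poly (conic_coeff a n P 2) t * y\<^sup>2
       + poly (conic_coeff a n P 3) t * z\<^sup>2 = 0)"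

(* A diagonal conic is smooth exactly when none of its coefficients vanishes. *)
definition smooth_fibre ::
    "(nat \<Rightarrow> int) \<Rightarrow> (nat \<Rightarrow> nat) \<Rightarrow> (nat \<times> nat \<Rightarrow> int poly) \<Rightarrow> rat \<Rightarrow> bool" where
  "smooth_fibre a n P t \<longleftrightarrow> (\<forall>i \<in> {1, 2, 3}. poly (conic_coeff a n P i) t \<noteq> 0)"

end

(*
  For a fixed t the fibre has a rational point with probability 0, so t ranges over [T, 2T) with T
  about (ln H)^n, where n is the number of polynomials, and the second moment method is applied to
  the number of t for which all P_ij(t) are, up to fixed constants, primes with compatible Legendre
  symbols; by Legendre's theorem the fibre at such a t has a rational point.  The primes are taken
  congruent to 1 modulo 4, so that quadratic reciprocity involves no signs and there is no obstruction
  at 2.  The lower bound for the first moment combines Mertens' theorem for this residue class with a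
  bilinear estimate showing that the symbols of primes of comparable size are equidistributed.  For
  the second moment the symbol conditions are dropped, and Selberg's sieve bounds the probability that
  P_ij(t) and P_ij(s) are both prime; the dependence of the bound on t - s is harmless on average.
*)
theory Submission
  imports "HOL-Number_Theory.Number_Theory" "HOL-Computational_Algebra.Squarefree"
    "HOL-Real_Asymp.Real_Asymp" Defs
begin

section \<open>Legendre symbols and ternary conics\<close>

text \<open>The prime values wanted at a fixed \<open>t\<close> have probability of order (ln
  H)^(-n), so about (ln H)^n values of \<open>t\<close> are just enough to bound the expected number
  of successes from below, while the sum of the pair correlations stays bounded. Only a positive
  proportion is wanted, so constant factors may be lost: primes are counted in windows (\<delta> Y,
  Y] with one fixed \<delta>, polynomials through a given value are counted from below, and the
  sieve is used from above. As \<open>t\<close> is only a power of ln H, all primes that occur have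
  size between powers of H with exponents near 1. For variables of such equal size the bilinear sum
  must be raised to a high power before its off-diagonal part becomes small. The values are
  prescribed between H t^d / (t - 1) and H t^d / 2: the lower limit forces the degree to be exactly
  d, the upper one keeps the value attainable with coefficients up to H. P(t) and P(s) are
  correlated only through the primes dividing t - s. These give the factor rho (t - s)^n, and all
  moments of \<open>rho\<close> are bounded on average.\<close>

lemma legendre_cases: "Legendre a p \<in> {-1, 0, 1}"
  by (auto simp: Legendre_def)

lemma legendre_eq_0_iff: "Legendre a p = 0 \<longleftrightarrow> p dvd a"
  by (auto simp: Legendre_def cong_0_iff)

lemma legendre_cong:
  assumes "[a = b] (mod p)"
  shows "Legendre a p = Legendre b p"
proof -
  have "[a = 0] (mod p) \<longleftrightarrow> [b = 0] (mod p)" "QuadRes p a \<longleftrightarrow> QuadRes p b"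
    using assms by (meson QuadRes_def cong_sym cong_trans)+
  then show ?thesis by (simp add: Legendre_def)
qed

text \<open>Euler's criterion gives the identity as a congruence modulo \<open>p\<close>. Both sides
  lie in {-1, 0, 1}, so they differ by at most 2, and \<open>2 < p\<close> turns the congruence into
  an equality.\<close>

lemma legendre_mult:
  assumes "prime p" "2 < p"
  shows "Legendre (a * b) (int p) = Legendre a (int p) * Legendre b (int p)"
proof -
  have "[Legendre (a * b) p = (a * b) ^ ((p - 1) div 2)] (mod p)"
    using assms by (rule euler_criterion)
  moreover have "[Legendre a p * Legendre b p = a ^ ((p - 1) div 2) * b ^ ((p - 1) div 2)] (mod p)"
    using assms by (intro cong_mult euler_criterion)
  ultimately have "[Legendre (a * b) p = Legendre a p * Legendre b p] (mod p)"
    by (metis cong_sym cong_trans power_mult_distrib)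
  then have d: "int p dvd Legendre (a * b) p - Legendre a p * Legendre b p"
    by (simp add: cong_iff_dvd_diff)
  have "\<bar>Legendre (a * b) p - Legendre a p * Legendre b p\<bar> < int p"
    using legendre_cases[of "a * b" p] legendre_cases[of a p] legendre_cases[of b p] assms
    by auto
  with d show ?thesis
    by (metis abs_of_nat dvd_imp_le_int linorder_not_less right_minus_eq)
qed

lemma legendre_1:
  assumes "prime p"
  shows "Legendre 1 (int p) = 1"
proof -
  have "\<not> int p dvd 1" using assms by (simp add: prime_nat_iff)
  moreover have "QuadRes (int p) 1" unfolding QuadRes_def by (rule exI[of _ 1]) simp
  ultimately show ?thesis by (simp add: Legendre_def cong_0_iff)
qed

lemma legendre_prod:
  assumes "prime p" "2 < p"
  shows "Legendre (\<Prod>i\<in>S. f i) (int p) = (\<Prod>i\<in>S. Legendre (f i) (int p))"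
  using assms by (induction S rule: infinite_finite_induct) (auto simp: legendre_mult legendre_1)

lemma legendre_minus_one:
  assumes "prime p" "p mod 4 = 1"
  shows "Legendre (-1) (int p) = 1"
proof -
  have "p \<noteq> 2" "p \<ge> 2" using assms by (auto simp: prime_ge_2_nat)
  then have p: "2 < p" by simp
  have e: "even ((p - 1) div 2)" using assms(2) by presburger
  have "[Legendre (-1) p = (-1) ^ ((p - 1) div 2)] (mod p)"
    using assms p by (intro euler_criterion)
  with e have "int p dvd Legendre (-1) p - 1"
    by (simp add: cong_iff_dvd_diff)
  moreover have "\<bar>Legendre (-1) p - 1\<bar> < int p"
    using legendre_cases[of "-1" p] p by auto
  ultimately show ?thesis
    by (metis abs_of_nat dvd_imp_le_int linorder_not_less right_minus_eq)
qed

text \<open>For primes that are 1 modulo 4 the sign in quadratic reciprocity is trivial. The case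
  \<open>p = q\<close>, where both symbols vanish, is included so that no distinctness has to be
  shown at the point of use.\<close>

lemma legendre_sym:
  assumes "prime p" "prime q" "p mod 4 = 1" "q mod 4 = 1"
  shows "Legendre (int p) (int q) = Legendre (int q) (int p)"
proof (cases "p = q")
  case False
  have "p \<noteq> 2" "q \<noteq> 2" "p \<ge> 2" "q \<ge> 2" using assms by (auto simp: prime_ge_2_nat)
  then have p: "2 < p" "2 < q" by simp_all
  have e: "even ((p - 1) div 2)" using assms(3) by presburger
  have "Legendre p q * Legendre q p = (-1) ^ ((p - 1) div 2 * ((q - 1) div 2))"
    using Quadratic_Reciprocity assms p False by blast
  with e have "Legendre p q * Legendre q p = 1" by simp
  with legendre_cases[of p q] legendre_cases[of q p] show ?thesis by auto
qed simp

text \<open>Square roots modulo the single primes are glued by the Chinese remainder theorem; since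
  \<open>S\<close> is a set, the moduli are distinct and hence coprime.\<close>

lemma sqrt_mod_prod:
  fixes M :: int
  assumes "finite S" "\<And>p. p \<in> S \<Longrightarrow> prime p" "\<And>p. p \<in> S \<Longrightarrow> QuadRes (int p) M"
  shows "\<exists>s. (\<Prod>p\<in>S. int p) dvd s\<^sup>2 - M"
  using assms
proof (induction S)
  case (insert p S)
  then obtain s where s: "(\<Prod>p\<in>S. int p) dvd s\<^sup>2 - M" by auto
  obtain r where r: "[r\<^sup>2 = M] (mod int p)"
    using insert.prems by (auto simp: QuadRes_def)
  have "coprime (int p) (\<Prod>p\<in>S. int p)"
    using insert by (intro prod_coprime_right) (metis coprime_int_iff insertCI primes_coprime)
  then obtain x where x: "[x = r] (mod int p)" "[x = s] (mod (\<Prod>p\<in>S. int p))"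
    using binary_chinese_remainder_int by blast
  have "int p dvd x\<^sup>2 - M"
    using x(1) r by (metis cong_iff_dvd_diff cong_pow cong_trans)
  moreover have "(\<Prod>p\<in>S. int p) dvd x\<^sup>2 - M"
    using x(2) s by (metis cong_iff_dvd_diff cong_pow cong_trans)
  ultimately have "int p * (\<Prod>p\<in>S. int p) dvd x\<^sup>2 - M"
    using \<open>coprime _ _\<close> by (simp add: divides_mult)
  then show ?case using insert by auto
qed simp

lemma floor_sqrt_ex: "\<exists>X::nat. X\<^sup>2 \<le> N \<and> N < (X + 1)\<^sup>2"
proof -
  define X where "X = Max {x. x\<^sup>2 \<le> N}"
  have f: "finite {x. x\<^sup>2 \<le> N}"
    by (rule finite_subset[of _ "{..N}"]) (auto simp: power2_eq_square intro: order_trans[OF le_square])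
  have "X \<in> {x. x\<^sup>2 \<le> N}" unfolding X_def using f by (intro Max_in) (auto intro: exI[of _ 0])
  moreover have "\<not> (X + 1)\<^sup>2 \<le> N"
  proof
    assume "(X + 1)\<^sup>2 \<le> N"
    then have "X + 1 \<le> X" unfolding X_def using f by (intro Max_ge) auto
    then show False by simp
  qed
  ultimately show ?thesis by auto
qed

text \<open>The box in the pigeonhole argument has side lengths \<open>sqrt (2BC)\<close>, \<open>sqrt (2AC)\<close> and
  \<open>2 sqrt (AB)\<close>; together with the conditions modulo 2 it makes the quadratic form divisible
  by \<open>4ABC\<close> and smaller than \<open>4ABC\<close> in absolute value.\<close>

lemma legendre_conic:
  fixes A B C :: nat
  assumes pos: "A > 0" "B > 0" "C > 0"
    and cop: "coprime A B" "coprime A C" "coprime B C"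
    and mod4: "A mod 4 = 1" "B mod 4 = 1" "C mod 4 = 1"
    and s1: "int A dvd int B * s1\<^sup>2 - int C"
    and s2: "int B dvd int A * s2\<^sup>2 - int C"
    and s3: "int C dvd int A * s3\<^sup>2 + int B"
    and nsq: "\<And>m. m\<^sup>2 \<noteq> A * B"
  shows "\<exists>x y z::int. (x, y, z) \<noteq> (0, 0, 0) \<and> int A * x\<^sup>2 + int B * y\<^sup>2 = int C * z\<^sup>2"
proof -
  obtain X where X: "X\<^sup>2 \<le> 2 * B * C" "2 * B * C < (X + 1)\<^sup>2" using floor_sqrt_ex by blast
  obtain Y where Y: "Y\<^sup>2 \<le> 2 * A * C" "2 * A * C < (Y + 1)\<^sup>2" using floor_sqrt_ex by blast
  obtain Z where Z: "Z\<^sup>2 \<le> 4 * A * B" "4 * A * B < (Z + 1)\<^sup>2" using floor_sqrt_ex by blast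
  have odd: "odd A" "odd B" "odd C" using mod4 by presburger+
  \<comment> \<open>Equality has to be excluded for \<open>X\<close> and for \<open>Z\<close>:
    strictness in \<open>X\<close> rules out V = 4ABC at the end, strictness in \<open>Z\<close>
    rules out V = -4ABC. Here 2BC has exactly one factor 2.\<close>
  have "X\<^sup>2 \<noteq> 2 * B * C"
  proof
    assume e: "X\<^sup>2 = 2 * B * C"
    then have "even X" by (metis dvd_triv_left even_power mult.assoc)
    then obtain w where "X = 2 * w" by blast
    with e have "2 * w\<^sup>2 = B * C" by (simp add: power_mult_distrib)
    then have "even (B * C)" by (metis dvd_triv_left)
    then show False using odd by simp
  qed
  with X have X': "X\<^sup>2 < 2 * B * C" by simp
  have "Z\<^sup>2 \<noteq> 4 * A * B"
  proof
    assume e: "Z\<^sup>2 = 4 * A * B"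
    then have "even Z" by (metis dvd_triv_left even_power mult.assoc mult_2 numeral_Bit0 even_add even_mult_iff)
    then obtain w where "Z = 2 * w" by blast
    with e have "w\<^sup>2 = A * B" by (simp add: power_mult_distrib)
    then show False using nsq by blast
  qed
  with Z have Z': "Z\<^sup>2 < 4 * A * B" by simp
  define box where "box = {0..int X} \<times> {0..int Y} \<times> {0..int Z}"
  \<comment> \<open>For the difference of two points with equal \<open>f\<close>, the first three
    components make the form vanish modulo each coefficient. The last two make x even and y - z
    even, which gives divisibility by 4 because B and C agree modulo 4.\<close>
  define f where "f = (\<lambda>(x, y, z). ((y - s1 * z) mod int A, (x - s2 * z) mod int B,
      (x - s3 * y) mod int C, x mod 2, (y - z) mod 2))"
  define T where "T = {0..<int A} \<times> {0..<int B} \<times> {0..<int C} \<times> {0..<2::int} \<times> {0..<2::int}"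
  have cT: "card T = 4 * A * B * C" by (simp add: T_def)
  have cbox: "card box = (X + 1) * (Y + 1) * (Z + 1)" by (simp add: box_def nat_add_distrib algebra_simps)
  \<comment> \<open>The product of the three side lengths is exactly 4ABC, the number of classes in
    \<open>T\<close>; a side of floor X contains X + 1 integers, and this gives the strict
    inequality for the pigeonhole principle.\<close>
  have "(4 * A * B * C)\<^sup>2 = (2 * B * C) * (2 * A * C) * (4 * A * B)"
    by (simp add: power2_eq_square algebra_simps)
  also have "\<dots> < (X + 1)\<^sup>2 * (Y + 1)\<^sup>2 * (Z + 1)\<^sup>2"
    using X(2) Y(2) Z(2) pos by (intro mult_strict_mono) auto
  also have "\<dots> = ((X + 1) * (Y + 1) * (Z + 1))\<^sup>2" by (simp only: power_mult_distrib)
  finally have "card T < card box" unfolding cT cbox by (rule power2_less_imp_less) simp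
  moreover have "f ` box \<subseteq> T" using pos by (auto simp: f_def T_def box_def)
  moreover have "finite T" by (simp add: T_def)
  ultimately have "card (f ` box) < card box" using card_mono by (meson le_less_trans)
  then have "\<not> inj_on f box" by (rule pigeonhole)
  then obtain u v where "u \<in> box" "v \<in> box" "u \<noteq> v" "f u = f v"
    unfolding inj_on_def by blast
  then obtain x0 y0 z0 x1 y1 z1 where in0: "(x0, y0, z0) \<in> box" and in1: "(x1, y1, z1) \<in> box"
    and ne: "(x0, y0, z0) \<noteq> (x1, y1, z1)" and eq: "f (x0, y0, z0) = f (x1, y1, z1)"
    by (metis prod_cases3)
  define x where "x = x0 - x1"
  define y where "y = y0 - y1"
  define z where "z = z0 - z1"
  have nz: "(x, y, z) \<noteq> (0, 0, 0)" using ne by (auto simp: x_def y_def z_def)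
  have "int A dvd (y0 - s1 * z0) - (y1 - s1 * z1)" "int B dvd (x0 - s2 * z0) - (x1 - s2 * z1)"
    "int C dvd (x0 - s3 * y0) - (x1 - s3 * y1)" "2 dvd x0 - x1" "2 dvd (y0 - z0) - (y1 - z1)"
    using eq by (auto simp: f_def mod_eq_dvd_iff)
  then have dA: "int A dvd y - s1 * z" and dB: "int B dvd x - s2 * z"
    and dC: "int C dvd x - s3 * y" and d2: "2 dvd x" and d2': "2 dvd y - z"
    by (simp_all add: x_def y_def z_def algebra_simps)
  define V where "V = int A * x\<^sup>2 + int B * y\<^sup>2 - int C * z\<^sup>2"
  have "V = int A * x\<^sup>2 + int B * (y - s1 * z) * (y + s1 * z) + (int B * s1\<^sup>2 - int C) * z\<^sup>2"
    by (simp add: V_def power2_eq_square algebra_simps)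
  then have VA: "int A dvd V" using dA s1 by simp
  have "V = int B * y\<^sup>2 + int A * (x - s2 * z) * (x + s2 * z) + (int A * s2\<^sup>2 - int C) * z\<^sup>2"
    by (simp add: V_def power2_eq_square algebra_simps)
  then have VB: "int B dvd V" using dB s2 by simp
  have "V = int A * (x - s3 * y) * (x + s3 * y) + (int A * s3\<^sup>2 + int B) * y\<^sup>2 - int C * z\<^sup>2"
    by (simp add: V_def power2_eq_square algebra_simps)
  then have VC: "int C dvd V" using dC s3 by simp
  have V4: "4 dvd V"
  proof -
    obtain u where u: "x = 2 * u" using d2 by blast
    obtain w where "y - z = 2 * w" using d2' by blast
    then have w: "y = z + 2 * w" by simp
    have "4 dvd int B - int C" using mod4 by presburger
    moreover have "V = 4 * (int A * u\<^sup>2 + int B * w * z + int B * w\<^sup>2) + (int B - int C) * z\<^sup>2"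
      by (simp add: V_def u w power2_eq_square algebra_simps)
    ultimately show ?thesis by simp
  qed
  have "int A * int B dvd V" using VA VB cop by (intro divides_mult) auto
  then have "int A * int B * int C dvd V" using VC cop by (intro divides_mult) auto
  moreover have "coprime (int A * int B * int C) 4"
  proof -
    have "coprime (int A * int B * int C) 2" using odd by simp
    then have "coprime (int A * int B * int C) (2 ^ 2)"
      by (simp only: coprime_power_right_iff) simp
    then show ?thesis by simp
  qed
  ultimately have dvd: "int A * int B * int C * 4 dvd V" using V4 divides_mult by blast
  have ax: "\<bar>x\<bar> \<le> int X" "\<bar>y\<bar> \<le> int Y" "\<bar>z\<bar> \<le> int Z"
    using in0 in1 by (auto simp: box_def x_def y_def z_def)
  have "x\<^sup>2 \<le> (int X)\<^sup>2" "y\<^sup>2 \<le> (int Y)\<^sup>2" "z\<^sup>2 \<le> (int Z)\<^sup>2"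
    using ax by (metis abs_of_nat abs_le_square_iff)+
  moreover have "(int X)\<^sup>2 < 2 * int B * int C" "(int Y)\<^sup>2 \<le> 2 * int A * int C"
     "(int Z)\<^sup>2 < 4 * int A * int B"
    using X' Y Z' by (metis of_nat_less_iff of_nat_le_iff of_nat_mult of_nat_power of_nat_numeral)+
  ultimately have b: "x\<^sup>2 < 2 * int B * int C" "y\<^sup>2 \<le> 2 * int A * int C" "z\<^sup>2 < 4 * int A * int B"
    by linarith+
  define W where "W = int A * int B * int C"
  have "int A * x\<^sup>2 < int A * (2 * int B * int C)" "int B * y\<^sup>2 \<le> int B * (2 * int A * int C)"
    "int C * z\<^sup>2 < int C * (4 * int A * int B)"
    using b pos by simp_all
  then have "int A * x\<^sup>2 < 2 * W" "int B * y\<^sup>2 \<le> 2 * W" "int C * z\<^sup>2 < 4 * W"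
    by (simp_all add: W_def algebra_simps)
  moreover have "0 \<le> int A * x\<^sup>2" "0 \<le> int B * y\<^sup>2" "0 \<le> int C * z\<^sup>2" by simp_all
  ultimately have "V < W * 4" "- V < W * 4" unfolding V_def by linarith+
  then have "\<bar>V\<bar> < W * 4" by linarith
  moreover have "W * 4 dvd V" using dvd by (simp add: W_def)
  ultimately have "V = 0"
    by (metis abs_ge_self dvd_imp_le_int linorder_not_less order_trans)
  then show ?thesis using nz unfolding V_def by (intro exI[of _ x] exI[of _ y] exI[of _ z]) auto
qed


text \<open>Multiplying the root by the inverse of \<open>B\<close> modulo \<open>A\<close> replaces
  BC by C / B. Symbols yield the hypothesis in the first form, while \<open>legendre_conic\<close>
  asks for the second.\<close>

lemma square_class_transfer:
  fixes A B C r :: int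
  assumes "coprime B A" "A dvd r\<^sup>2 - B * C"
  shows "\<exists>s. A dvd B * s\<^sup>2 - C"
proof -
  obtain w where "[B * w = 1] (mod A)" using cong_solve_coprime_int assms(1) by blast
  then have w: "A dvd B * w - 1" by (simp add: cong_iff_dvd_diff)
  have "B * (r * w)\<^sup>2 - C = B * w\<^sup>2 * (r\<^sup>2 - B * C) + C * (B * w + 1) * (B * w - 1)"
    by (simp add: power2_eq_square algebra_simps)
  then show ?thesis using w assms(2) by (intro exI[of _ "r * w"]) simp
qed

text \<open>By multiplicativity \<open>sym\<close> says that modulo each prime of one group the
  product of the other two coefficients is a square, which is the local condition of
  \<open>legendre_conic\<close> up to squares. At the third coefficient the condition concerns minus
  that product, and -1 is a square because all primes are 1 modulo 4. Group 3 may be empty; its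
  coefficient is then the empty product 1.\<close>

lemma conic_of_primes:
  fixes g p :: "'i \<Rightarrow> nat"
  assumes fin: "finite I" and inj: "inj_on p I" and pr: "\<And>i. i \<in> I \<Longrightarrow> prime (p i)"
    and p4: "\<And>i. i \<in> I \<Longrightarrow> p i mod 4 = 1" and g: "\<And>i. i \<in> I \<Longrightarrow> g i \<in> {1, 2, 3}"
    and ne: "i1 \<in> I" "g i1 = 1"
    and sym: "\<And>i. i \<in> I \<Longrightarrow> (\<Prod>j\<in>{j\<in>I. g j \<noteq> g i}. Legendre (p j) (p i)) = 1"
  shows "\<exists>x y z::int. (x, y, z) \<noteq> (0, 0, 0) \<and>
     int (\<Prod>i\<in>{i\<in>I. g i = 1}. p i) * x\<^sup>2 + int (\<Prod>i\<in>{i\<in>I. g i = 2}. p i) * y\<^sup>2 =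
     int (\<Prod>i\<in>{i\<in>I. g i = 3}. p i) * z\<^sup>2"
proof -
  define A where "A = (\<lambda>k. \<Prod>i\<in>{i\<in>I. g i = k}. p i)"
  have gt2: "2 < p i" if "i \<in> I" for i
  proof -
    have "p i \<noteq> 2" using p4[OF that] by auto
    with prime_ge_2_nat[OF pr[OF that]] show ?thesis by simp
  qed
  have cop: "coprime (A k) (A l)" if "k \<noteq> l" for k l
    unfolding A_def
  proof (intro prod_coprime_left prod_coprime_right)
    fix i j assume ij: "i \<in> {i\<in>I. g i = k}" "j \<in> {i\<in>I. g i = l}"
    with that have "i \<noteq> j" by auto
    with inj ij have "p i \<noteq> p j" by (auto simp: inj_on_def)
    with ij pr show "coprime (p i) (p j)" by (auto intro: primes_coprime)
  qed
  have mod4: "A k mod 4 = 1" for k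
  proof -
    have "finite S \<Longrightarrow> (\<And>i. i \<in> S \<Longrightarrow> p i mod 4 = 1) \<Longrightarrow> (\<Prod>i\<in>S. p i) mod 4 = 1" for S
      by (induction S rule: finite_induct) (auto simp: mod_mult_eq[symmetric] simp del: mod_mult_eq)
    from this[of "{i\<in>I. g i = k}"] show ?thesis unfolding A_def using fin p4 by simp
  qed
  have pos: "A k > 0" for k using mod4[of k] by (cases "A k = 0") auto
  have root: "\<exists>s. int (A k) dvd s\<^sup>2 - M"
    if "\<And>i. i \<in> I \<Longrightarrow> g i = k \<Longrightarrow> Legendre M (p i) = 1" for k M
  proof -
    have "\<exists>s. (\<Prod>q\<in>p ` {i\<in>I. g i = k}. int q) dvd s\<^sup>2 - M"
    proof (rule sqrt_mod_prod)
      fix q assume "q \<in> p ` {i\<in>I. g i = k}"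
      then obtain i where i: "i \<in> I" "g i = k" "q = p i" by auto
      then show "prime q" "QuadRes (int q) M"
        using pr that[of i] by (auto simp: Legendre_def split: if_splits)
    qed (use fin in auto)
    moreover have "inj_on p {i\<in>I. g i = k}" using inj by (auto simp: inj_on_def)
    ultimately show ?thesis by (simp add: A_def prod.reindex)
  qed
  have LA: "Legendre (int (A k) * int (A l)) (p i) = 1"
    if "i \<in> I" "{k, l, g i} = {1, 2, 3}" for i k l
  proof -
    have "k \<noteq> l" "k \<noteq> g i" "l \<noteq> g i" 
      using arg_cong[OF that(2), of card] by (auto simp: card_insert_if split: if_splits)
    then have "{j\<in>I. g j \<noteq> g i} = {j\<in>I. g j = k} \<union> {j\<in>I. g j = l}" using g that by auto
    then have "1 = (\<Prod>j\<in>{j\<in>I. g j = k} \<union> {j\<in>I. g j = l}. Legendre (p j) (p i))"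
      using sym[OF that(1)] by simp
    also have "\<dots> = (\<Prod>j\<in>{j\<in>I. g j = k}. Legendre (p j) (p i)) * (\<Prod>j\<in>{j\<in>I. g j = l}. Legendre (p j) (p i))"
      using fin \<open>k \<noteq> l\<close> by (intro prod.union_disjoint) auto
    also have "\<dots> = Legendre (int (A k)) (p i) * Legendre (int (A l)) (p i)"
      using pr[OF that(1)] gt2[OF that(1)] by (simp add: A_def legendre_prod)
    finally show ?thesis using pr[OF that(1)] gt2[OF that(1)] by (simp add: legendre_mult)
  qed
  have "\<exists>s. int (A 1) dvd int (A 2) * s\<^sup>2 - int (A 3)"
  proof -
    have "Legendre (int (A 2) * int (A 3)) (p i) = 1" if "i \<in> I" "g i = 1" for i
      using LA[OF that(1), of 2 3] that(2) by (simp add: insert_commute)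
    then obtain r where "int (A 1) dvd r\<^sup>2 - int (A 2) * int (A 3)"
      using root[of 1 "int (A 2) * int (A 3)"] by blast
    then show ?thesis using cop[of 2 1] by (intro square_class_transfer) auto
  qed
  then obtain s1 where s1: "int (A 1) dvd int (A 2) * s1\<^sup>2 - int (A 3)" ..
  have "\<exists>s. int (A 2) dvd int (A 1) * s\<^sup>2 - int (A 3)"
  proof -
    have "Legendre (int (A 1) * int (A 3)) (p i) = 1" if "i \<in> I" "g i = 2" for i
      using LA[OF that(1), of 1 3] that(2) by (simp add: insert_commute)
    then obtain r where "int (A 2) dvd r\<^sup>2 - int (A 1) * int (A 3)"
      using root[of 2 "int (A 1) * int (A 3)"] by blast
    then show ?thesis using cop[of 1 2] by (intro square_class_transfer) auto
  qed
  then obtain s2 where s2: "int (A 2) dvd int (A 1) * s2\<^sup>2 - int (A 3)" ..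
  have "\<exists>s. int (A 3) dvd int (A 1) * s\<^sup>2 - (- int (A 2))"
  proof -
    have "Legendre (int (A 1) * - int (A 2)) (p i) = 1" if "i \<in> I" "g i = 3" for i
    proof -
      have "Legendre (- 1 * (int (A 1) * int (A 2))) (p i) =
          Legendre (- 1) (p i) * Legendre (int (A 1) * int (A 2)) (p i)"
        using pr[OF that(1)] gt2[OF that(1)] by (rule legendre_mult)
      also have "\<dots> = 1" using LA[OF that(1), of 1 2] that pr p4 by (simp add: legendre_minus_one insert_commute)
      finally show ?thesis by simp
    qed
    then obtain r where "int (A 3) dvd r\<^sup>2 - int (A 1) * - int (A 2)"
      using root[of 3 "int (A 1) * - int (A 2)"] by blast
    then show ?thesis using cop[of 1 3] by (intro square_class_transfer) auto
  qed
  then obtain s3 where s3: "int (A 3) dvd int (A 1) * s3\<^sup>2 + int (A 2)" by auto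
  \<comment> \<open>As \<open>p\<close> is injective, \<open>p i1\<close> divides \<open>A 1\<close>
    exactly once and does not divide \<open>A 2\<close>.\<close>
  have nsq: "m\<^sup>2 \<noteq> A 1 * A 2" for m
  proof
    assume m: "m\<^sup>2 = A 1 * A 2"
    define R where "R = (\<Prod>i\<in>{i\<in>I. g i = 1} - {i1}. p i)"
    have A1: "A 1 = p i1 * R" unfolding A_def R_def using ne fin by (intro prod.remove) auto
    have "p i1 dvd m" using m A1 ne pr by (metis dvd_mult2 dvd_triv_left prime_dvd_power)
    then obtain w where "m = p i1 * w" by blast
    with m A1 have "p i1 * (p i1 * w\<^sup>2) = p i1 * (R * A 2)" by (simp add: power2_eq_square algebra_simps)
    then have "p i1 * w\<^sup>2 = R * A 2" using gt2[OF ne(1)] by simp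
    then have "p i1 dvd R * A 2" by (metis dvd_triv_left)
    moreover have "coprime (p i1) (R * A 2)"
    proof -
      have "coprime (p i1) R" unfolding R_def
        using ne inj pr by (intro prod_coprime_right primes_coprime) (auto simp: inj_on_def)
      moreover have "coprime (p i1) (A 2)" using cop[of 1 2] A1 by simp
      ultimately show ?thesis by simp
    qed
    ultimately have "is_unit (p i1)" by (metis coprime_absorb_left)
    then show False using gt2[OF ne(1)] by simp
  qed
  have "\<exists>x y z::int. (x, y, z) \<noteq> (0, 0, 0) \<and> int (A 1) * x\<^sup>2 + int (A 2) * y\<^sup>2 = int (A 3) * z\<^sup>2"
    using pos cop mod4 s1 s2 s3 nsq by (intro legendre_conic) auto
  then show ?thesis by (simp add: A_def)
qed

section \<open>Bilinear sums of Legendre symbols\<close>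

lemma power2_sum_le:
  fixes f :: "'a \<Rightarrow> real"
  shows "(\<Sum>x\<in>S. f x)\<^sup>2 \<le> real (card S) * (\<Sum>x\<in>S. (f x)\<^sup>2)"
  using Cauchy_Schwarz_ineq_sum[of "\<lambda>_. 1" f S] by simp

text \<open>If every residue had a square root, squaring would be surjective and hence injective on
  the finite set of residues; but 1 and -1 have the same square.\<close>

lemma nonresidue_exists:
  fixes q :: nat
  assumes "prime q" "2 < q"
  shows "\<exists>a. Legendre a (int q) = -1"
proof (rule ccontr)
  assume "\<nexists>a. Legendre a (int q) = -1"
  then have L: "Legendre a q = 0 \<or> Legendre a q = 1" for a using legendre_cases[of a q] by auto
  define h where "h = (\<lambda>y::int. y\<^sup>2 mod int q)"
  have "{0..<int q} \<subseteq> h ` {0..<int q}"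
  proof
    fix a assume a: "a \<in> {0..<int q}"
    have "\<exists>y. [y\<^sup>2 = a] (mod int q)"
    proof (cases "Legendre a q = 0")
      case True
      then have "[0\<^sup>2 = a] (mod int q)" by (simp add: legendre_eq_0_iff cong_iff_dvd_diff)
      then show ?thesis by blast
    next
      case False
      with L have "Legendre a q = 1" by blast
      then show ?thesis by (auto simp: Legendre_def QuadRes_def split: if_splits)
    qed
    then obtain y where "[y\<^sup>2 = a] (mod int q)" by blast
    then have "h (y mod int q) = a" using a by (simp add: h_def Cong.cong_def power_mod)
    moreover have "y mod int q \<in> {0..<int q}" using assms by simp
    ultimately show "a \<in> h ` {0..<int q}" by blast
  qed
  then have "inj_on h {0..<int q}"
    by (metis (no_types, lifting) eq_card_imp_inj_on card_image_le card_mono finite_atLeastLessThan_int finite_imageI le_antisym)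
  moreover have "h 1 = h (int q - 1)"
  proof -
    have "int q dvd (int q - 1)\<^sup>2 - 1\<^sup>2"
      by (simp add: power2_eq_square algebra_simps)
    then show ?thesis by (simp add: h_def mod_eq_dvd_iff dvd_diff_commute)
  qed
  ultimately have "1 = int q - 1" using assms by (auto simp: inj_on_def)
  with assms show False by simp
qed

text \<open>Full periods cancel, and at most \<open>m\<close> terms of an incomplete one
  remain.\<close>

lemma sum_periodic_le:
  fixes f :: "nat \<Rightarrow> real"
  assumes m: "m > 0" and per: "\<And>n. f (n + m) = f n" and zero: "(\<Sum>n<m. f n) = 0"
    and bd: "\<And>n. \<bar>f n\<bar> \<le> 1"
  shows "\<bar>\<Sum>n<N. f n\<bar> \<le> real m"
proof (induction N rule: less_induct)
  case (less N)
  show ?case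
  proof (cases "N \<le> m")
    case True
    have "\<bar>\<Sum>n<N. f n\<bar> \<le> (\<Sum>n<N. \<bar>f n\<bar>)" by (rule sum_abs)
    also have "\<dots> \<le> (\<Sum>n<N. 1)" by (intro sum_mono bd)
    finally show ?thesis using True by simp
  next
    case False
    define M where "M = N - m"
    have N: "N = M + m" using False by (simp add: M_def)
    have "(\<Sum>n<N. f n) = (\<Sum>n<m. f n) + (\<Sum>n=m..<N. f n)"
      using False by (simp add: atLeast0LessThan[symmetric] sum.atLeastLessThan_concat)
    also have "(\<Sum>n=m..<N. f n) = (\<Sum>n<M. f (n + m))"
      unfolding N by (simp add: sum.shift_bounds_nat_ivl[of f 0 m M, simplified] atLeast0LessThan)
    finally have "(\<Sum>n<N. f n) = (\<Sum>n<M. f n)" by (simp add: zero per)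
    moreover have "M < N" using m N by simp
    ultimately show ?thesis using less.IH by simp
  qed
qed

text \<open>The product of the two symbols is a nontrivial character modulo \<open>q * r\<close>. It
  sums to zero over a period, and an incomplete period is bounded by its length.\<close>

lemma legendre_pair_sum:
  fixes q r :: nat
  assumes q: "prime q" "2 < q" and r: "prime r" "2 < r" and ne: "q \<noteq> r"
  shows "\<bar>\<Sum>m<N. real_of_int (Legendre (int m) q * Legendre (int m) r)\<bar> \<le> real (q * r)"
proof -
  define F where "F = (\<lambda>m::int. Legendre m q * Legendre m r)"
  define f where "f = (\<lambda>m::nat. real_of_int (F (int m)))"
  have pos: "q * r > 0" using q r by simp
  have cop: "coprime q r" using q r ne by (simp add: primes_coprime)
  have Fc: "F x = F y" if "[x = y] (mod int (q * r))" for x y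
  proof -
    have "[x = y] (mod int q)" "[x = y] (mod int r)"
      using that by (auto intro: cong_dvd_modulus)
    then show ?thesis unfolding F_def using legendre_cong by metis
  qed
  obtain a where a: "Legendre a q = -1" using nonresidue_exists q by blast
  \<comment> \<open>A nonresidue modulo \<open>q\<close> that is 1 modulo \<open>r\<close>:
    multiplication by \<open>b\<close> permutes the residues modulo \<open>q * r\<close> and changes
    the sign of \<open>F\<close>, so the complete sum equals its own negative.\<close>
  obtain b where b: "[b = a] (mod int q)" "[b = 1] (mod int r)"
    using binary_chinese_remainder_int cop by (metis coprime_int_iff)
  have Lb: "Legendre b q = -1" "Legendre b r = 1"
    using legendre_cong[OF b(1)] legendre_cong[OF b(2)] a legendre_1 r by auto
  have Fb: "F (b * x) = - F x" for x
    using Lb q r by (simp add: F_def legendre_mult)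
  define M where "M = int (q * r)"
  have M: "M > 0" using pos by (simp add: M_def)
  have copb: "coprime b M"
  proof -
    have "\<not> int q dvd b" "\<not> int r dvd b" using Lb by (auto simp: legendre_eq_0_iff[symmetric])
    then have "coprime (int q) b" "coprime (int r) b"
      using prime_imp_coprime[of "int q" b] prime_imp_coprime[of "int r" b] q r by simp_all
    then show ?thesis by (simp add: M_def coprime_commute)
  qed
  have inj: "inj_on (\<lambda>x. b * x mod M) {0..<M}"
  proof (rule inj_onI)
    fix x y assume xy: "x \<in> {0..<M}" "y \<in> {0..<M}" "b * x mod M = b * y mod M"
    then have "[b * x = b * y] (mod M)" by (simp add: Cong.cong_def)
    then have "[x = y] (mod M)" using copb by (simp add: cong_mult_lcancel coprime_commute)
    then show "x = y" using xy by (simp add: Cong.cong_def)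
  qed
  have "(\<lambda>x. b * x mod M) ` {0..<M} = {0..<M}"
    using inj M by (intro endo_inj_surj) auto
  then have "(\<Sum>x\<in>{0..<M}. F x) = (\<Sum>x\<in>(\<lambda>x. b * x mod M) ` {0..<M}. F x)" by simp
  also have "\<dots> = (\<Sum>x\<in>{0..<M}. F (b * x mod M))" using inj by (simp add: sum.reindex)
  also have "\<dots> = (\<Sum>x\<in>{0..<M}. - F x)"
    by (intro sum.cong refl) (metis Fb Fc M_def cong_mod_left cong_refl)
  also have "\<dots> = - (\<Sum>x\<in>{0..<M}. F x)" by (simp add: sum_negf)
  finally have z: "(\<Sum>x\<in>{0..<M}. F x) = 0" by simp
  have "(\<Sum>m<q * r. f m) = real_of_int (\<Sum>m<q * r. F (int m))" by (simp add: f_def)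
  also have "(\<Sum>m<q * r. F (int m)) = (\<Sum>x\<in>int ` {..<q * r}. F x)" by (simp add: sum.reindex)
  also have "int ` {..<q * r} = {0..<M}" by (simp add: M_def image_int_atLeastLessThan lessThan_atLeast0)
  finally have zero: "(\<Sum>m<q * r. f m) = 0" using z by simp
  have per: "f (m + q * r) = f m" for m
    unfolding f_def by (intro arg_cong[of _ _ real_of_int] Fc) (simp add: Cong.cong_def)
  have bd: "\<bar>f m\<bar> \<le> 1" for m
    using legendre_cases[of "int m" q] legendre_cases[of "int m" r] by (auto simp: f_def F_def)
  have "\<bar>\<Sum>m<N. f m\<bar> \<le> real (q * r)"
    using pos per zero bd by (rule sum_periodic_le)
  then show ?thesis by (simp add: f_def F_def)
qed


text \<open>Two applications of Cauchy-Schwarz in \<open>q\<close> produce the fourth power of the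
  inner sum, which by multiplicativity is a sum of symbols of products of four primes; a third one
  over the quadruples opens a square into pairs \<open>q, r\<close>. Quadruples make the bound
  effective for sets of comparable size: the off-diagonal part then needs Y^2 to be small against
  \<open>card P ^ 4\<close>, whereas pairs of primes would only offer
  \<open>card P ^ 2\<close>.\<close>

lemma bilinear_legendre_sum:
  fixes P Q :: "nat set" and \<alpha> \<beta> :: "nat \<Rightarrow> real"
  assumes finP: "finite P" and P: "\<And>p. p \<in> P \<Longrightarrow> prime p \<and> p \<le> X"
    and finQ: "finite Q" and Q: "\<And>q. q \<in> Q \<Longrightarrow> prime q \<and> 2 < q \<and> q \<le> Y"
    and \<alpha>: "\<And>p. p \<in> P \<Longrightarrow> \<bar>\<alpha> p\<bar> \<le> 1" and \<beta>: "\<And>q. q \<in> Q \<Longrightarrow> \<bar>\<beta> q\<bar> \<le> 1"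
  shows "(\<Sum>p\<in>P. \<Sum>q\<in>Q. \<alpha> p * \<beta> q * real_of_int (Legendre p q)) ^ 8
     \<le> 256 * real (card Q) ^ 6 * real (card P) ^ 4 *
       (real (card Q) * (real X ^ 4 + 1) + real (card Q) ^ 2 * real Y ^ 2)"
proof -
  define L where "L = (\<lambda>(m::nat) (q::nat). real_of_int (Legendre m q))"
  define S where "S = (\<Sum>p\<in>P. \<Sum>q\<in>Q. \<alpha> p * \<beta> q * L p q)"
  define T where "T = (\<lambda>q. \<Sum>p\<in>P. \<alpha> p * L p q)"
  define U where "U = P \<times> P \<times> P \<times> P"
  define \<pi> where "\<pi> = (\<lambda>(a::nat, b, c, d). a * b * c * d)"
  define w where "w = (\<lambda>(a, b, c, d). \<alpha> a * \<alpha> b * \<alpha> c * \<alpha> d)"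
  define G where "G = (\<lambda>m. (\<Sum>q\<in>Q. L m q)\<^sup>2)"
  define N where "N = X ^ 4 + 1"
  have finU: "finite U" using finP by (simp add: U_def)
  have Lm: "L (a * b) q = L a q * L b q" if "q \<in> Q" for a b q
    using Q[OF that] by (simp add: L_def legendre_mult)
  have L1: "\<bar>L m q\<bar> \<le> 1" for m q using legendre_cases[of m q] by (auto simp: L_def)
  have "S = (\<Sum>q\<in>Q. \<beta> q * T q)"
    unfolding S_def T_def by (subst sum.swap) (simp add: sum_distrib_left mult_ac)
  then have "S\<^sup>2 \<le> (\<Sum>q\<in>Q. (\<beta> q)\<^sup>2) * (\<Sum>q\<in>Q. (T q)\<^sup>2)"
    using Cauchy_Schwarz_ineq_sum[of \<beta> T Q] by simp
  also have "(\<Sum>q\<in>Q. (\<beta> q)\<^sup>2) \<le> (\<Sum>q\<in>Q. 1)"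
    using \<beta> by (intro sum_mono) (simp add: abs_square_le_1)
  finally have S2: "S\<^sup>2 \<le> real (card Q) * (\<Sum>q\<in>Q. (T q)\<^sup>2)"
    by (simp add: mult_right_mono sum_nonneg)
  have "S ^ 4 = (S\<^sup>2)\<^sup>2" by simp
  also have "\<dots> \<le> (real (card Q) * (\<Sum>q\<in>Q. (T q)\<^sup>2))\<^sup>2"
    using S2 by (intro power_mono) auto
  also have "\<dots> = real (card Q) ^ 2 * (\<Sum>q\<in>Q. (T q)\<^sup>2)\<^sup>2" by (simp add: power_mult_distrib)
  also have "\<dots> \<le> real (card Q) ^ 2 * (real (card Q) * (\<Sum>q\<in>Q. ((T q)\<^sup>2)\<^sup>2))"
    by (intro mult_left_mono power2_sum_le) auto
  finally have S4: "S ^ 4 \<le> real (card Q) ^ 3 * (\<Sum>q\<in>Q. T q ^ 4)"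
    by (simp add: power3_eq_cube power2_eq_square power4_eq_xxxx mult_ac)
  have "T q ^ 4 = (\<Sum>u\<in>U. w u * L (\<pi> u) q)" if "q \<in> Q" for q
  proof -
    have "T q ^ 4 = T q * (T q * (T q * T q))" by (simp add: power4_eq_xxxx)
    also have "\<dots> = (\<Sum>u\<in>U. case u of (a, b, c, d) \<Rightarrow>
        (\<alpha> a * L a q) * ((\<alpha> b * L b q) * ((\<alpha> c * L c q) * (\<alpha> d * L d q))))"
      by (simp add: T_def U_def sum_product sum.cartesian_product case_prod_beta)
    also have "\<dots> = (\<Sum>u\<in>U. w u * L (\<pi> u) q)"
      using that by (intro sum.cong refl) (auto simp: w_def \<pi>_def Lm mult_ac)
    finally show ?thesis .
  qed
  then have "(\<Sum>q\<in>Q. T q ^ 4) = (\<Sum>u\<in>U. w u * (\<Sum>q\<in>Q. L (\<pi> u) q))"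
    by (simp add: sum.swap[of _ U] sum_distrib_left)
  then have "(\<Sum>q\<in>Q. T q ^ 4)\<^sup>2 \<le> (\<Sum>u\<in>U. (w u)\<^sup>2) * (\<Sum>u\<in>U. (\<Sum>q\<in>Q. L (\<pi> u) q)\<^sup>2)"
    using Cauchy_Schwarz_ineq_sum[of w _ U] by simp
  also have "(\<Sum>u\<in>U. (w u)\<^sup>2) \<le> (\<Sum>u\<in>U. 1)"
  proof (intro sum_mono)
    fix u assume "u \<in> U"
    then have "\<bar>w u\<bar> \<le> 1" using \<alpha>
      by (auto simp: U_def w_def abs_mult intro!: mult_le_one)
    then show "(w u)\<^sup>2 \<le> 1" by (simp add: abs_square_le_1)
  qed
  also have "(\<Sum>u\<in>U. 1) = real (card P) ^ 4"
    by (simp add: U_def card_cartesian_product power4_eq_xxxx)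
  finally have T4: "(\<Sum>q\<in>Q. T q ^ 4)\<^sup>2 \<le> real (card P) ^ 4 * (\<Sum>u\<in>U. G (\<pi> u))"
    by (simp add: G_def mult_right_mono sum_nonneg)
  \<comment> \<open>All entries of a quadruple with product \<open>m\<close> are prime factors of
    \<open>m\<close>, of which there are at most four; this leaves at most 4^4 quadruples.\<close>
  have mult: "card {u \<in> U. \<pi> u = m} \<le> 256" if m: "m \<in> \<pi> ` U" for m
  proof -
    define F where "F = prime_factors m"
    obtain a b c d where abcd: "a \<in> P" "b \<in> P" "c \<in> P" "d \<in> P" "m = a * b * c * d"
      using m by (auto simp: U_def \<pi>_def)
    have nz: "m \<noteq> 0" using abcd P by (auto dest!: P dest: prime_gt_0_nat)
    have "F \<subseteq> {a, b, c, d}"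
    proof
      fix r assume "r \<in> F"
      then have "prime r" "r dvd a * b * c * d" using abcd by (auto simp: F_def in_prime_factors_iff)
      then have "r dvd a \<or> r dvd b \<or> r dvd c \<or> r dvd d" by (simp add: prime_dvd_mult_iff)
      moreover have "prime a" "prime b" "prime c" "prime d" using abcd P by auto
      ultimately show "r \<in> {a, b, c, d}"
        using primes_dvd_imp_eq[OF \<open>prime r\<close>] by auto
    qed
    then have "card F \<le> card {a, b, c, d}" by (intro card_mono) auto
    also have "\<dots> \<le> 4" by (simp add: card_insert_if)
    finally have F4: "card F \<le> 4" .
    have "{u \<in> U. \<pi> u = m} \<subseteq> F \<times> F \<times> F \<times> F"
      using nz P by (auto simp: U_def \<pi>_def F_def in_prime_factors_iff)
    then have "card {u \<in> U. \<pi> u = m} \<le> card (F \<times> F \<times> F \<times> F)"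
      by (intro card_mono) (auto simp: F_def)
    also have "\<dots> = card F ^ 4" by (simp add: card_cartesian_product power4_eq_xxxx)
    also have "\<dots> \<le> 4 ^ 4" using F4 by (intro power_mono) auto
    finally show ?thesis by simp
  qed
  have G0: "G m \<ge> 0" for m by (simp add: G_def)
  have "(\<Sum>u\<in>U. G (\<pi> u)) = (\<Sum>m\<in>\<pi> ` U. \<Sum>u\<in>{u\<in>U. \<pi> u = m}. G (\<pi> u))"
    using finU by (rule sum.image_gen)
  also have "\<dots> = (\<Sum>m\<in>\<pi> ` U. real (card {u\<in>U. \<pi> u = m}) * G m)"
    by (intro sum.cong refl) (simp add: mult.commute)
  also have "\<dots> \<le> (\<Sum>m\<in>\<pi> ` U. 256 * G m)"
    using mult G0 by (intro sum_mono mult_right_mono) force+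
  \<comment> \<open>As \<open>G\<close> is nonnegative, the sum may be extended from the sparse set
    of products to all integers up to X^4, where \<open>legendre_pair_sum\<close> applies.\<close>
  also have "\<dots> \<le> (\<Sum>m<N. 256 * G m)"
  proof (intro sum_mono2)
    show "\<pi> ` U \<subseteq> {..<N}"
    proof
      fix m assume "m \<in> \<pi> ` U"
      then obtain a b c d where abcd: "a \<in> P" "b \<in> P" "c \<in> P" "d \<in> P" "m = a * b * c * d"
        by (auto simp: U_def \<pi>_def)
      then have "m \<le> X * X * X * X" using P by (auto intro!: mult_mono)
      then show "m \<in> {..<N}" by (simp add: N_def power4_eq_xxxx)
    qed
  qed (auto simp: G0)
  also have "\<dots> = 256 * (\<Sum>m<N. G m)" by (simp add: sum_distrib_left)
  finally have GU: "(\<Sum>u\<in>U. G (\<pi> u)) \<le> 256 * (\<Sum>m<N. G m)" .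
  have "(\<Sum>m<N. G m) = (\<Sum>m<N. \<Sum>q\<in>Q. \<Sum>r\<in>Q. L m q * L m r)"
    by (simp add: G_def power2_eq_square sum_product)
  also have "\<dots> = (\<Sum>q\<in>Q. \<Sum>m<N. \<Sum>r\<in>Q. L m q * L m r)" by (rule sum.swap)
  also have "\<dots> = (\<Sum>q\<in>Q. \<Sum>r\<in>Q. \<Sum>m<N. L m q * L m r)" by (intro sum.cong refl sum.swap)
  also have "\<dots> \<le> (\<Sum>q\<in>Q. \<Sum>r\<in>Q. (if r = q then real N else 0) + real Y ^ 2)"
  proof (intro sum_mono)
    fix q r assume qr: "q \<in> Q" "r \<in> Q"
    show "(\<Sum>m<N. L m q * L m r) \<le> (if r = q then real N else 0) + real Y ^ 2"
    proof (cases "r = q")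
      case True
      have "(\<Sum>m<N. L m q * L m r) \<le> (\<Sum>m<N. 1)"
      proof (intro sum_mono)
        fix m
        have "\<bar>L m q * L m r\<bar> \<le> 1" using L1[of m q] L1[of m r] by (simp add: abs_mult mult_le_one)
        then show "L m q * L m r \<le> 1" by linarith
      qed
      then show ?thesis using True by (simp add: add_increasing2)
    next
      case False
      have "(\<Sum>m<N. L m q * L m r) \<le> real (q * r)"
        using legendre_pair_sum[of q r N] Q[OF qr(1)] Q[OF qr(2)] False by (simp add: L_def)
      also have "\<dots> \<le> real Y * real Y"
        unfolding of_nat_mult using Q[OF qr(1)] Q[OF qr(2)] by (intro mult_mono) auto
      finally show ?thesis using False by (simp add: power2_eq_square)
    qed
  qed
  also have "\<dots> = real (card Q) * real N + real (card Q) ^ 2 * real Y ^ 2"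
    using finQ by (simp add: sum.distrib power2_eq_square algebra_simps)
  finally have GN: "(\<Sum>m<N. G m) \<le> real (card Q) * real N + real (card Q) ^ 2 * real Y ^ 2" .
  have "S ^ 8 = (S ^ 4)\<^sup>2" by simp
  also have "\<dots> \<le> (real (card Q) ^ 3 * (\<Sum>q\<in>Q. T q ^ 4))\<^sup>2"
    using S4 by (intro power_mono) auto
  also have "\<dots> = real (card Q) ^ 6 * (\<Sum>q\<in>Q. T q ^ 4)\<^sup>2" by (simp add: power_mult_distrib)
  also have "\<dots> \<le> real (card Q) ^ 6 * (real (card P) ^ 4 * (256 *
      (real (card Q) * real N + real (card Q) ^ 2 * real Y ^ 2)))"
    using GN GU by (intro mult_left_mono order_trans[OF T4]) auto
  finally show ?thesis by (simp add: S_def L_def N_def mult_ac add_ac)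
qed

section \<open>Tuples of primes with prescribed symbols\<close>

lemma sum_PiE_insert:
  fixes f :: "('i \<Rightarrow> 'a) \<Rightarrow> 'b::comm_monoid_add"
  assumes "x \<notin> S"
  shows "(\<Sum>p\<in>PiE (insert x S) T. f p) = (\<Sum>y\<in>T x. \<Sum>g\<in>PiE S T. f (g(x := y)))"
proof -
  have "(\<Sum>p\<in>PiE (insert x S) T. f p) = (\<Sum>(y, g)\<in>T x \<times> PiE S T. f (g(x := y)))"
    unfolding PiE_insert_eq using inj_combinator[OF assms]
    by (subst sum.reindex) (auto simp: case_prod_beta o_def)
  then show ?thesis by (simp add: sum.cartesian_product)
qed

text \<open>By symmetry the factors for (i, j) and (j, i) combine to squares, and only the diagonal
  remains.\<close>

lemma prod_symmetric_nonneg: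
  fixes s :: "'i \<Rightarrow> 'i \<Rightarrow> real"
  assumes "finite S" "\<And>i j. i \<in> S \<Longrightarrow> j \<in> S \<Longrightarrow> s i j = s j i" "\<And>i. i \<in> S \<Longrightarrow> s i i \<ge> 0"
  shows "(\<Prod>i\<in>S. \<Prod>j\<in>S. s i j) \<ge> 0"
  using assms
proof (induction S)
  case (insert x S)
  have "(\<Prod>i\<in>insert x S. \<Prod>j\<in>insert x S. s i j) =
      s x x * (\<Prod>j\<in>S. s x j) * ((\<Prod>i\<in>S. s i x) * (\<Prod>i\<in>S. \<Prod>j\<in>S. s i j))"
    using insert.hyps by (simp add: prod.distrib)
  also have "(\<Prod>i\<in>S. s i x) = (\<Prod>j\<in>S. s x j)"
    using insert.prems by (intro prod.cong) auto
  also have "s x x * (\<Prod>j\<in>S. s x j) * ((\<Prod>j\<in>S. s x j) * (\<Prod>i\<in>S. \<Prod>j\<in>S. s i j)) =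
     s x x * ((\<Prod>j\<in>S. s x j)\<^sup>2 * (\<Prod>i\<in>S. \<Prod>j\<in>S. s i j))"
    by (simp add: power2_eq_square)
  also have "\<dots> \<ge> 0"
    using insert by (intro mult_nonneg_nonneg) auto
  finally show ?case .
qed simp

text \<open>The indicator of the symbol conditions is the product of the factors \<open>(1 + \<psi>\<^sub>i) / 2\<close>.  A
  proper nonempty set \<open>J\<close> of indices is joined to its complement by an edge of the complete
  multipartite graph given by \<open>g\<close>, and then the term of the expansion belonging to \<open>J\<close> is a
  bilinear sum.  The term of the full index set is nonnegative by quadratic reciprocity.\<close>

lemma card_symbol_tuples:
  fixes Q :: "'i \<Rightarrow> nat set" and g :: "'i \<Rightarrow> 'k"
  assumes fin: "finite I" and finQ: "\<And>i. i \<in> I \<Longrightarrow> finite (Q i)"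
    and Q: "\<And>i q. i \<in> I \<Longrightarrow> q \<in> Q i \<Longrightarrow> prime q \<and> q mod 4 = 1"
    and disj: "\<And>i j. i \<in> I \<Longrightarrow> j \<in> I \<Longrightarrow> i \<noteq> j \<Longrightarrow> Q i \<inter> Q j = {}"
    and two: "i1 \<in> I" "i2 \<in> I" "g i1 \<noteq> g i2"
    and bil: "\<And>i j \<alpha> \<beta>. i \<in> I \<Longrightarrow> j \<in> I \<Longrightarrow> i \<noteq> j \<Longrightarrow> (\<And>p. \<bar>\<alpha> p\<bar> \<le> 1) \<Longrightarrow> (\<And>p. \<bar>\<beta> p\<bar> \<le> 1) \<Longrightarrow>
      \<bar>\<Sum>p\<in>Q i. \<Sum>q\<in>Q j. \<alpha> p * \<beta> q * real_of_int (Legendre p q)\<bar> \<le> \<eta> * (real (card (Q i)) * real (card (Q j)))"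
    and \<eta>: "\<eta> \<ge> 0"
  shows "(1 - 2 ^ card I * \<eta>) * (\<Prod>i\<in>I. real (card (Q i))) \<le>
     2 ^ card I * real (card {p \<in> PiE I Q. \<forall>i\<in>I. (\<Prod>j\<in>{j\<in>I. g j \<noteq> g i}. Legendre (p j) (p i)) = 1})"
proof -
  define L where "L = (\<lambda>(m::nat) (q::nat). real_of_int (Legendre m q))"
  define N where "N = (\<lambda>i. {j\<in>I. g j \<noteq> g i})"
  define \<psi> where "\<psi> = (\<lambda>i p. \<Prod>j\<in>N i. L (p j) (p i))"
  define \<Omega> where "\<Omega> = PiE I Q"
  define good where "good = (\<lambda>p. \<forall>i\<in>I. (\<Prod>j\<in>N i. Legendre (int (p j)) (int (p i))) = 1)"
  define W where "W = (\<Prod>i\<in>I. real (card (Q i)))"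
  define tm where "tm = (\<lambda>J. \<Sum>p\<in>\<Omega>. \<Prod>i\<in>J. \<psi> i p)"
  have fin\<Omega>: "finite \<Omega>" using fin finQ by (auto simp: \<Omega>_def intro: finite_PiE)
  have L1: "\<bar>L m q\<bar> \<le> 1" for m q using legendre_cases[of m q] by (auto simp: L_def)
  have W0: "W \<ge> 0" by (simp add: W_def prod_nonneg)
  have \<psi>eq: "\<psi> i p = real_of_int (\<Prod>j\<in>N i. Legendre (int (p j)) (int (p i)))" for i p
    by (simp add: \<psi>_def L_def)
  have \<psi>pm: "\<psi> i p = 1 \<or> \<psi> i p = -1" if p: "p \<in> \<Omega>" and i: "i \<in> I" for i p
  proof -
    have "\<bar>L (p j) (p i)\<bar> = 1" if j: "j \<in> N i" for j
    proof -
      have ij: "j \<in> I" "i \<noteq> j" using j by (auto simp: N_def)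
      have pi: "p i \<in> Q i" "p j \<in> Q j" using p i ij by (auto simp: \<Omega>_def)
      then have "p i \<noteq> p j" using disj[OF i ij(1) ij(2)] by auto
      then have "\<not> p i dvd p j" using Q pi i ij by (metis primes_dvd_imp_eq)
      then have "Legendre (int (p j)) (int (p i)) \<noteq> 0" by (simp add: legendre_eq_0_iff)
      then show ?thesis using legendre_cases[of "p j" "p i"] by (auto simp: L_def)
    qed
    then have "\<bar>\<psi> i p\<bar> = 1" by (simp add: \<psi>_def abs_prod)
    then show ?thesis by linarith
  qed
  have ind: "(\<Prod>i\<in>I. 1 + \<psi> i p) = (if good p then 2 ^ card I else 0)" if p: "p \<in> \<Omega>" for p
  proof (cases "good p")
    case True
    then have "\<psi> i p = 1" if "i \<in> I" for i using that by (simp add: \<psi>eq good_def)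
    then show ?thesis using True by simp
  next
    case False
    then obtain i where i: "i \<in> I" "\<psi> i p \<noteq> 1" unfolding \<psi>eq good_def of_int_eq_1_iff by blast
    then have "1 + \<psi> i p = 0" using \<psi>pm[OF p i(1)] by auto
    then show ?thesis using False i fin by (auto intro: prod_zero)
  qed
  have "2 ^ card I * real (card {p\<in>\<Omega>. good p}) = (\<Sum>p\<in>\<Omega>. if good p then 2 ^ card I else 0)"
    using fin\<Omega> by (simp add: sum.If_cases Int_def)
  also have "\<dots> = (\<Sum>p\<in>\<Omega>. \<Prod>i\<in>I. 1 + \<psi> i p)" by (simp add: ind)
  also have "\<dots> = (\<Sum>p\<in>\<Omega>. \<Sum>J\<in>Pow I. \<Prod>i\<in>J. \<psi> i p)"
    using fin prod_add[of I "\<lambda>i. \<psi> i p" "\<lambda>_. 1" for p] by (simp add: add.commute)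
  also have "\<dots> = (\<Sum>J\<in>Pow I. tm J)" unfolding tm_def by (rule sum.swap)
  finally have E: "2 ^ card I * real (card {p\<in>\<Omega>. good p}) = (\<Sum>J\<in>Pow I. tm J)" .
  have t0: "tm {} = W" using fin by (simp add: tm_def W_def \<Omega>_def card_PiE)
  have tI: "tm I \<ge> 0" unfolding tm_def
  proof (intro sum_nonneg)
    fix p assume p: "p \<in> \<Omega>"
    define s where "s = (\<lambda>i j. if g j \<noteq> g i then L (p j) (p i) else 1)"
    have "(\<Prod>i\<in>I. \<psi> i p) = (\<Prod>i\<in>I. \<Prod>j\<in>I. s i j)"
      unfolding \<psi>_def s_def N_def using fin by (intro prod.cong[OF refl] prod.inter_filter)
    also have "\<dots> \<ge> 0"
    proof (rule prod_symmetric_nonneg)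
      fix i j assume ij: "i \<in> I" "j \<in> I"
      then have "p i \<in> Q i" "p j \<in> Q j" using p by (auto simp: \<Omega>_def)
      then show "s i j = s j i" using legendre_sym Q ij by (auto simp: s_def L_def)
    qed (auto simp: fin s_def)
    finally show "(\<Prod>i\<in>I. \<psi> i p) \<ge> 0" .
  qed
  have tJ: "- (\<eta> * W) \<le> tm J" if J: "J \<subseteq> I" "J \<noteq> {}" "J \<noteq> I" for J
  proof -
    have "\<exists>i\<in>J. \<exists>j\<in>I - J. g j \<noteq> g i"
    proof (rule ccontr)
      assume c: "\<not> (\<exists>i\<in>J. \<exists>j\<in>I - J. g j \<noteq> g i)"
      obtain i0 j0 where "i0 \<in> J" "j0 \<in> I - J" using J by blast
      with c have "g k = g i0" if "k \<in> I" for k using that by (metis Diff_iff)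
      then show False using two by metis
    qed
    then obtain i j where ij: "i \<in> J" "j \<in> I - J" "g j \<noteq> g i" by blast
    have ne: "i \<noteq> j" "i \<in> I" "j \<in> I" using ij J by auto
    define R where "R = I - {i, j}"
    have I: "I = insert j (insert i R)" "j \<notin> insert i R" "i \<notin> R" using ne by (auto simp: R_def)
    have finR: "finite R" using fin by (simp add: R_def)
    \<comment> \<open>\<open>D\<close> lists the symbols in the product over \<open>J\<close>. As
      \<open>j\<close> is not in \<open>J\<close>, those in \<open>D1\<close> do not involve
      \<open>p j\<close>, and those in \<open>D2\<close> do not involve \<open>p i\<close>. So (i,
      j) is the only symbol that links both variables, and the others become bounded
      weights.\<close>
    define D where "D = (SIGMA k:J. N k)"
    define D1 where "D1 = {(k, l) \<in> D. l \<noteq> j}"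
    define D2 where "D2 = {(k, l) \<in> D. l = j \<and> k \<noteq> i}"
    have finD: "finite D" using J fin by (auto simp: D_def N_def intro: finite_subset)
    have Deq: "D = insert (i, j) (D1 \<union> D2)" using ij by (auto simp: D_def D1_def D2_def N_def)
    have finD': "finite D1" "finite D2" using finD Deq by (auto intro: finite_subset)
    define \<alpha> where "\<alpha> = (\<lambda>r a. \<Prod>(k, l)\<in>D1. L ((r(i := a)) l) ((r(i := a)) k))"
    define \<beta> where "\<beta> = (\<lambda>r b. \<Prod>(k, l)\<in>D2. L ((r(j := b)) l) ((r(j := b)) k))"
    have bd: "\<bar>\<alpha> r a\<bar> \<le> 1" "\<bar>\<beta> r b\<bar> \<le> 1" for r a b
      unfolding \<alpha>_def \<beta>_def abs_prod using L1 by (auto intro!: prod_le_1)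
    have fac: "(\<Prod>k\<in>J. \<psi> k ((r(i := a))(j := b))) = \<beta> r b * \<alpha> r a * L b a" for r a b
    proof -
      define p where "p = (r(i := a))(j := b)"
      have "(\<Prod>k\<in>J. \<psi> k p) = (\<Prod>(k, l)\<in>D. L (p l) (p k))"
        unfolding \<psi>_def D_def using J fin by (intro prod.Sigma) (auto simp: N_def intro: finite_subset)
      also have "\<dots> = L (p j) (p i) * (\<Prod>(k, l)\<in>D1 \<union> D2. L (p l) (p k))"
        unfolding Deq using finD' by (subst prod.insert) (auto simp: D1_def D2_def)
      also have "(\<Prod>(k, l)\<in>D1 \<union> D2. L (p l) (p k)) =
         (\<Prod>(k, l)\<in>D1. L (p l) (p k)) * (\<Prod>(k, l)\<in>D2. L (p l) (p k))"
        using finD' by (intro prod.union_disjoint) (auto simp: D1_def D2_def)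
      also have "(\<Prod>(k, l)\<in>D1. L (p l) (p k)) = \<alpha> r a" unfolding \<alpha>_def
        by (rule prod.cong) (use ij in \<open>auto simp: D1_def D_def p_def\<close>)
      also have "(\<Prod>(k, l)\<in>D2. L (p l) (p k)) = \<beta> r b" unfolding \<beta>_def
        by (rule prod.cong) (use ij in \<open>auto simp: D2_def D_def p_def\<close>)
      finally show ?thesis using ne by (simp add: p_def mult_ac del: fun_upd_apply) (simp add: mult_ac)
    qed
    have "tm J = (\<Sum>b\<in>Q j. \<Sum>a\<in>Q i. \<Sum>r\<in>PiE R Q. \<beta> r b * \<alpha> r a * L b a)"
      unfolding tm_def \<Omega>_def
      by (subst I(1), subst sum_PiE_insert[OF I(2)], subst sum_PiE_insert[OF I(3)]) (simp add: fac)
    also have "\<dots> = (\<Sum>r\<in>PiE R Q. \<Sum>b\<in>Q j. \<Sum>a\<in>Q i. \<beta> r b * \<alpha> r a * L b a)"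
      by (simp add: sum.swap[of _ _ "PiE R Q"])
    finally have "\<bar>tm J\<bar> \<le> (\<Sum>r\<in>PiE R Q. \<bar>\<Sum>b\<in>Q j. \<Sum>a\<in>Q i. \<beta> r b * \<alpha> r a * L b a\<bar>)"
      by simp
    also have "\<dots> \<le> (\<Sum>r\<in>PiE R Q. \<eta> * (real (card (Q j)) * real (card (Q i))))"
      using bil[OF ne(3,2)] ne bd unfolding L_def by (intro sum_mono) auto
    also have "\<dots> = \<eta> * (real (card (Q j)) * (real (card (Q i)) * (\<Prod>k\<in>R. real (card (Q k)))))"
      using finR by (simp add: card_PiE)
    also have "\<dots> = \<eta> * W" 
    proof -
      have "W = (\<Prod>k\<in>insert j (insert i R). real (card (Q k)))" by (simp only: W_def I(1)[symmetric])
      then show ?thesis using I(2,3) finR by simp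
    qed
    finally show ?thesis by linarith
  qed
  \<comment> \<open>For uniformity every subset is charged \<open>\<eta> * W\<close>, also the empty
    and the full one; hence the factor \<open>2 ^ card I\<close>.\<close>
  have "(\<Sum>J\<in>Pow I. (if J = {} then W else 0) - \<eta> * W) \<le> (\<Sum>J\<in>Pow I. tm J)"
  proof (intro sum_mono)
    fix J assume "J \<in> Pow I"
    moreover have "\<eta> * W \<ge> 0" using \<eta> W0 by simp
    ultimately show "(if J = {} then W else 0) - \<eta> * W \<le> tm J"
      using t0 tI tJ[of J] two by (cases "J = {}"; cases "J = I") auto
  qed
  also have "(\<Sum>J\<in>Pow I. (if J = {} then W else 0) - \<eta> * W) = W - 2 ^ card I * (\<eta> * W)"
    using fin by (simp add: sum_subtractf card_Pow sum.delta)
  finally show ?thesis using E by (simp add: good_def \<Omega>_def N_def W_def algebra_simps)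
qed

section \<open>Primes congruent to 1 modulo 4\<close>

definition chi4 :: "nat \<Rightarrow> real" where
  "chi4 n = (if n mod 4 = 1 then 1 else if n mod 4 = 3 then -1 else 0)"

lemma chi4_mult: "chi4 (m * n) = chi4 m * chi4 n"
proof -
  have "m * n mod 4 = (m mod 4) * (n mod 4) mod 4" by (simp add: mod_mult_eq)
  moreover have "m mod 4 \<in> {0, 1, 2, 3}" "n mod 4 \<in> {0, 1, 2, 3}" by auto
  ultimately show ?thesis unfolding chi4_def by auto
qed

lemma chi4_bound: "\<bar>chi4 n\<bar> \<le> 1"
  by (simp add: chi4_def)

text \<open>Partial summation, as in Leibniz's criterion: the sums \<open>X\<close> of
  \<open>chi4\<close> over initial segments take only the values 0 and 1.\<close>

lemma chi4_alternating_sum: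
  fixes f :: "nat \<Rightarrow> real"
  assumes anti: "\<And>n. n > a \<Longrightarrow> f (Suc n) \<le> f n" and nonneg: "\<And>n. n > a \<Longrightarrow> f n \<ge> 0"
  shows "\<bar>\<Sum>n\<in>{a<..N}. chi4 n * f n\<bar> \<le> f (Suc a)"
proof -
  define X where "X = (\<lambda>n::nat. if n mod 4 = 1 \<or> n mod 4 = 2 then 1 else 0 :: real)"
  have X: "chi4 (Suc n) = X (Suc n) - X n" for n
  proof -
    have "n mod 4 \<in> {0, 1, 2, 3}" by auto
    then show ?thesis by (auto simp: chi4_def X_def mod_Suc)
  qed
  have X01: "0 \<le> X n * y" "X n * y \<le> y" if "y \<ge> 0" for n y using that by (auto simp: X_def)
  define S where "S = (\<lambda>N. \<Sum>n\<in>{a<..N}. chi4 n * f n)"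
  \<comment> \<open>Without its boundary term \<open>X N * f N\<close> the partial sum is
    nondecreasing, and the step to N + 1 adds at most \<open>f N - f (Suc N)\<close>, which
    telescopes.\<close>
  have inv: "- f (Suc a) \<le> S (Suc a + k) - X (Suc a + k) * f (Suc a + k) \<and>
      S (Suc a + k) - X (Suc a + k) * f (Suc a + k) \<le> f (Suc a) - f (Suc a + k)" for k
  proof (induction k)
    case 0
    have "{a<..Suc a} = {Suc a}" by auto
    then have "S (Suc a) - X (Suc a) * f (Suc a) = - X a * f (Suc a)"
      by (simp add: S_def X algebra_simps)
    moreover have "X a * f (Suc a) \<le> f (Suc a)" "0 \<le> X a * f (Suc a)"
      using X01 nonneg[of "Suc a"] by auto
    ultimately show ?case by simp
  next
    case (Suc k)
    define N where "N = Suc a + k"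
    have "{a<..Suc N} = insert (Suc N) {a<..N}" by (auto simp: N_def)
    then have "S (Suc N) = S N + (X (Suc N) - X N) * f (Suc N)" by (simp add: S_def X)
    then have e: "S (Suc N) - X (Suc N) * f (Suc N) = (S N - X N * f N) + X N * (f N - f (Suc N))"
      by (simp add: algebra_simps)
    have "f (Suc N) \<le> f N" using anti[of N] by (simp add: N_def)
    then have "0 \<le> X N * (f N - f (Suc N))" "X N * (f N - f (Suc N)) \<le> f N - f (Suc N)"
      using X01 by auto
    with Suc e show ?case by (simp add: N_def)
  qed
  show ?thesis
  proof (cases "N > a")
    case True
    then obtain k where k: "N = Suc a + k" using less_iff_Suc_add by auto
    have "0 \<le> X N * f N" "X N * f N \<le> f N"
      using X01 nonneg[of N] True by auto
    with inv[of k] have "- f (Suc a) \<le> S N \<and> S N \<le> f (Suc a)" by (auto simp: k)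
    then show ?thesis by (auto simp: S_def)
  next
    case False
    then show ?thesis using nonneg[of "Suc a"] by simp
  qed
qed

lemma multiples_eq_image:
  fixes m N :: nat
  assumes "m > 0"
  shows "{n \<in> {1..N}. m dvd n} = (\<lambda>j. m * j) ` {1..N div m}"
proof (intro equalityI subsetI)
  fix n assume "n \<in> {n \<in> {1..N}. m dvd n}"
  then obtain j where j: "n = m * j" "1 \<le> n" "n \<le> N" by auto
  then have "j \<ge> 1" by (cases j) auto
  moreover have "j \<le> N div m" using j assms by (simp add: less_eq_div_iff_mult_less_eq mult.commute)
  ultimately show "n \<in> (\<lambda>j. m * j) ` {1..N div m}" using j by auto
next
  fix n assume "n \<in> (\<lambda>j. m * j) ` {1..N div m}"
  then obtain j where "n = m * j" "j \<in> {1..N div m}" by blast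
  then show "n \<in> {n \<in> {1..N}. m dvd n}"
    using assms by (auto simp: less_eq_div_iff_mult_less_eq mult.commute Suc_le_eq)
qed

lemma sum_divisors_swap:
  fixes F :: "nat \<Rightarrow> nat \<Rightarrow> real"
  shows "(\<Sum>n = 1..N. \<Sum>m | m dvd n. F m n) = (\<Sum>m = 1..N. \<Sum>k = 1..N div m. F m (m * k))"
proof -
  have "(\<Sum>n = 1..N. \<Sum>m | m dvd n. F m n) = (\<Sum>n = 1..N. \<Sum>m | m \<in> {1..N} \<and> m dvd n. F m n)"
  proof (rule sum.cong[OF refl])
    fix n assume n: "n \<in> {1..N}"
    have "{m. m dvd n} = {m. m \<in> {1..N} \<and> m dvd n}"
      using n by (auto simp: Suc_le_eq intro!: Nat.gr0I dest: dvd_imp_le)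
    then show "(\<Sum>m | m dvd n. F m n) = (\<Sum>m | m \<in> {1..N} \<and> m dvd n. F m n)" by simp
  qed
  also have "\<dots> = (\<Sum>m = 1..N. \<Sum>n | n \<in> {1..N} \<and> m dvd n. F m n)"
    by (rule sum.swap_restrict) auto
  also have "\<dots> = (\<Sum>m = 1..N. \<Sum>k = 1..N div m. F m (m * k))"
  proof (rule sum.cong[OF refl])
    fix m assume m: "m \<in> {1..N}"
    then have "{n. n \<in> {1..N} \<and> m dvd n} = (\<lambda>k. m * k) ` {1..N div m}"
      by (intro multiples_eq_image) auto
    moreover have "inj_on (\<lambda>j. m * j) {1..N div m}" using m by (auto simp: inj_on_def)
    ultimately show "(\<Sum>n | n \<in> {1..N} \<and> m dvd n. F m n) = (\<Sum>k = 1..N div m. F m (m * k))"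
      by (simp add: sum.reindex)
  qed
  finally show ?thesis .
qed

text \<open>Legendre's formula for the factorial: ln n is the divisor sum of
  \<open>mangoldt\<close>, and \<open>N div m\<close> counts the multiples of
  \<open>m\<close>.\<close>

lemma ln_fact_mangoldt: "ln (fact N :: real) = (\<Sum>m = 1..N. mangoldt m * real (N div m))"
proof -
  have "ln (fact N :: real) = (\<Sum>n = 1..N. ln (real n))"
    unfolding fact_prod by (subst of_nat_prod) (subst ln_prod, auto)
  also have "\<dots> = (\<Sum>n = 1..N. \<Sum>m | m dvd n. mangoldt m)"
    by (intro sum.cong refl) (simp add: mangoldt_sum)
  also have "\<dots> = (\<Sum>m = 1..N. mangoldt m * real (N div m))"
    by (subst sum_divisors_swap) (simp add: mult.commute)
  finally show ?thesis .
qed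

text \<open>This is Chebyshev's second function.\<close>

definition psi :: "nat \<Rightarrow> real" where
  "psi N = (\<Sum>m = 1..N. mangoldt m)"

text \<open>Chebyshev's argument: in the binomial coefficient of \<open>N\<close> over its half,
  every prime power in the upper half has weight 1 and no weight is negative. So halving
  \<open>N\<close> costs at most the logarithm of 2^N.\<close>

lemma psi_le: "psi N \<le> 4 * real N"
proof (induction N rule: less_induct)
  case (less N)
  show ?case
  proof (cases "N \<le> 1")
    case True
    then have "N = 0 \<or> N = 1" by auto
    then show ?thesis by (auto simp: psi_def)
  next
    case False
    define M where "M = N div 2"
    define M' where "M' = N - M"
    have M: "N = M + M'" "M \<le> M'" "M' < N" "2 * M' \<le> N + 1" "M \<le> N" using False by (auto simp: M_def M'_def)
    have fl: "ln (fact n :: real) = (\<Sum>m = 1..N. mangoldt m * real (n div m))" if "n \<le> N" for n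
    proof -
      have "(\<Sum>m = 1..N. mangoldt m * real (n div m)) = (\<Sum>m = 1..n. mangoldt m * real (n div m))"
        using that by (intro sum.mono_neutral_right) auto
      then show ?thesis by (simp add: ln_fact_mangoldt)
    qed
    have "psi N - psi M' = (\<Sum>m\<in>{M'<..N}. mangoldt m)"
    proof -
      have "{1..N} = {1..M'} \<union> {M'<..N}" using M by auto
      then have "psi N = psi M' + (\<Sum>m\<in>{M'<..N}. mangoldt m)"
        unfolding psi_def by (subst sum.union_disjoint[symmetric]) auto
      then show ?thesis by simp
    qed
    also have "\<dots> = (\<Sum>m\<in>{M'<..N}. mangoldt m * (real (N div m) - real (M div m) - real (M' div m)))"
    proof (rule sum.cong[OF refl])
      fix m assume m: "m \<in> {M'<..N}"
      have "N < 2 * m" using m M by auto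
      then have "N div m = 1" using m by (intro div_nat_eqI) auto
      moreover have "M div m = 0" "M' div m = 0" using m M by auto
      ultimately show "mangoldt m = mangoldt m * (real (N div m) - real (M div m) - real (M' div m))" by simp
    qed
    also have "\<dots> \<le> (\<Sum>m = 1..N. mangoldt m * (real (N div m) - real (M div m) - real (M' div m)))"
    proof (rule sum_mono2)
      fix m
      have "M div m + M' div m \<le> N div m" 
      proof (cases "m = 0")
        case False
        have "(M div m + M' div m) * m \<le> M + M'"
          unfolding distrib_right by (intro add_mono div_times_less_eq_dividend)
        then show ?thesis using False M(1) by (simp add: less_eq_div_iff_mult_less_eq)
      qed simp
      then have "real (N div m) - real (M div m) - real (M' div m) \<ge> 0" by linarith
      then show "0 \<le> mangoldt m * (real (N div m) - real (M div m) - real (M' div m))"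
        by (simp add: mangoldt_nonneg)
    qed auto
    also have "\<dots> = ln (fact N) - ln (fact M) - ln (fact M')"
      using M by (simp add: fl right_diff_distrib sum_subtractf)
    also have "\<dots> = ln (real (N choose M))"
      using M by (simp add: binomial_fact ln_div ln_mult M'_def)
    also have "\<dots> \<le> ln (2 ^ N)"
    proof -
      have "N choose M \<le> 2 ^ N"
        using binomial_le_pow2[of N M] by simp
      then have "real (N choose M) \<le> 2 ^ N" by (metis of_nat_le_iff of_nat_numeral of_nat_power)
      moreover have "real (N choose M) > 0" using M by (simp add: zero_less_binomial)
      ultimately show ?thesis by simp
    qed
    also have "\<dots> \<le> real N * 1" 
      using mult_left_mono[of "ln 2" 1 "real N"] ln_2_less_1 by (simp add: ln_realpow)
    finally have "psi N \<le> psi M' + real N" by simp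
    also have "\<dots> \<le> 4 * real M' + real N" using less.IH[OF M(3)] by simp
    also have "\<dots> \<le> 4 * real N"
    proof -
      have "4 * M' \<le> 3 * N" using M(4) False by simp
      then show ?thesis by linarith
    qed
    finally show ?thesis .
  qed
qed

lemma ln_fact_ge: "ln (fact N :: real) \<ge> real N * ln (real N) - real N"
proof (induction N)
  case (Suc N)
  show ?case
  proof (cases "N = 0")
    case False
    have "ln (real (Suc N)) - ln (real N) = ln (1 + 1 / real N)"
    proof -
      have "1 + 1 / real N = real (Suc N) / real N" using False by (simp add: field_simps)
      moreover have "ln (real (Suc N) / real N) = ln (real (Suc N)) - ln (real N)"
        using False by (subst ln_div) auto
      ultimately show ?thesis by (simp only:)
    qed
    also have "\<dots> \<le> 1 / real N" using False by (intro ln_add_one_self_le_self) simp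
    finally have "real N * (ln (real (Suc N)) - ln (real N)) \<le> 1"
      using False by (simp add: field_simps)
    moreover have "ln (fact (Suc N) :: real) = ln (real (Suc N)) + ln (fact N)"
      by (simp only: fact_Suc) (subst ln_mult, auto)
    ultimately show ?thesis using Suc by (simp add: algebra_simps)
  qed simp
qed simp

lemma ln_fact_le: "ln (fact N :: real) \<le> real N * ln (real N)"
proof (cases "N = 0")
  case False
  have "ln (fact N :: real) \<le> ln (real N ^ N)"
    using False fact_le_power[where 'a = real, of N] by (subst ln_le_cancel_iff) simp_all
  then show ?thesis using False by (simp add: ln_realpow)
qed simp

text \<open>The sum is compared with ln (N!) / N through Legendre's formula. Replacing
  \<open>N div m\<close> by N / m costs nothing in one direction and \<open>psi N\<close> in the
  other.\<close>

lemma mertens_mangoldt: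
  assumes N: "N \<ge> 1"
  shows "(\<Sum>m = 1..N. mangoldt m / real m) \<ge> ln (real N) - 1" (is "?S \<ge> _")
    and "(\<Sum>m = 1..N. mangoldt m / real m) \<le> ln (real N) + 4"
proof -
  have le: "real (N div m) \<le> real N / real m" for m by (rule of_nat_div_le_of_nat)
  have ge: "real N / real m \<le> real (N div m) + 1" if "m > 0" for m
  proof -
    have "N < m * (N div m + 1)" using that dividend_less_times_div[of m N] by simp
    then have "real N < real (m * (N div m + 1))" by (simp only: of_nat_less_iff)
    also have "\<dots> = real m * (real (N div m) + 1)" by (simp only: of_nat_mult of_nat_add of_nat_1)
    finally show ?thesis using that by (simp add: field_simps)
  qed
  have "ln (fact N :: real) \<le> real N * ?S"
    unfolding ln_fact_mangoldt sum_distrib_left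
  proof (rule sum_mono)
    fix m
    show "mangoldt m * real (N div m) \<le> real N * (mangoldt m / real m)"
      using mult_left_mono[OF le mangoldt_nonneg, of m m] by (simp add: mult.commute)
  qed
  with ln_fact_ge[of N] have "real N * (ln (real N) - 1) \<le> real N * ?S" by (simp add: right_diff_distrib)
  then show "?S \<ge> ln (real N) - 1" using N by simp
  have "real N * ?S \<le> (\<Sum>m = 1..N. mangoldt m * real (N div m) + mangoldt m)"
    unfolding sum_distrib_left
  proof (rule sum_mono)
    fix m assume "m \<in> {1..N}"
    then have "mangoldt m * (real N / real m) \<le> mangoldt m * (real (N div m) + 1)"
      by (intro mult_left_mono ge mangoldt_nonneg) auto
    then show "real N * (mangoldt m / real m) \<le> mangoldt m * real (N div m) + mangoldt m"
      by (simp add: algebra_simps)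
  qed
  also have "\<dots> = ln (fact N) + psi N" by (simp add: sum.distrib ln_fact_mangoldt psi_def)
  also have "\<dots> \<le> real N * ln (real N) + 4 * real N" using ln_fact_le psi_le by (rule add_mono)
  finally have "real N * ?S \<le> real N * (ln (real N) + 4)" by (simp add: algebra_simps)
  then show "?S \<le> ln (real N) + 4" using N by simp
qed


lemma ln_over_antimono:
  assumes "n > 2"
  shows "ln (real (Suc n)) / real (Suc n) \<le> ln (real n) / real n"
proof -
  have n: "real n > 0" "n \<noteq> 0" using assms by auto
  have "ln (real n) \<ge> 1"
  proof -
    have "exp 1 \<le> (3::real)" by (rule exp_le)
    also have "3 \<le> real n" using assms by simp
    finally have "exp 1 \<le> real n" .
    then show ?thesis using n by (subst ln_ge_iff) auto
  qed
  moreover have "ln (real (Suc n)) - ln (real n) \<le> 1 / real n"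
  proof -
    have "1 + 1 / real n = real (Suc n) / real n" using n by (simp add: field_simps)
    moreover have "ln (real (Suc n) / real n) = ln (real (Suc n)) - ln (real n)"
      using n by (subst ln_div) auto
    ultimately have "ln (real (Suc n)) - ln (real n) = ln (1 + 1 / real n)" by (simp only:)
    also have "\<dots> \<le> 1 / real n" using n by (intro ln_add_one_self_le_self) simp
    finally show ?thesis .
  qed
  ultimately have "real n * (ln (real (Suc n)) - ln (real n)) \<le> ln (real n)"
    using n mult_left_mono[of "ln (real (Suc n)) - ln (real n)" "1 / real n" "real n"] by simp
  then have "real n * ln (real (Suc n)) \<le> real (Suc n) * ln (real n)" by (simp add: algebra_simps)
  then show ?thesis using n by (simp add: divide_simps mult.commute)
qed

text \<open>The sum \<open>B\<close> of chi4 n ln n / n is bounded because it alternates. Writing ln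
  as a divisor sum of \<open>mangoldt\<close> turns \<open>B\<close> into a sum with inner factors
  \<open>L (N div m)\<close>. Replacing them by \<open>L N\<close> costs at most psi N / N, and
  \<open>L N\<close> can be divided out because it stays away from 0, the analogue of the
  nonvanishing of L(1, chi).\<close>

lemma mertens_chi4:
  assumes N: "N \<ge> 4"
  shows "\<bar>\<Sum>m = 1..N. chi4 m * mangoldt m / real m\<bar> \<le> 11"
proof -
  define L where "L = (\<lambda>M. \<Sum>k = 1..M. chi4 k / real k)"
  define S where "S = (\<Sum>m = 1..N. chi4 m * mangoldt m / real m)"
  have Ldiff: "\<bar>L M - L K\<bar> \<le> 1 / real (Suc K)" if "K \<le> M" for K M
  proof -
    have "{1..M} = {1..K} \<union> {K<..M}" using that by auto
    then have "L M = (\<Sum>k\<in>{1..K} \<union> {K<..M}. chi4 k / real k)" by (simp only: L_def)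
    also have "\<dots> = L K + (\<Sum>k\<in>{K<..M}. chi4 k / real k)"
      unfolding L_def by (intro sum.union_disjoint) auto
    finally have "L M - L K = (\<Sum>k\<in>{K<..M}. chi4 k * (1 / real k))" by simp
    also have "\<bar>\<dots>\<bar> \<le> 1 / real (Suc K)"
      by (rule chi4_alternating_sum) (auto simp: field_simps)
    finally show ?thesis .
  qed
  \<comment> \<open>The tail beyond 4 is at most its first term 1/5, so \<open>L N\<close> is at
    least 2/3 - 1/5 = 7/15. The final constant comes from 5 * 15/7 < 11.\<close>
  have "L 4 = 2 / 3"
  proof -
    have "{1..4::nat} = {1, 2, 3, 4}" by auto
    then show ?thesis by (simp add: L_def chi4_def)
  qed
  have LN: "L N \<ge> 7 / 15" 
  proof -
    have "\<bar>L N - L 4\<bar> \<le> 1 / 5" using Ldiff[OF N] by simp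
    with \<open>L 4 = 2 / 3\<close> show ?thesis by linarith
  qed
  define B where "B = (\<Sum>n = 1..N. chi4 n * (ln (real n) / real n))"
  \<comment> \<open>ln x / x decreases only beyond e, so the alternating sum starts at 3. The term
    for 1 contains ln 1 = 0, and \<open>chi4\<close> kills the term for 2.\<close>
  have "B = (\<Sum>n\<in>{2<..N}. chi4 n * (ln (real n) / real n))"
    unfolding B_def
  proof (rule sum.mono_neutral_right)
    show "\<forall>n\<in>{1..N} - {2<..N}. chi4 n * (ln (real n) / real n) = 0"
    proof
      fix n assume "n \<in> {1..N} - {2<..N}"
      then have "n = 1 \<or> n = 2" by auto
      then show "chi4 n * (ln (real n) / real n) = 0" by (auto simp: chi4_def)
    qed
  qed auto
  also have "\<bar>\<dots>\<bar> \<le> ln (real (Suc 2)) / real (Suc 2)"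
    by (rule chi4_alternating_sum) (use ln_over_antimono in auto)
  also have "\<dots> \<le> 1"
    using ln_le_minus_one[of 3] by simp
  finally have B: "\<bar>B\<bar> \<le> 1" .
  have "B = (\<Sum>n = 1..N. \<Sum>m | m dvd n. mangoldt m * (chi4 n / real n))"
  proof -
    have "chi4 n * (ln (real n) / real n) = (\<Sum>m | m dvd n. mangoldt m * (chi4 n / real n))" if "n \<in> {1..N}" for n
      using that mangoldt_sum[of n, where 'a = real] unfolding sum_distrib_right[symmetric] by simp
    then show ?thesis unfolding B_def by (intro sum.cong refl)
  qed
  also have "\<dots> = (\<Sum>m = 1..N. \<Sum>k = 1..N div m. mangoldt m * (chi4 (m * k) / real (m * k)))"
    by (rule sum_divisors_swap)
  also have "\<dots> = (\<Sum>m = 1..N. chi4 m * mangoldt m / real m * L (N div m))"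
    by (intro sum.cong refl) (simp add: L_def sum_distrib_left chi4_mult mult_ac)
  finally have B2: "B = (\<Sum>m = 1..N. chi4 m * mangoldt m / real m * L (N div m))" .
  have "B - L N * S = (\<Sum>m = 1..N. chi4 m * mangoldt m / real m * (L (N div m) - L N))"
    unfolding B2 S_def sum_distrib_left sum_subtractf[symmetric] by (intro sum.cong refl) (simp add: algebra_simps diff_divide_distrib)
  also have "\<bar>\<dots>\<bar> \<le> (\<Sum>m = 1..N. \<bar>chi4 m * mangoldt m / real m * (L (N div m) - L N)\<bar>)" by (rule sum_abs)
  also have "\<dots> \<le> (\<Sum>m = 1..N. mangoldt m / real N)"
  proof (rule sum_mono)
    fix m assume m: "m \<in> {1..N}"
    have "\<bar>L (N div m) - L N\<bar> \<le> 1 / real (Suc (N div m))"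
      using Ldiff[of "N div m" N] by (simp add: abs_minus_commute)
    also have "\<dots> \<le> real m / real N"
    proof -
      have "N < m * (N div m + 1)" using m dividend_less_times_div[of m N] by simp
      then have "real N < real (m * (N div m + 1))" by (simp only: of_nat_less_iff)
      also have "\<dots> = real m * real (Suc (N div m))" by (simp only: of_nat_mult Suc_eq_plus1)
      finally show ?thesis using N by (simp add: divide_simps mult.commute)
    qed
    finally have d: "\<bar>L (N div m) - L N\<bar> \<le> real m / real N" .
    have "\<bar>chi4 m * mangoldt m / real m\<bar> \<le> mangoldt m / real m"
      using chi4_bound[of m] mangoldt_nonneg[of m] by (simp add: abs_mult divide_right_mono mult_left_le_one_le)
    then have "\<bar>chi4 m * mangoldt m / real m\<bar> * \<bar>L (N div m) - L N\<bar> \<le> (mangoldt m / real m) * (real m / real N)"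
      using d by (intro mult_mono) (auto simp: mangoldt_nonneg)
    then show "\<bar>chi4 m * mangoldt m / real m * (L (N div m) - L N)\<bar> \<le> mangoldt m / real N"
      using m by (simp only: abs_mult) simp
  qed
  also have "\<dots> = psi N / real N" by (simp add: psi_def sum_divide_distrib)
  also have "\<dots> \<le> 4" using psi_le[of N] N by (simp add: divide_simps)
  finally have "\<bar>L N * S\<bar> \<le> 5" using B by linarith
  then have "L N * \<bar>S\<bar> \<le> 5" using LN by (simp add: abs_mult)
  moreover have "7 / 15 * \<bar>S\<bar> \<le> L N * \<bar>S\<bar>" using LN by (intro mult_right_mono) auto
  ultimately show ?thesis by (simp add: S_def)
qed


lemma sum_powers_from_2_le:
  fixes x :: real
  assumes "0 \<le> x" "x \<le> 1 / 2"
  shows "(\<Sum>j = 2..N. x ^ j) \<le> 2 * x ^ 2"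
proof -
  have step: "(\<Sum>j = 2..k + 2. x ^ j) \<le> 2 * x ^ 2 - x ^ (k + 2)" for k
  proof (induction k)
    case 0
    show ?case by (simp add: power2_eq_square)
  next
    case (Suc k)
    have "x ^ (Suc k + 2) \<le> x ^ (k + 2) / 2"
      using assms mult_right_mono[of x "1 / 2" "x ^ (k + 2)"] by simp
    moreover have "(\<Sum>j = 2..Suc k + 2. x ^ j) = (\<Sum>j = 2..k + 2. x ^ j) + x ^ (Suc k + 2)"
      by (simp only: add_Suc sum.nat_ivl_Suc')
    ultimately show ?case using Suc.IH by linarith
  qed
  show ?thesis
  proof (cases "N \<ge> 2")
    case True
    then obtain k where k: "N = k + 2" by (metis add.commute le_Suc_ex)
    have "0 \<le> x ^ (k + 2)" using assms(1) by simp
    with step[of k] show ?thesis unfolding k by linarith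
  qed (use assms in auto)
qed

text \<open>The proper powers of \<open>p\<close> contribute at most 2 ln p / p^2, and ln p is at
  most 2 sqrt p; the series of p^(-3/2) converges.\<close>

lemma prime_powers_sum_bounded:
  "\<exists>C. \<forall>N. (\<Sum>n | n \<in> {1..N} \<and> \<not> prime n. mangoldt n / real n) \<le> C"
proof -
  define w where "w = (\<lambda>p::nat. real p powr (- 3 / 2))"
  have sw: "summable w" unfolding w_def by (subst summable_real_powr_iff) simp
  have "(\<Sum>n | n \<in> {1..N} \<and> \<not> prime n. mangoldt n / real n) \<le> 4 * suminf w" for N
  proof -
    define A where "A = {n. n \<in> {1..N} \<and> \<not> prime n \<and> primepow n}"
    define I where "I = {p \<in> {..N}. prime p} \<times> {2..N}"
    define g where "g = (\<lambda>n::nat. mangoldt n / real n :: real)"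
    have g0: "g n \<ge> 0" for n by (simp add: g_def mangoldt_nonneg)
    have "(\<Sum>n | n \<in> {1..N} \<and> \<not> prime n. g n) = (\<Sum>n\<in>A. g n)"
      by (rule sum.mono_neutral_right) (auto simp: A_def g_def mangoldt_def)
    also have "\<dots> \<le> (\<Sum>n\<in>(\<lambda>(p, j). p ^ j) ` I. g n)"
    proof (rule sum_mono2)
      show "A \<subseteq> (\<lambda>(p, j). p ^ j) ` I"
      proof
        fix n assume n: "n \<in> A"
        then obtain p k where pk: "prime p" "k > 0" "n = p ^ k" by (auto simp: A_def primepow_def)
        have "k \<noteq> 1" using n pk by (auto simp: A_def)
        then have "k \<ge> 2" using pk by simp
        have "p \<le> p ^ k" using pk prime_gt_0_nat by (simp add: self_le_power Suc_le_eq)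
        moreover have "k \<le> p ^ k"
          using power_gt_expt[of p k] prime_gt_1_nat[OF pk(1)] by simp
        ultimately have "p \<le> N" "k \<le> N" using n pk by (auto simp: A_def)
        then have "(p, k) \<in> I" using pk \<open>k \<ge> 2\<close> by (auto simp: I_def)
        then show "n \<in> (\<lambda>(p, j). p ^ j) ` I"
          using pk(3) by (intro image_eqI[of _ _ "(p, k)"]) simp_all
      qed
    qed (auto simp: I_def g0)
    also have "\<dots> \<le> (\<Sum>i\<in>I. (g \<circ> (\<lambda>(p, j). p ^ j)) i)"
      by (rule sum_image_le) (auto simp: I_def g0)
    also have "\<dots> = (\<Sum>p | p \<in> {..N} \<and> prime p. \<Sum>j = 2..N. g (p ^ j))"
      by (simp add: I_def sum.cartesian_product case_prod_beta)
    also have "\<dots> \<le> (\<Sum>p | p \<in> {..N} \<and> prime p. 4 * w p)"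
    proof (rule sum_mono)
      fix p assume "p \<in> {p. p \<in> {..N} \<and> prime p}"
      then have p: "prime p" by simp
      have p2: "real p \<ge> 2" using prime_ge_2_nat[OF p] by simp
      have "(\<Sum>j = 2..N. g (p ^ j)) = (\<Sum>j = 2..N. ln (real p) * (1 / real p) ^ j)"
        by (intro sum.cong refl) (auto simp: g_def p power_divide)
      also have "\<dots> = ln (real p) * (\<Sum>j = 2..N. (1 / real p) ^ j)" by (simp add: sum_distrib_left)
      also have "\<dots> \<le> ln (real p) * (2 * (1 / real p) ^ 2)"
        using p2 by (intro mult_left_mono sum_powers_from_2_le) (auto simp: field_simps)
      also have "\<dots> \<le> (real p powr (1 / 2) / (1 / 2)) * (2 * (1 / real p) ^ 2)"
        using p2 by (intro mult_right_mono ln_powr_bound) auto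
      also have "\<dots> = 4 * w p"
      proof -
        have "real p powr (- 3 / 2) = real p powr (1 / 2 - 2)" by simp
        also have "\<dots> = real p powr (1 / 2) / real p ^ 2"
          using p2 by (subst powr_diff) (simp add: powr_numeral)
        finally show ?thesis by (simp add: w_def power_divide)
      qed
      finally show "(\<Sum>j = 2..N. g (p ^ j)) \<le> 4 * w p" .
    qed
    also have "\<dots> = 4 * (\<Sum>p | p \<in> {..N} \<and> prime p. w p)" by (simp add: sum_distrib_left)
    also have "\<dots> \<le> 4 * suminf w"
      by (intro mult_left_mono sum_le_suminf[OF sw]) (auto simp: w_def)
    finally show ?thesis by (simp add: g_def)
  qed
  then show ?thesis by blast
qed

definition prime_log_sum :: "nat \<Rightarrow> real" where
  "prime_log_sum N = (\<Sum>p | p \<in> {1..N} \<and> prime p \<and> p mod 4 = 1. ln (real p) / real p)"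

text \<open>Half the sum of the two Mertens estimates, since (1 + chi4 p) / 2 detects the class 1
  among odd primes. What remains are the prime 2, where \<open>chi4\<close> vanishes, and the proper
  prime powers.\<close>

lemma mertens_primes_mod4:
  "\<exists>K > 0. \<forall>N \<ge> 4. \<bar>prime_log_sum N - ln (real N) / 2\<bar> \<le> K"
proof -
  obtain C where C: "\<And>N. (\<Sum>n | n \<in> {1..N} \<and> \<not> prime n. mangoldt n / real n) \<le> C"
    using prime_powers_sum_bounded by blast
  have C0: "C \<ge> 0" using C[of 0] by simp
  show ?thesis
  proof (intro exI[of _ "10 + C"] conjI allI impI)
    show "10 + C > 0" using C0 by simp
    fix N :: nat assume N: "N \<ge> 4"
    define g where "g = (\<lambda>n::nat. mangoldt n / real n :: real)"
    define P where "P = prime_log_sum N"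
    define S where "S = (\<Sum>m = 1..N. g m)"
    define X where "X = (\<Sum>m = 1..N. chi4 m * mangoldt m / real m)"
    have g0: "g n \<ge> 0" for n by (simp add: g_def mangoldt_nonneg)
    have P: "P = (\<Sum>n = 1..N. if prime n \<and> n mod 4 = 1 then g n else 0)"
    proof -
      have "P = (\<Sum>p | p \<in> {1..N} \<and> prime p \<and> p mod 4 = 1. g p)"
        unfolding P_def prime_log_sum_def by (intro sum.cong refl) (simp add: g_def)
      also have "\<dots> = (\<Sum>n = 1..N. if prime n \<and> n mod 4 = 1 then g n else 0)"
        by (rule sum.inter_filter) simp
      finally show ?thesis .
    qed
    define R where "R = (\<Sum>n = 1..N. if \<not> prime n then g n else 0)"
    have "R = (\<Sum>n | n \<in> {1..N} \<and> \<not> prime n. g n)"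
      unfolding R_def by (rule sum.inter_filter[symmetric]) simp
    then have R: "R \<le> C" using C[of N] by (simp add: g_def)
    have SX: "S + X = (\<Sum>n = 1..N. (1 + chi4 n) * g n)"
      
      unfolding S_def X_def g_def sum.distrib[symmetric] by (intro sum.cong refl) (simp add: algebra_simps add_divide_distrib)
    have "2 * P \<le> S + X"
      unfolding SX P sum_distrib_left
    proof (rule sum_mono)
      fix n show "2 * (if prime n \<and> n mod 4 = 1 then g n else 0) \<le> (1 + chi4 n) * g n"
        using g0[of n] chi4_bound[of n] by (auto simp: chi4_def)
    qed
    moreover have "S + X \<le> 2 * P + 2 * R + g 2"
    proof -
      have "(1 + chi4 n) * g n \<le> 2 * (if prime n \<and> n mod 4 = 1 then g n else 0)
          + 2 * (if \<not> prime n then g n else 0) + (if n = 2 then g 2 else 0)" for n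
      proof (cases "prime n \<and> n \<noteq> 2")
        case True
        then have "odd n" using prime_odd_nat prime_ge_2_nat[of n] by auto
        then have "n mod 4 = 1 \<or> n mod 4 = 3" by presburger
        then show ?thesis using True by (auto simp: chi4_def)
      next
        case False
        have "(1 + chi4 n) * g n \<le> 2 * g n"
          using g0[of n] chi4_bound[of n] by (intro mult_right_mono) (auto simp: abs_le_iff)
        moreover have "chi4 2 = 0" by (simp add: chi4_def)
        ultimately show ?thesis using False g0[of n] by (cases "n = 2") simp_all
      qed
      then have "S + X \<le> (\<Sum>n = 1..N. 2 * (if prime n \<and> n mod 4 = 1 then g n else 0)
          + 2 * (if \<not> prime n then g n else 0) + (if n = 2 then g 2 else 0))"
        unfolding SX by (intro sum_mono)
      also have "\<dots> = 2 * P + 2 * R + (\<Sum>n = 1..N. if n = 2 then g 2 else 0)"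
        unfolding P R_def by (simp only: sum.distrib sum_distrib_left)
      also have "(\<Sum>n = 1..N. if n = 2 then g 2 else 0) = g 2" using N by simp
      finally show ?thesis .
    qed
    moreover have "g 2 \<le> 1" using ln_2_less_1 by (simp add: g_def)
    moreover have "S \<ge> ln (real N) - 1" "S \<le> ln (real N) + 4"
      using mertens_mangoldt[of N] N by (auto simp: S_def g_def)
    moreover have "\<bar>X\<bar> \<le> 11" using mertens_chi4[OF N] by (simp add: X_def)
    ultimately show "\<bar>prime_log_sum N - ln (real N) / 2\<bar> \<le> 10 + C"
      using R C0 unfolding P_def[symmetric] by linarith
  qed
qed

text \<open>Mertens' estimate with an error \<open>K\<close> forces total weight at least 1 on a
  window whose ratio 1 / \<delta> is large in terms of \<open>K\<close>. Each prime in it weighs at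
  most ln Y / (\<delta> Y), which gives the number of primes.\<close>

lemma primes_mod4_in_interval:
  "\<exists>\<delta> c. 0 < \<delta> \<and> \<delta> < 1 \<and> 0 < c \<and> (\<forall>\<^sub>F Y in at_top.
     c * Y / ln Y \<le> real (card {p. prime p \<and> p mod 4 = 1 \<and> \<delta> * Y < real p \<and> real p \<le> Y}))"
proof -
  obtain K where K0: "K > 0" and K: "\<And>N. N \<ge> 4 \<Longrightarrow>
      \<bar>prime_log_sum N - ln (real N) / 2\<bar> \<le> K"
    using mertens_primes_mod4 by blast
  \<comment> \<open>The difference of two Mertens estimates loses 2K; half of the logarithmic length
    4K + 2 exceeds this by 1. The factor 1/2 allows for rounding \<open>Y\<close> down to
    \<open>N\<close>.\<close>
  define \<delta> where "\<delta> = exp (- 4 * K - 2) / 2"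
  have \<delta>: "0 < \<delta>" "\<delta> < 1"
  proof -
    have "exp (- 4 * K - 2) \<le> 1" using K0 by simp
    then show "\<delta> < 1" unfolding \<delta>_def by linarith
    show "0 < \<delta>" by (simp add: \<delta>_def)
  qed
  have "\<forall>\<^sub>F Y in at_top.
     \<delta> * Y / ln Y \<le> real (card {p. prime p \<and> p mod 4 = 1 \<and> \<delta> * Y < real p \<and> real p \<le> Y})"
  proof (rule eventually_mono[OF eventually_ge_at_top[of "8 / \<delta>"]])
    fix Y :: real assume Y: "Y \<ge> 8 / \<delta>"
    then have dY: "\<delta> * Y \<ge> 8" using \<delta> by (simp add: field_simps)
    moreover have "\<delta> * Y \<le> 1 * Y" using dY \<delta> by (intro mult_right_mono) (auto simp: zero_le_mult_iff intro: order_trans[OF _ Y])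
    ultimately have Y8: "Y \<ge> 8" by linarith
    define M where "M = nat \<lfloor>\<delta> * Y\<rfloor>"
    define N where "N = nat \<lfloor>Y\<rfloor>"
    have M: "real M \<le> \<delta> * Y" "\<delta> * Y < real M + 1" using dY by (simp_all add: M_def)
    have N: "real N \<le> Y" "Y < real N + 1" using Y8 by (simp_all add: N_def)
    have M4: "M \<ge> 4" "N \<ge> 4" using M N dY Y8 by linarith+
    have MN: "M \<le> N" unfolding M_def N_def using \<open>\<delta> * Y \<le> 1 * Y\<close> by (intro nat_mono floor_mono) simp
    define Q where "Q = {p. prime p \<and> p mod 4 = 1 \<and> \<delta> * Y < real p \<and> real p \<le> Y}"
    have QMN: "Q = {p. p \<in> {M<..N} \<and> prime p \<and> p mod 4 = 1}"
    proof (intro equalityI subsetI)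
      fix p assume "p \<in> Q"
      then have p: "prime p" "p mod 4 = 1" "\<delta> * Y < real p" "real p \<le> Y" by (auto simp: Q_def)
      have "M < p" "p \<le> N" using M N p by linarith+
      then show "p \<in> {p. p \<in> {M<..N} \<and> prime p \<and> p mod 4 = 1}" using p by simp
    next
      fix p assume "p \<in> {p. p \<in> {M<..N} \<and> prime p \<and> p mod 4 = 1}"
      then have p: "prime p" "p mod 4 = 1" "M + 1 \<le> p" "p \<le> N" by auto
      then have "real M + 1 \<le> real p" "real p \<le> real N" by linarith+
      then show "p \<in> Q" using M N p by (auto simp: Q_def)
    qed
    have finQ: "finite Q" by (simp add: QMN)
    define f where "f = (\<lambda>p::nat. ln (real p) / real p)"
    have "prime_log_sum N = prime_log_sum M + (\<Sum>p\<in>Q. f p)"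
    proof -
      have "{p. p \<in> {1..N} \<and> prime p \<and> p mod 4 = 1} = {p. p \<in> {1..M} \<and> prime p \<and> p mod 4 = 1} \<union> Q"
        using MN by (auto simp: QMN)
      moreover have "{p. p \<in> {1..M} \<and> prime p \<and> p mod 4 = 1} \<inter> Q = {}" by (auto simp: QMN)
      ultimately show ?thesis using finQ by (simp add: prime_log_sum_def f_def sum.union_disjoint)
    qed
    moreover note K[OF M4(1)] K[OF M4(2)]
    ultimately have fQ: "(\<Sum>p\<in>Q. f p) \<ge> ln (real N) / 2 - ln (real M) / 2 - 2 * K"
      by (simp only: abs_le_iff) linarith
    have "ln (real N) - ln (real M) \<ge> 4 * K + 2"
    proof -
      have "ln (Y / 2) \<le> ln (real N)" using N Y8 M4 by (subst ln_le_cancel_iff) auto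
      moreover have "ln (real M) \<le> ln (\<delta> * Y)" using M M4 dY by (subst ln_le_cancel_iff) auto
      moreover have "\<delta> * Y = exp (- 4 * K - 2) * (Y / 2)" by (simp add: \<delta>_def)
      then have "ln (\<delta> * Y) = (- 4 * K - 2) + ln (Y / 2)" using Y8 by (simp only:) (subst ln_mult, auto)
      ultimately show ?thesis by linarith
    qed
    with fQ have "1 \<le> (\<Sum>p\<in>Q. f p)" by linarith
    also have "\<dots> \<le> (\<Sum>p\<in>Q. ln Y / (\<delta> * Y))"
    proof (rule sum_mono)
      fix p assume "p \<in> Q"
      then have "prime p" "\<delta> * Y < real p" "real p \<le> Y" by (auto simp: Q_def)
      then show "f p \<le> ln Y / (\<delta> * Y)" unfolding f_def using dY Y8
        by (intro frac_le) (auto simp: prime_gt_0_nat)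
    qed
    also have "\<dots> = real (card Q) * (ln Y / (\<delta> * Y))" by simp
    finally show "\<delta> * Y / ln Y \<le> real (card {p. prime p \<and> p mod 4 = 1 \<and> \<delta> * Y < real p \<and> real p \<le> Y})"
      using dY Y8 \<delta> unfolding Q_def[symmetric] by (simp add: field_simps)
  qed
  with \<delta> show ?thesis by blast
qed

section \<open>Selberg sieve\<close>

lemma prime_factors_prod_primes:
  fixes D :: "nat set"
  assumes fin: "finite D" and pr: "\<And>p. p \<in> D \<Longrightarrow> prime p"
  shows "prime_factors (\<Prod>D) = D"
proof (rule Set.set_eqI)
  fix p
  have "\<Prod>D > 0" by (rule prod_pos) (rule prime_gt_0_nat[OF pr])
  then have "p \<in> prime_factors (\<Prod>D) \<longleftrightarrow> prime p \<and> p dvd \<Prod>D"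
    unfolding in_prime_factors_iff by blast
  also have "\<dots> \<longleftrightarrow> prime p \<and> (\<exists>q\<in>D. p dvd q)"
    using prime_dvd_prod_iff[OF fin, of p "\<lambda>q. q"] by blast
  also have "\<dots> \<longleftrightarrow> p \<in> D"
    using primes_dvd_imp_eq[of p] pr dvd_refl by metis
  finally show "p \<in> prime_factors (\<Prod>D) \<longleftrightarrow> p \<in> D" .
qed

text \<open>Moebius inversion on the lattice of subsets; in the sieve it evaluates the sums of the
  weights over supersets.\<close>

lemma alternating_interval_sum:
  assumes "finite M"
  shows "(\<Sum>D | F \<subseteq> D \<and> D \<subseteq> M. (-1) ^ card D) = (if F = M then (-1) ^ card M else (0::real))"
proof (cases "F \<subset> M")
  case True
  have "{D. F \<subseteq> D \<and> D \<subseteq> M} \<subseteq> Pow M" by auto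
  then have fin: "finite {D. F \<subseteq> D \<and> D \<subseteq> M}" using assms by (meson finite_Pow_iff finite_subset)
  have "{D \<in> {D. F \<subseteq> D \<and> D \<subseteq> M}. Q D} = {D. D \<subseteq> M \<and> F \<subseteq> D \<and> Q D}" for Q by blast
  then have "card {D \<in> {D. F \<subseteq> D \<and> D \<subseteq> M}. even (card D)} = card {D \<in> {D. F \<subseteq> D \<and> D \<subseteq> M}. odd (card D)}"
    using card_subsupersets_even_odd[OF assms True] by (simp only:)
  then have "(\<Sum>D | F \<subseteq> D \<and> D \<subseteq> M. (-1) ^ card D) = (0::real)"
    by (rule sum_alternating_cancels[OF fin])
  then show ?thesis using True by auto
next
  case False
  show ?thesis
  proof (cases "F = M")
    case True
    then have "{D. F \<subseteq> D \<and> D \<subseteq> M} = {M}" by auto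
    then show ?thesis using True by simp
  next
    case ne: False
    then have "{D. F \<subseteq> D \<and> D \<subseteq> M} = {}" using False by auto
    then show ?thesis using ne by (simp only: sum.empty if_False)
  qed
qed

text \<open>Squarefree numbers are represented by their sets of prime factors, and
  the weights come from diagonalising the quadratic form with the (slightly suboptimal) choice
  \<open>1 / f\<close> instead of \<open>1 / \<phi>(f)\<close>.\<close>

lemma selberg_sieve:
  fixes P :: "nat set" and R :: "nat \<Rightarrow> 'c \<Rightarrow> bool" and N :: real and z :: nat
  assumes finP: "finite P" and P: "\<And>p. p \<in> P \<Longrightarrow> prime p" and finC: "finite C" and N0: "N \<ge> 0"
    and z: "z \<ge> 1"
    and cnt: "\<And>D. D \<subseteq> P \<Longrightarrow> \<bar>real (card {c \<in> C. \<forall>p\<in>D. R p c}) - N / real (\<Prod>D)\<bar> \<le> 1"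
  shows "real (card {c \<in> C. \<forall>p\<in>P. \<not> R p c}) \<le>
     N / (\<Sum>D | D \<subseteq> P \<and> \<Prod>D \<le> z. 1 / real (\<Prod>D)) + real z ^ 4"
proof -
  define \<D> where "\<D> = {D. D \<subseteq> P \<and> \<Prod>D \<le> z}"
  define \<pi> where "\<pi> = (\<lambda>D::nat set. real (\<Prod>D))"
  define h where "h = (\<lambda>D. 1 / \<pi> D)"
  define G where "G = (\<Sum>D\<in>\<D>. h D)"
  define \<phi> where "\<phi> = (\<lambda>F::nat set. \<Prod>p\<in>F. real p - 1)"
  \<comment> \<open>Selberg's weights: \<open>lam D / \<pi> D\<close> is the Moebius inverse, over
    supersets, of the vector \<open>(-1) ^ card F * h F / G\<close>; the division by
    \<open>G\<close> normalises \<open>lam {}\<close> to 1.\<close>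
  define lam where "lam = (\<lambda>D. (-1) ^ card D * \<pi> D / G * (\<Sum>M\<in>{M\<in>\<D>. D \<subseteq> M}. h M))"
  have fin: "finite D" if "D \<subseteq> P" for D using that finP finite_subset by blast
  have fin\<D>: "finite \<D>" using finP by (auto simp: \<D>_def intro: finite_subset[of _ "Pow P"])
  have prod_pos: "\<Prod>D > 0" if "D \<subseteq> P" for D
    using that P by (intro prod_pos) (auto dest!: P[OF subsetD] simp: prime_gt_0_nat)
  have \<pi>pos: "\<pi> D > 0" if "D \<subseteq> P" for D using prod_pos[OF that] by (simp add: \<pi>_def del: of_nat_prod)
  have hpos: "h D > 0" if "D \<subseteq> P" for D using \<pi>pos[OF that] by (simp add: h_def)
  have \<D>P: "D \<subseteq> P" if "D \<in> \<D>" for D using that by (simp add: \<D>_def)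
  have e\<D>: "{} \<in> \<D>" using z by (simp add: \<D>_def)
  have G: "G > 0" unfolding G_def using fin\<D> e\<D> hpos \<D>P by (intro sum_pos) auto
  have sub\<D>: "F \<in> \<D>" if "D \<in> \<D>" "F \<subseteq> D" for D F
  proof -
    have "\<Prod>F dvd \<Prod>D" using that fin \<D>P by (intro prod_dvd_prod_subset) auto
    then have "\<Prod>F \<le> \<Prod>D" using prod_pos \<D>P that(1) by (intro dvd_imp_le) auto
    then show ?thesis using that by (auto simp: \<D>_def)
  qed
  have card\<D>: "card \<D> \<le> z"
  proof -
    have "inj_on Prod \<D>"
    proof (rule inj_onI)
      fix D E assume DE: "D \<in> \<D>" "E \<in> \<D>" "\<Prod>D = \<Prod>E"
      have "prime_factors (\<Prod>D) = D" if "D \<in> \<D>" for D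
        using fin P \<D>P[OF that] by (intro prime_factors_prod_primes) blast+
      then show "D = E" using DE by metis
    qed
    moreover have "Prod ` \<D> \<subseteq> {1..z}"
    proof
      fix n assume "n \<in> Prod ` \<D>"
      then obtain D where D: "D \<in> \<D>" "n = \<Prod>D" by blast
      then have "n > 0" using prod_pos[OF \<D>P] by simp
      moreover have "n \<le> z" using D by (simp add: \<D>_def)
      ultimately show "n \<in> {1..z}" by simp
    qed
    ultimately have "card \<D> \<le> card {1..z}" by (intro card_inj_on_le[of Prod]) auto
    then show ?thesis by simp
  qed
  have lam1: "lam {} = 1" using G by (simp add: lam_def \<pi>_def G_def)
  have lamb: "\<bar>lam D\<bar> \<le> real z" if "D \<in> \<D>" for D
  proof -
    define s where "s = (\<Sum>M\<in>{M\<in>\<D>. D \<subseteq> M}. h M)"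
    have "s \<le> G" unfolding G_def s_def
      using fin\<D> hpos \<D>P by (intro sum_mono2) (auto intro: less_imp_le)
    moreover have s0: "s \<ge> 0" unfolding s_def
      using hpos \<D>P by (intro sum_nonneg) (auto intro: less_imp_le)
    ultimately have "\<pi> D * (s / G) \<le> \<pi> D * 1"
      using G \<pi>pos[OF \<D>P[OF that]] by (intro mult_left_mono) auto
    moreover have "\<bar>lam D\<bar> = \<pi> D * (s / G)"
      using s0 G \<pi>pos[OF \<D>P[OF that]] by (simp add: lam_def abs_mult power_abs flip: s_def)
    moreover have "\<pi> D \<le> real z" using that by (simp add: \<D>_def \<pi>_def del: of_nat_prod)
    ultimately show ?thesis by simp
  qed
  \<comment> \<open>Unions stand for least common multiples. The reciprocal of the lcm is the gcd
    over the product, and the gcd is the sum of Euler's function \<open>\<phi>\<close> over its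
    divisors; this is what diagonalises the quadratic form.\<close>
  have inv: "1 / \<pi> (D \<union> E) = (\<Sum>F | F \<subseteq> D \<and> F \<subseteq> E. \<phi> F) / (\<pi> D * \<pi> E)" if "D \<subseteq> P" "E \<subseteq> P" for D E
  proof -
    have fDE: "finite D" "finite E" using fin that by auto
    have "(\<Sum>F\<in>Pow (D \<inter> E). \<phi> F) = (\<Prod>p\<in>D \<inter> E. (real p - 1) + 1)"
      using prod_add[of "D \<inter> E" "\<lambda>p. real p - 1" "\<lambda>_. 1"] fDE by (simp add: \<phi>_def)
    also have "\<dots> = \<pi> (D \<inter> E)" by (simp add: \<pi>_def)
    also have "Pow (D \<inter> E) = {F. F \<subseteq> D \<and> F \<subseteq> E}" by auto
    finally have "(\<Sum>F | F \<subseteq> D \<and> F \<subseteq> E. \<phi> F) = \<pi> (D \<inter> E)" .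
    moreover have "\<pi> (D \<union> E) * \<pi> (D \<inter> E) = \<pi> D * \<pi> E"
      using prod.union_inter[of D E "\<lambda>p. p"] fDE by (simp add: \<pi>_def flip: of_nat_mult of_nat_prod)
    moreover have "\<pi> D > 0" "\<pi> E > 0" "\<pi> (D \<union> E) > 0" using \<pi>pos that by auto
    ultimately show ?thesis by (subst frac_eq_eq) (auto simp: mult.commute)
  qed
  have y: "(\<Sum>D\<in>{D\<in>\<D>. F \<subseteq> D}. lam D / \<pi> D) = (-1) ^ card F * h F / G" if F: "F \<in> \<D>" for F
  proof -
    have "(\<Sum>D\<in>{D\<in>\<D>. F \<subseteq> D}. lam D / \<pi> D) =
        (\<Sum>D\<in>{D\<in>\<D>. F \<subseteq> D}. \<Sum>M\<in>{M\<in>\<D>. D \<subseteq> M}. (-1) ^ card D * h M / G)"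
    proof (intro sum.cong refl)
      fix D assume "D \<in> {D\<in>\<D>. F \<subseteq> D}"
      then have "\<pi> D > 0" using \<pi>pos \<D>P by auto
      then show "lam D / \<pi> D = (\<Sum>M\<in>{M\<in>\<D>. D \<subseteq> M}. (-1) ^ card D * h M / G)"
        by (simp add: lam_def sum_distrib_left sum_divide_distrib)
    qed
    also have "\<dots> = (\<Sum>M\<in>\<D>. \<Sum>D\<in>{D\<in>{D\<in>\<D>. F \<subseteq> D}. D \<subseteq> M}. (-1) ^ card D * h M / G)"
      using fin\<D> by (intro sum.swap_restrict) auto
    also have "\<dots> = (\<Sum>M\<in>\<D>. h M / G * (\<Sum>D | F \<subseteq> D \<and> D \<subseteq> M. (-1) ^ card D))"
    proof (intro sum.cong refl)
      fix M assume M: "M \<in> \<D>"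
      have "{D\<in>{D\<in>\<D>. F \<subseteq> D}. D \<subseteq> M} = {D. F \<subseteq> D \<and> D \<subseteq> M}" using sub\<D>[OF M] by auto
      then show "(\<Sum>D\<in>{D\<in>{D\<in>\<D>. F \<subseteq> D}. D \<subseteq> M}. (-1) ^ card D * h M / G) =
          h M / G * (\<Sum>D | F \<subseteq> D \<and> D \<subseteq> M. (-1) ^ card D)"
        by (simp add: sum_distrib_left mult.commute)
    qed
    also have "\<dots> = (\<Sum>M\<in>\<D>. if F = M then h M / G * (-1) ^ card M else 0)"
      using fin \<D>P by (intro sum.cong refl) (simp add: alternating_interval_sum)
    also have "\<dots> = (-1) ^ card F * h F / G" using F fin\<D> by simp
    finally show ?thesis .
  qed
  \<comment> \<open>The form is a sum of \<open>\<phi> F\<close> times squares of the sums computed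
    in \<open>y\<close>. As \<open>\<phi> F\<close> is at most \<open>\<pi> F\<close>, each term is
    at most h F / G^2, and these add up to 1 / G.\<close>
  have form: "(\<Sum>D\<in>\<D>. \<Sum>E\<in>\<D>. lam D * lam E / \<pi> (D \<union> E)) \<le> 1 / G"
  proof -
    have "(\<Sum>D\<in>\<D>. \<Sum>E\<in>\<D>. lam D * lam E / \<pi> (D \<union> E)) =
        (\<Sum>D\<in>\<D>. \<Sum>E\<in>\<D>. \<Sum>F\<in>{F\<in>\<D>. F \<subseteq> D \<and> F \<subseteq> E}. \<phi> F * (lam D / \<pi> D) * (lam E / \<pi> E))"
    proof (intro sum.cong refl)
      fix D E assume DE: "D \<in> \<D>" "E \<in> \<D>"
      have "{F\<in>\<D>. F \<subseteq> D \<and> F \<subseteq> E} = {F. F \<subseteq> D \<and> F \<subseteq> E}" using sub\<D>[OF DE(1)] by blast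
      then have "1 / \<pi> (D \<union> E) = (\<Sum>F\<in>{F\<in>\<D>. F \<subseteq> D \<and> F \<subseteq> E}. \<phi> F) / (\<pi> D * \<pi> E)"
        using inv[OF \<D>P[OF DE(1)] \<D>P[OF DE(2)]] by (simp only:)
      moreover have "x * y * (s / (a * b)) = s * ((x / a) * (y / b))" for x y s a b :: real by simp
      ultimately have "lam D * lam E * (1 / \<pi> (D \<union> E)) =
          (\<Sum>F\<in>{F\<in>\<D>. F \<subseteq> D \<and> F \<subseteq> E}. \<phi> F) * ((lam D / \<pi> D) * (lam E / \<pi> E))"
        by (simp only:)
      moreover have "lam D * lam E / \<pi> (D \<union> E) = lam D * lam E * (1 / \<pi> (D \<union> E))" by simp
      ultimately show "lam D * lam E / \<pi> (D \<union> E) =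
          (\<Sum>F\<in>{F\<in>\<D>. F \<subseteq> D \<and> F \<subseteq> E}. \<phi> F * (lam D / \<pi> D) * (lam E / \<pi> E))"
        by (simp only: sum_distrib_right mult.assoc)
    qed
    also have "\<dots> = (\<Sum>D\<in>\<D>. \<Sum>E\<in>\<D>. \<Sum>F\<in>\<D>. if F \<subseteq> D \<and> F \<subseteq> E then \<phi> F * (lam D / \<pi> D) * (lam E / \<pi> E) else 0)"
      by (rule sum.cong[OF refl], rule sum.cong[OF refl], rule sum.inter_filter[OF fin\<D>])
    also have "\<dots> = (\<Sum>D\<in>\<D>. \<Sum>F\<in>\<D>. \<Sum>E\<in>\<D>. if F \<subseteq> D \<and> F \<subseteq> E then \<phi> F * (lam D / \<pi> D) * (lam E / \<pi> E) else 0)"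
      by (rule sum.cong[OF refl], rule sum.swap)
    also have "\<dots> = (\<Sum>F\<in>\<D>. \<Sum>D\<in>\<D>. \<Sum>E\<in>\<D>. if F \<subseteq> D \<and> F \<subseteq> E then \<phi> F * (lam D / \<pi> D) * (lam E / \<pi> E) else 0)"
      by (rule sum.swap)
    also have "\<dots> = (\<Sum>F\<in>\<D>. \<phi> F * (\<Sum>D\<in>{D\<in>\<D>. F \<subseteq> D}. lam D / \<pi> D)\<^sup>2)"
    proof (intro sum.cong refl)
      fix F
      have "(\<Sum>D\<in>{D\<in>\<D>. F \<subseteq> D}. lam D / \<pi> D) = (\<Sum>D\<in>\<D>. if F \<subseteq> D then lam D / \<pi> D else 0)"
        using fin\<D> by (rule sum.inter_filter)
      then have "\<phi> F * (\<Sum>D\<in>{D\<in>\<D>. F \<subseteq> D}. lam D / \<pi> D)\<^sup>2 =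
          (\<Sum>D\<in>\<D>. \<Sum>E\<in>\<D>. \<phi> F * ((if F \<subseteq> D then lam D / \<pi> D else 0) * (if F \<subseteq> E then lam E / \<pi> E else 0)))"
        by (simp only: power2_eq_square sum_product) (simp only: sum_distrib_left)
      then show "(\<Sum>D\<in>\<D>. \<Sum>E\<in>\<D>. if F \<subseteq> D \<and> F \<subseteq> E then \<phi> F * (lam D / \<pi> D) * (lam E / \<pi> E) else 0) =
          \<phi> F * (\<Sum>D\<in>{D\<in>\<D>. F \<subseteq> D}. lam D / \<pi> D)\<^sup>2"
        by (simp only:) (rule sum.cong[OF refl], rule sum.cong[OF refl], simp)
    qed
    also have "\<dots> = (\<Sum>F\<in>\<D>. \<phi> F * (h F)\<^sup>2 / G\<^sup>2)"
    proof (rule sum.cong[OF refl])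
      fix F assume F: "F \<in> \<D>"
      have "((-1) ^ card F * h F / G)\<^sup>2 = (h F)\<^sup>2 / G\<^sup>2"
        by (cases "even (card F)") (simp_all add: power_divide)
      then show "\<phi> F * (\<Sum>D\<in>{D\<in>\<D>. F \<subseteq> D}. lam D / \<pi> D)\<^sup>2 = \<phi> F * (h F)\<^sup>2 / G\<^sup>2"
        by (simp only: y[OF F] times_divide_eq_right)
    qed
    also have "\<dots> \<le> (\<Sum>F\<in>\<D>. h F / G\<^sup>2)"
    proof (intro sum_mono divide_right_mono)
      fix F assume F: "F \<in> \<D>"
      have "\<phi> F \<le> \<pi> F" unfolding \<phi>_def \<pi>_def of_nat_prod
      proof (rule prod_mono)
        fix p assume "p \<in> F"
        then have "prime p" using P \<D>P[OF F] by blast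
        then have "p \<ge> 1" by (rule prime_ge_1_nat)
        then show "0 \<le> real p - 1 \<and> real p - 1 \<le> real p" by simp
      qed
      then have "\<phi> F * (h F)\<^sup>2 \<le> \<pi> F * (h F)\<^sup>2" by (intro mult_right_mono) auto
      also have "\<dots> = h F" using \<pi>pos[OF \<D>P[OF F]] by (simp add: h_def power2_eq_square)
      finally show "\<phi> F * (h F)\<^sup>2 \<le> h F" .
    qed auto
    also have "\<dots> = (\<Sum>F\<in>\<D>. h F) / G\<^sup>2" by (rule sum_divide_distrib[symmetric])
    also have "\<dots> = 1 / G" using G unfolding G_def[symmetric] power2_eq_square by simp
    finally show ?thesis .
  qed
  define S where "S = (\<lambda>c. {p\<in>P. R p c})"
  have "real (card {c \<in> C. \<forall>p\<in>P. \<not> R p c}) = (\<Sum>c\<in>C. if \<forall>p\<in>P. \<not> R p c then 1 else 0)"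
    using finC by (simp add: sum.If_cases Int_def)
  \<comment> \<open>A square is never negative, and it equals 1 when \<open>S c\<close> is empty,
    because then only \<open>lam {}\<close> survives.\<close>
  also have "\<dots> \<le> (\<Sum>c\<in>C. (\<Sum>D\<in>\<D>. if D \<subseteq> S c then lam D else 0)\<^sup>2)"
  proof (intro sum_mono)
    fix c
    show "(if \<forall>p\<in>P. \<not> R p c then 1 else 0) \<le> (\<Sum>D\<in>\<D>. if D \<subseteq> S c then lam D else 0)\<^sup>2"
    proof (cases "\<forall>p\<in>P. \<not> R p c")
      case True
      then have "S c = {}" by (auto simp: S_def)
      then have "(\<Sum>D\<in>\<D>. if D \<subseteq> S c then lam D else 0) = (\<Sum>D\<in>\<D>. if D = {} then lam {} else 0)"
        by (intro sum.cong) auto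
      also have "\<dots> = 1" using fin\<D> e\<D> lam1 by simp
      finally show ?thesis by simp
    next
      case False
      then show ?thesis by (simp only: if_False zero_le_power2)
    qed
  qed
  also have "\<dots> = (\<Sum>c\<in>C. \<Sum>D\<in>\<D>. \<Sum>E\<in>\<D>. if D \<union> E \<subseteq> S c then lam D * lam E else 0)"
  proof (rule sum.cong[OF refl])
    fix c
    have "(\<Sum>D\<in>\<D>. if D \<subseteq> S c then lam D else 0)\<^sup>2 = (\<Sum>D\<in>\<D>. \<Sum>E\<in>\<D>.
        (if D \<subseteq> S c then lam D else 0) * (if E \<subseteq> S c then lam E else 0))"
      by (simp only: power2_eq_square sum_product)
    also have "\<dots> = (\<Sum>D\<in>\<D>. \<Sum>E\<in>\<D>. if D \<union> E \<subseteq> S c then lam D * lam E else 0)"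
      by (intro sum.cong refl) (simp add: Un_subset_iff)
    finally show "(\<Sum>D\<in>\<D>. if D \<subseteq> S c then lam D else 0)\<^sup>2 =
        (\<Sum>D\<in>\<D>. \<Sum>E\<in>\<D>. if D \<union> E \<subseteq> S c then lam D * lam E else 0)" .
  qed
  also have "\<dots> = (\<Sum>D\<in>\<D>. \<Sum>c\<in>C. \<Sum>E\<in>\<D>. if D \<union> E \<subseteq> S c then lam D * lam E else 0)" by (rule sum.swap)
  also have "\<dots> = (\<Sum>D\<in>\<D>. \<Sum>E\<in>\<D>. \<Sum>c\<in>C. if D \<union> E \<subseteq> S c then lam D * lam E else 0)"
    by (rule sum.cong[OF refl], rule sum.swap)
  also have "\<dots> = (\<Sum>D\<in>\<D>. \<Sum>E\<in>\<D>. lam D * lam E * real (card {c\<in>C. \<forall>p\<in>D \<union> E. R p c}))"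
  proof (intro sum.cong refl)
    fix D E assume "D \<in> \<D>" "E \<in> \<D>"
    then have "{c\<in>C. \<forall>p\<in>D \<union> E. R p c} = {c\<in>C. D \<union> E \<subseteq> S c}" using \<D>P by (auto simp: S_def)
    then show "(\<Sum>c\<in>C. if D \<union> E \<subseteq> S c then lam D * lam E else 0) =
        lam D * lam E * real (card {c\<in>C. \<forall>p\<in>D \<union> E. R p c})"
      using finC by (simp add: sum.inter_filter[symmetric] mult.commute del: Un_subset_iff)
  qed
  \<comment> \<open>The errors in \<open>cnt\<close> are at most 1. There are at most z^2 pairs (D,
    E), each with a product of weights bounded by z^2; together they give z^4.\<close>
  also have "\<dots> \<le> (\<Sum>D\<in>\<D>. \<Sum>E\<in>\<D>. N * (lam D * lam E / \<pi> (D \<union> E)) + real z * real z)"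
  proof (intro sum_mono)
    fix D E assume DE: "D \<in> \<D>" "E \<in> \<D>"
    define k where "k = real (card {c\<in>C. \<forall>p\<in>D \<union> E. R p c})"
    have "\<bar>k - N / \<pi> (D \<union> E)\<bar> \<le> 1" using cnt[of "D \<union> E"] DE \<D>P by (simp add: k_def \<pi>_def)
    moreover have "\<bar>lam D * lam E\<bar> \<le> real z * real z" unfolding abs_mult using lamb DE by (intro mult_mono) auto
    ultimately have "\<bar>lam D * lam E\<bar> * \<bar>k - N / \<pi> (D \<union> E)\<bar> \<le> (real z * real z) * 1"
      by (intro mult_mono) auto
    then have "lam D * lam E * (k - N / \<pi> (D \<union> E)) \<le> real z * real z"
      by (metis abs_ge_self abs_mult mult_1_right order_trans)
    moreover have "lam D * lam E * (k - N / \<pi> (D \<union> E)) = lam D * lam E * k - N * (lam D * lam E / \<pi> (D \<union> E))"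
      by (simp add: right_diff_distrib)
    ultimately show "lam D * lam E * k \<le> N * (lam D * lam E / \<pi> (D \<union> E)) + real z * real z"
      by linarith
  qed
  also have "\<dots> = N * (\<Sum>D\<in>\<D>. \<Sum>E\<in>\<D>. lam D * lam E / \<pi> (D \<union> E)) + real (card \<D>) ^ 2 * (real z * real z)"
    by (simp add: sum.distrib sum_distrib_left power2_eq_square)
  also have "\<dots> \<le> N * (1 / G) + real z ^ 2 * (real z * real z)"
    using form N0 card\<D> by (intro add_mono mult_left_mono mult_right_mono power_mono) auto
  also have "N * (1 / G) = N / (\<Sum>D | D \<subseteq> P \<and> \<Prod>D \<le> z. 1 / real (\<Prod>D))"
    unfolding G_def h_def \<pi>_def \<D>_def by (rule times_divide_eq_right[of N 1, unfolded mult_1_right])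
  also have "real z ^ 2 * (real z * real z) = real z ^ 4"
    by (simp only: power2_eq_square power4_eq_xxxx mult.assoc)
  finally show ?thesis .
qed

section \<open>Sieving arithmetic progressions\<close>

lemma le_div_iff_mult_le_int:
  fixes a d k :: int
  assumes "d > 0"
  shows "k \<le> a div d \<longleftrightarrow> d * k \<le> a"
proof
  assume "k \<le> a div d"
  then have "d * k \<le> d * (a div d)" using assms by simp
  also have "\<dots> \<le> a" using assms pos_mod_sign[of d a] mult_div_mod_eq[of d a] by linarith
  finally show "d * k \<le> a" .
next
  assume "d * k \<le> a"
  then have "(d * k) div d \<le> a div d" using assms by (rule zdiv_mono1)
  then show "k \<le> a div d" using assms by simp
qed

text \<open>Inverting \<alpha> modulo \<open>d\<close> turns the condition into a single residue
  class, which an interval meets as expected up to an error of 1. This supplies the hypothesis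
  \<open>cnt\<close> of the sieve.\<close>

lemma card_progression:
  fixes \<alpha> \<beta> lo N d :: int
  assumes d: "d > 0" and cop: "coprime \<alpha> d" and N: "N \<ge> 0"
  shows "\<bar>real (card {c \<in> {lo..<lo + N}. d dvd \<alpha> * c + \<beta>}) - real_of_int N / real_of_int d\<bar> \<le> 1"
proof -
  obtain w where w: "[\<alpha> * w = 1] (mod d)" using cong_solve_coprime_int[OF cop] by blast
  define r where "r = - w * \<beta>"
  have r: "d dvd \<alpha> * r + \<beta>"
  proof -
    have "\<alpha> * r + \<beta> = - (\<beta> * (\<alpha> * w - 1))" by (simp add: r_def algebra_simps)
    then show ?thesis using w by (simp add: cong_iff_dvd_diff)
  qed
  have iff: "d dvd \<alpha> * c + \<beta> \<longleftrightarrow> d dvd c - r" for c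
  proof -
    have "\<alpha> * c + \<beta> = \<alpha> * (c - r) + (\<alpha> * r + \<beta>)" by (simp add: algebra_simps)
    then have "d dvd \<alpha> * c + \<beta> \<longleftrightarrow> d dvd \<alpha> * (c - r)" by (simp only: dvd_add_left_iff[OF r])
    also have "\<dots> \<longleftrightarrow> d dvd c - r" using cop by (simp add: coprime_commute coprime_dvd_mult_right_iff)
    finally show ?thesis .
  qed
  define k0 where "k0 = (lo - 1 - r) div d"
  define k1 where "k1 = (lo + N - 1 - r) div d"
  have "{c \<in> {lo..<lo + N}. d dvd \<alpha> * c + \<beta>} = (\<lambda>k. r + d * k) ` {k0<..k1}"
  proof (intro equalityI subsetI)
    fix c assume "c \<in> {c \<in> {lo..<lo + N}. d dvd \<alpha> * c + \<beta>}"
    then have c: "lo \<le> c" "c < lo + N" "d dvd c - r" using iff by auto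
    then obtain k where k: "c = r + d * k" by (metis add_diff_cancel_left' diff_add_cancel dvdE add.commute)
    have "k \<le> k1" using c(2) k le_div_iff_mult_le_int[OF d, of k "lo + N - 1 - r"] by (simp add: k1_def)
    moreover have "\<not> k \<le> k0" using c(1) k le_div_iff_mult_le_int[OF d, of k "lo - 1 - r"] by (simp add: k0_def)
    ultimately show "c \<in> (\<lambda>k. r + d * k) ` {k0<..k1}" using k by auto
  next
    fix c assume "c \<in> (\<lambda>k. r + d * k) ` {k0<..k1}"
    then obtain k where "k \<in> {k0<..k1}" "c = r + d * k" by blast
    then have k: "c = r + d * k" "\<not> k \<le> k0" "k \<le> k1" by auto
    have "c < lo + N" using k le_div_iff_mult_le_int[OF d, of k "lo + N - 1 - r"] by (simp add: k1_def)
    moreover have "lo \<le> c" using k le_div_iff_mult_le_int[OF d, of k "lo - 1 - r"] by (simp add: k0_def)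
    ultimately show "c \<in> {c \<in> {lo..<lo + N}. d dvd \<alpha> * c + \<beta>}" using iff k(1) by simp
  qed
  moreover have "inj_on (\<lambda>k. r + d * k) {k0<..k1}" using d by (auto simp: inj_on_def)
  ultimately have card: "card {c \<in> {lo..<lo + N}. d dvd \<alpha> * c + \<beta>} = nat (k1 - k0)"
    by (simp add: card_image)
  have "k0 \<le> k1" unfolding k0_def k1_def using N d by (intro zdiv_mono1) auto
  have b: "x / real_of_int d - 1 < real_of_int (a div d)" "real_of_int (a div d) \<le> x / real_of_int d"
    if "x = real_of_int a" for x a
    using that floor_correct[of "real_of_int a / real_of_int d"] by (simp_all add: floor_divide_of_int_eq)
  have "real_of_int (lo + N - 1 - r) / real_of_int d - real_of_int (lo - 1 - r) / real_of_int d
      = real_of_int N / real_of_int d"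
    by (simp flip: diff_divide_distrib)
  moreover have "real (nat (k1 - k0)) = real_of_int k1 - real_of_int k0" using \<open>k0 \<le> k1\<close> by simp
  ultimately show ?thesis
    using b[OF refl, of "lo + N - 1 - r"] b[OF refl, of "lo - 1 - r"] unfolding card k0_def k1_def by linarith
qed

lemma prod_primes_dvd_iff:
  fixes x :: int
  assumes "finite D" "\<And>p. p \<in> D \<Longrightarrow> prime p"
  shows "int (\<Prod>D) dvd x \<longleftrightarrow> (\<forall>p\<in>D. int p dvd x)"
  using assms
proof (induction D)
  case (insert p D)
  have "coprime p (\<Prod>D)"
  proof (intro prod_coprime_right)
    fix q assume "q \<in> D"
    with insert.hyps insert.prems show "coprime p q" by (intro primes_coprime) auto
  qed
  then have "coprime (int p) (int (\<Prod>D))" by (simp only: coprime_int_iff)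
  then have "int p * int (\<Prod>D) dvd x \<longleftrightarrow> int p dvd x \<and> int (\<Prod>D) dvd x"
    by (meson divides_mult dvd_mult_left dvd_mult_right)
  then show ?case using insert by simp
qed simp

lemma squarefree_eq_prod_prime_factors:
  fixes n :: nat
  assumes "squarefree n" "n \<noteq> 0"
  shows "\<Prod>(prime_factors n) = n"
proof -
  have "multiplicity p n = 1" if "p \<in> prime_factors n" for p
    using that assms by (auto simp: squarefree_factorial_semiring'' prime_factors_multiplicity
        dest!: spec[of _ p] simp: le_Suc_eq)
  then have "\<Prod>(prime_factors n) = (\<Prod>p\<in>prime_factors n. p ^ multiplicity p n)"
    by (intro prod.cong) auto
  also have "\<dots> = n" using assms(2) by (simp add: prod_prime_factors)
  finally show ?thesis .
qed

lemma sum_inverse_squares_le: "(\<Sum>s = 1..n. 1 / real s ^ 2) \<le> 2"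
proof -
  have "(\<Sum>s = 1..Suc n. 1 / real s ^ 2) \<le> 2 - 1 / real (Suc n)" for n
  proof (induction n)
    case (Suc n)
    have "1 / real (Suc (Suc n)) ^ 2 \<le> 1 / real (Suc n) - 1 / real (Suc (Suc n))"
    proof -
      have "1 / real (Suc (Suc n)) ^ 2 \<le> 1 / (real (Suc n) * real (Suc (Suc n)))"
        by (intro divide_left_mono) (auto simp: power2_eq_square)
      also have "\<dots> = 1 / real (Suc n) - 1 / real (Suc (Suc n))" by (simp add: field_simps)
      finally show ?thesis .
    qed
    with Suc show ?case by simp
  qed simp
  from this[of "n - 1"] show ?thesis
    by (cases n) (auto intro: order_trans)
qed

lemma subset_products_sum:
  assumes "finite E"
  shows "(\<Sum>X\<in>Pow E. 1 / real (\<Prod>X)) = (\<Prod>p\<in>E. 1 + 1 / real p)"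
  using prod_add[OF assms, of "\<lambda>p. 1 / real p" "\<lambda>_. 1"] by (simp add: prod_dividef add.commute)

text \<open>Every number up to \<open>z\<close> is a square times a squarefree number, whose prime
  factors split into those in \<open>E\<close> and the others. So the harmonic sum is at most a
  product of three sums, the first bounded by 2. This bounds the denominator of the sieve from below
  by a multiple of ln z.\<close>

lemma harm_le_sieve_sum:
  fixes E :: "nat set"
  assumes finE: "finite E"
  shows "harm z \<le> 2 * (\<Prod>p\<in>E. 1 + 1 / real p) *
    (\<Sum>D | D \<subseteq> {p. prime p \<and> p \<le> z \<and> p \<notin> E} \<and> \<Prod>D \<le> z. 1 / real (\<Prod>D))"
proof -
  define \<D> where "\<D> = {D. D \<subseteq> {p. prime p \<and> p \<le> z \<and> p \<notin> E} \<and> \<Prod>D \<le> z}"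
  have fin\<D>: "finite \<D>" by (rule finite_subset[of _ "Pow {..z}"]) (auto simp: \<D>_def)
  define pf where "pf = (\<lambda>n::nat. prime_factors (squarefree_part n))"
  define f where "f = (\<lambda>n::nat. (square_part n, pf n \<inter> E, pf n - E))"
  define w where "w = (\<lambda>(s, X, D). 1 / real s ^ 2 * (1 / real (\<Prod>X) * (1 / real (\<Prod>D))))"
  have split: "n = square_part n ^ 2 * (\<Prod>(pf n \<inter> E) * \<Prod>(pf n - E))" for n
  proof -
    have "\<Prod>(pf n \<inter> E) * \<Prod>(pf n - E) = \<Prod>(pf n)"
      by (subst prod.union_disjoint[symmetric]) (auto simp: pf_def intro: arg_cong[of _ _ Prod])
    also have "\<dots> = squarefree_part n" unfolding pf_def by (rule squarefree_eq_prod_prime_factors) auto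
    finally show ?thesis using squarefree_decompose[of n] by (simp add: mult.commute)
  qed
  have inj: "inj_on f {1..z}"
  proof (rule inj_onI)
    fix m n assume "f m = f n"
    then show "m = n" using split[of m] split[of n] by (auto simp: f_def)
  qed
  have img: "f ` {1..z} \<subseteq> {1..z} \<times> Pow E \<times> \<D>"
  proof
    fix u assume "u \<in> f ` {1..z}"
    then obtain n where n: "1 \<le> n" "n \<le> z" "u = f n" by auto
    define a where "a = square_part n"
    define b where "b = \<Prod>(pf n \<inter> E)"
    define c where "c = \<Prod>(pf n - E)"
    have e: "n = a ^ 2 * (b * c)" using split[of n] by (simp only: a_def b_def c_def)
    then have "a dvd n" "c dvd n" by (auto simp: power2_eq_square)
    then have "a \<le> n" "c \<le> n" using n(1) by (simp_all add: dvd_imp_le)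
    moreover have "a \<noteq> 0" using e n(1) by (cases "a = 0") simp_all
    ultimately have le: "a \<le> z" "c \<le> z" "a \<ge> 1" using n(2) by auto
    have "p \<le> z" if "p \<in> pf n" for p
    proof -
      have "p dvd squarefree_part n" using that by (auto simp: pf_def)
      then have "p dvd n" using squarefree_decompose[of n] by (metis dvd_mult2)
      then show ?thesis using n by (auto dest: dvd_imp_le)
    qed
    then have "pf n - E \<in> \<D>" using le(2) by (auto simp: \<D>_def c_def pf_def)
    then show "u \<in> {1..z} \<times> Pow E \<times> \<D>" using le n by (auto simp: f_def a_def)
  qed
  have "harm z = (\<Sum>n\<in>{1..z}. 1 / real n)" by (simp add: harm_def inverse_eq_divide)
  also have "\<dots> = (\<Sum>n\<in>{1..z}. w (f n))"
  proof (rule sum.cong[OF refl])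
    fix n
    have "real n = real (square_part n) ^ 2 * (real (\<Prod>(pf n \<inter> E)) * real (\<Prod>(pf n - E)))"
      using arg_cong[OF split[of n], of real] by (simp only: of_nat_mult of_nat_power)
    then show "1 / real n = w (f n)" by (simp add: w_def f_def del: of_nat_prod)
  qed
  also have "\<dots> = (\<Sum>u\<in>f ` {1..z}. w u)" using inj by (simp add: sum.reindex)
  also have "\<dots> \<le> (\<Sum>u\<in>{1..z} \<times> Pow E \<times> \<D>. w u)"
    using img finE fin\<D> by (intro sum_mono2) (auto simp: w_def prod_nonneg)
  also have "\<dots> = (\<Sum>s = 1..z. 1 / real s ^ 2) * ((\<Sum>X\<in>Pow E. 1 / real (\<Prod>X)) * (\<Sum>D\<in>\<D>. 1 / real (\<Prod>D)))"
    unfolding w_def sum_product sum.cartesian_product by (intro sum.cong refl) (simp add: case_prod_beta)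
  also have "\<dots> \<le> 2 * ((\<Sum>X\<in>Pow E. 1 / real (\<Prod>X)) * (\<Sum>D\<in>\<D>. 1 / real (\<Prod>D)))"
    by (intro mult_right_mono sum_inverse_squares_le mult_nonneg_nonneg sum_nonneg) (auto simp: prod_nonneg)
  also have "(\<Sum>X\<in>Pow E. 1 / real (\<Prod>X)) = (\<Prod>p\<in>E. 1 + 1 / real p)" using finE by (rule subset_products_sum)
  finally show ?thesis by (simp add: \<D>_def mult.assoc)
qed

text \<open>\<open>E\<close> contains the primes dividing \<alpha>, where all values lie in one
  residue class and sifting is impossible. Leaving out \<open>E\<close> costs a factor 1 + 1/p for
  each of its elements.\<close>

lemma sieve_progression:
  fixes \<alpha> \<beta> lo N :: int and z :: nat and E :: "nat set"
  assumes z: "z \<ge> 2" and finE: "finite E" and N: "N \<ge> 0"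
    and E: "\<And>p. prime p \<Longrightarrow> p \<notin> E \<Longrightarrow> \<not> int p dvd \<alpha>"
  shows "real (card {c \<in> {lo..<lo + N}. \<forall>p. prime p \<longrightarrow> p \<le> z \<longrightarrow> p \<notin> E \<longrightarrow> \<not> int p dvd \<alpha> * c + \<beta>})
     \<le> 2 * (\<Prod>p\<in>E. 1 + 1 / real p) * real_of_int N / ln (real z) + real z ^ 4"
proof -
  define P where "P = {p. prime p \<and> p \<le> z \<and> p \<notin> E}"
  define G where "G = (\<Sum>D | D \<subseteq> P \<and> \<Prod>D \<le> z. 1 / real (\<Prod>D))"
  define \<rho> where "\<rho> = (\<Prod>p\<in>E. 1 + 1 / real p)"
  have finP: "finite P" by (rule finite_subset[of _ "{..z}"]) (auto simp: P_def)
  have "real (card {c \<in> {lo..<lo + N}. \<forall>p\<in>P. \<not> int p dvd \<alpha> * c + \<beta>}) \<le> real_of_int N / G + real z ^ 4"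
    unfolding G_def
  proof (rule selberg_sieve)
    fix D assume D: "D \<subseteq> P"
    have finD: "finite D" using D finP finite_subset by blast
    have pr: "prime p" if "p \<in> D" for p using that D by (auto simp: P_def)
    have "{c \<in> {lo..<lo + N}. \<forall>p\<in>D. int p dvd \<alpha> * c + \<beta>} = {c \<in> {lo..<lo + N}. int (\<Prod>D) dvd \<alpha> * c + \<beta>}"
      using prod_primes_dvd_iff[OF finD pr] by blast
    moreover have "coprime \<alpha> (int (\<Prod>D))"
      unfolding of_nat_prod
    proof (intro prod_coprime_right)
      fix p assume p: "p \<in> D"
      have "\<not> int p dvd \<alpha>" using E pr[OF p] p D by (auto simp: P_def)
      then have "coprime (int p) \<alpha>" using pr[OF p] by (intro prime_imp_coprime) auto
      then show "coprime \<alpha> (int p)" by (simp add: coprime_commute)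
    qed
    moreover have "\<Prod>D > 0" using pr by (intro prod_pos) (auto simp: prime_gt_0_nat)
    ultimately show "\<bar>real (card {c \<in> {lo..<lo + N}. \<forall>p\<in>D. int p dvd \<alpha> * c + \<beta>}) - real_of_int N / real (\<Prod>D)\<bar> \<le> 1"
      using card_progression[of "int (\<Prod>D)" \<alpha> N lo \<beta>] N by (simp only: of_int_of_nat_eq of_nat_0_less_iff)
  qed (use finP N z in \<open>auto simp: P_def\<close>)
  also have "real_of_int N / G \<le> 2 * \<rho> * real_of_int N / ln (real z)"
  proof -
    have "ln (real z) \<le> ln (real z + 1)" using z by simp
    also have "\<dots> \<le> harm z" by (rule ln_le_harm)
    also have "\<dots> \<le> 2 * \<rho> * G" unfolding \<rho>_def G_def P_def by (rule harm_le_sieve_sum[OF finE])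
    finally have le: "ln (real z) \<le> 2 * \<rho> * G" .
    have lnz: "ln (real z) > 0" using z by simp
    have \<rho>: "\<rho> > 0" unfolding \<rho>_def by (intro prod_pos) (simp add: add_pos_nonneg)
    with le lnz have "0 < 2 * \<rho> * G" by linarith
    then have G: "G > 0" using \<rho> by (simp add: zero_less_mult_iff)
    have "real_of_int N * ln (real z) \<le> real_of_int N * (2 * \<rho> * G)"
      using le N by (intro mult_left_mono) auto
    then show ?thesis using G lnz by (simp add: divide_simps mult_ac)
  qed
  finally show ?thesis unfolding P_def \<rho>_def by (simp add: Ball_def imp_conjL)
qed

section \<open>Moments of the loss factor of the sieve\<close>

text \<open>Dedekind's psi function divided by its argument. It measures what the sieve loses at the
  primes dividing \<open>m\<close>.\<close>

definition rho :: "nat \<Rightarrow> real" where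
  "rho m = (\<Prod>p\<in>prime_factors m. 1 + 1 / real p)"

lemma rho_ge_1: "rho m \<ge> 1"
  unfolding rho_def by (intro prod_ge_1) simp

text \<open>Primes common to \<open>k\<close> and \<open>u\<close> occur once on the left and twice
  on the right.\<close>

lemma rho_mult_le:
  assumes "k \<noteq> 0" "u \<noteq> 0"
  shows "rho (k * u) \<le> rho k * rho u"
proof -
  let ?f = "\<lambda>p::nat. 1 + 1 / real p"
  have "prime_factors (k * u) = prime_factors k \<union> prime_factors u"
    using assms by (simp add: prime_factors_product)
  then have "rho (k * u) * prod ?f (prime_factors k \<inter> prime_factors u) = rho k * rho u"
    unfolding rho_def by (simp add: prod.union_inter)
  moreover have "prod ?f (prime_factors k \<inter> prime_factors u) \<ge> 1" by (intro prod_ge_1) simp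
  moreover have "rho (k * u) \<ge> 0" using rho_ge_1[of "k * u"] by simp
  ultimately show ?thesis by (metis mult_left_le_imp_le mult_left_mono mult.right_neutral)
qed

text \<open>Expanding the product yields the reciprocals of the squarefree divisors only.\<close>

lemma rho_le_sum_divisors:
  assumes "k > 0"
  shows "rho k \<le> (\<Sum>e | e dvd k. 1 / real e)"
proof -
  have fin: "finite (prime_factors k)" by simp
  have "rho k = (\<Sum>X\<in>Pow (prime_factors k). 1 / real (\<Prod>X))"
    unfolding rho_def by (rule subset_products_sum[OF fin, symmetric])
  also have "\<dots> = (\<Sum>e\<in>Prod ` Pow (prime_factors k). 1 / real e)"
  proof (subst sum.reindex)
    show "inj_on Prod (Pow (prime_factors k))"
    proof (rule inj_onI)
      have *: "prime_factors (\<Prod>X) = X" if X: "X \<in> Pow (prime_factors k)" for X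
        using X fin by (intro prime_factors_prod_primes) (auto intro: finite_subset)
      fix X Y assume "X \<in> Pow (prime_factors k)" "Y \<in> Pow (prime_factors k)" "\<Prod>X = \<Prod>Y"
      then show "X = Y" using * by metis
    qed
  qed simp
  also have "\<dots> \<le> (\<Sum>e | e dvd k. 1 / real e)"
  proof (intro sum_mono2)
    show "finite {e. e dvd k}" using assms by simp
    have "\<Prod>X dvd k" if X: "X \<subseteq> prime_factors k" for X
    proof -
      have "\<Prod>X dvd \<Prod>(prime_factors k)" using X by (intro prod_dvd_prod_subset) auto
      also have "\<dots> dvd (\<Prod>p\<in>prime_factors k. p ^ multiplicity p k)"
      proof (rule prod_dvd_prod)
        fix p assume "p \<in> prime_factors k"
        then have "multiplicity p k > 0" by (auto simp: prime_factors_multiplicity)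
        then show "p dvd p ^ multiplicity p k" by (simp add: dvd_power)
      qed
      also have "\<dots> = k" using assms by (simp add: prod_prime_factors)
      finally show ?thesis .
    qed
    then show "Prod ` Pow (prime_factors k) \<subseteq> {e. e dvd k}" by auto
  qed auto
  finally show ?thesis .
qed

lemma weighted_power_mean:
  fixes w x :: "'a \<Rightarrow> real"
  assumes fin: "finite S" and w: "\<And>s. s \<in> S \<Longrightarrow> w s > 0" and x: "\<And>s. s \<in> S \<Longrightarrow> x s \<ge> 0" and n: "n \<ge> 1"
  shows "(\<Sum>s\<in>S. w s * x s) ^ n \<le> (\<Sum>s\<in>S. w s) ^ (n - 1) * (\<Sum>s\<in>S. w s * x s ^ n)"
proof (cases "S = {}")
  case True
  then show ?thesis using n by (simp add: power_0_left)
next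
  case False
  define W where "W = (\<Sum>s\<in>S. w s)"
  have W: "W > 0" unfolding W_def using fin False w by (intro sum_pos) auto
  have conv: "convex_on {0::real..} (\<lambda>x. x ^ n)"
    using convex_power_odd convex_on_subset[OF convex_power_even] by (cases "even n") auto
  have "(\<Sum>s\<in>S. (w s / W) *\<^sub>R x s) ^ n \<le> (\<Sum>s\<in>S. (w s / W) * x s ^ n)"
    using fin False conv w x W
    by (intro convex_on_sum[where f = "\<lambda>x. x ^ n"]) (auto simp: W_def less_imp_le simp flip: sum_divide_distrib)
  moreover have "(\<Sum>s\<in>S. (w s / W) *\<^sub>R x s) = (\<Sum>s\<in>S. w s * x s) / W"
    by (simp add: sum_divide_distrib)
  moreover have "(\<Sum>s\<in>S. (w s / W) * x s ^ n) = (\<Sum>s\<in>S. w s * x s ^ n) / W"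
    by (simp add: sum_divide_distrib)
  ultimately have "(\<Sum>s\<in>S. w s * x s) ^ n / W ^ n \<le> (\<Sum>s\<in>S. w s * x s ^ n) / W"
    by (simp add: power_divide)
  moreover have "W ^ n = W * W ^ (n - 1)" using n by (simp add: power_eq_if)
  ultimately show ?thesis using W unfolding W_def[symmetric] by (simp add: field_simps)
qed

text \<open>Jensen's inequality for the weights \<open>e powr (-1 - 1/n)\<close>: the power mean inequality turns
  the \<open>n\<close>-th moment of the sum over \<open>e | k\<close> of \<open>1/e\<close> into a sum over \<open>e | k\<close> of \<open>e powr (-1/n)\<close>.\<close>

lemma rho_moment:
  assumes n: "n \<ge> 1"
  shows "\<exists>C. C > 0 \<and> (\<forall>T. (\<Sum>k = 1..T. rho k ^ n) \<le> C * real T)"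
proof -
  define \<delta> where "\<delta> = 1 / real n"
  have \<delta>: "\<delta> > 0" using n by (simp add: \<delta>_def)
  define w where "w = (\<lambda>e::nat. real e powr (-1 - \<delta>))"
  have sw: "summable w" unfolding w_def using \<delta> by (subst summable_real_powr_iff) simp
  define Z where "Z = suminf w"
  have wle: "(\<Sum>e\<in>S. w e) \<le> Z" if "finite S" for S
    unfolding Z_def by (rule sum_le_suminf[OF sw that]) (simp add: w_def)
  have "w 1 \<le> Z" using wle[of "{1}"] by simp
  then have Z: "Z \<ge> 1" by (simp add: w_def)
  have "(\<Sum>k = 1..T. rho k ^ n) \<le> Z ^ n * real T" for T
  proof -
    have one: "rho k ^ n \<le> Z ^ (n - 1) * (\<Sum>e | e dvd k. w e * real e)" if k: "k \<in> {1..T}" for k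
    proof -
      have kp: "k > 0" using k by simp
      have ep: "e > 0" if "e dvd k" for e using that kp by (auto intro: Nat.gr0I)
      have "rho k ^ n \<le> (\<Sum>e | e dvd k. 1 / real e) ^ n"
        using rho_le_sum_divisors[OF kp] rho_ge_1[of k] by (intro power_mono) auto
      also have "(\<Sum>e | e dvd k. 1 / real e) = (\<Sum>e | e dvd k. w e * real e powr \<delta>)"
      proof (intro sum.cong refl)
        fix e assume "e \<in> {e. e dvd k}"
        then have "e > 0" using ep by simp
        then show "1 / real e = w e * real e powr \<delta>"
          by (simp add: w_def powr_minus powr_diff field_simps)
      qed
      also have "(\<Sum>e | e dvd k. w e * real e powr \<delta>) ^ n \<le>
          (\<Sum>e | e dvd k. w e) ^ (n - 1) * (\<Sum>e | e dvd k. w e * (real e powr \<delta>) ^ n)"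
        using kp ep n by (intro weighted_power_mean) (auto simp: w_def)
      also have "(\<Sum>e | e dvd k. w e * (real e powr \<delta>) ^ n) = (\<Sum>e | e dvd k. w e * real e)"
      proof (intro sum.cong refl)
        fix e assume "e \<in> {e. e dvd k}"
        then have "e > 0" using ep by simp
        then have "(real e powr \<delta>) ^ n = real e" using n
          by (simp add: powr_realpow[symmetric] powr_powr \<delta>_def)
        then show "w e * (real e powr \<delta>) ^ n = w e * real e" by simp
      qed
      also have "(\<Sum>e | e dvd k. w e) ^ (n - 1) * (\<Sum>e | e dvd k. w e * real e) \<le>
          Z ^ (n - 1) * (\<Sum>e | e dvd k. w e * real e)"
        using kp wle[of "{e. e dvd k}"]
        by (intro mult_right_mono power_mono sum_nonneg) (auto simp: w_def intro: sum_nonneg)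
      finally show ?thesis .
    qed
    have "(\<Sum>k = 1..T. rho k ^ n) \<le> (\<Sum>k = 1..T. Z ^ (n - 1) * (\<Sum>e | e dvd k. w e * real e))"
      by (intro sum_mono one)
    also have "\<dots> = Z ^ (n - 1) * (\<Sum>k = 1..T. \<Sum>e | e dvd k. w e * real e)" by (simp add: sum_distrib_left)
    also have "(\<Sum>k = 1..T. \<Sum>e | e dvd k. w e * real e) = (\<Sum>k = 1..T. \<Sum>e | e \<in> {1..T} \<and> e dvd k. w e * real e)"
    proof (intro sum.cong refl)
      fix k assume "k \<in> {1..T}"
      then show "{e. e dvd k} = {e. e \<in> {1..T} \<and> e dvd k}"
        by (auto simp: Suc_le_eq intro!: Nat.gr0I dest: dvd_imp_le)
    qed
    also have "\<dots> = (\<Sum>e = 1..T. \<Sum>k | k \<in> {1..T} \<and> e dvd k. w e * real e)"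
      by (rule sum.swap_restrict) auto
    \<comment> \<open>There are at most T / e multiples of \<open>e\<close>, which cancels the
      factor \<open>e\<close> left by the power mean inequality; the weights alone are
      summable.\<close>
    also have "\<dots> \<le> (\<Sum>e = 1..T. real T * w e)"
    proof (intro sum_mono)
      fix e assume e: "e \<in> {1..T}"
      have "{k. k \<in> {1..T} \<and> e dvd k} = (\<lambda>j. e * j) ` {1..T div e}"
        using e by (intro multiples_eq_image) auto
      then have "card {k. k \<in> {1..T} \<and> e dvd k} = card ((\<lambda>j. e * j) ` {1..T div e})" by simp
      also have "\<dots> \<le> T div e" by (rule order_trans[OF card_image_le]) auto
      finally have "real (card {k. k \<in> {1..T} \<and> e dvd k}) \<le> real (T div e)" by simp
      also have "\<dots> \<le> real T / real e" by (rule of_nat_div_le_of_nat)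
      finally have "real (card {k. k \<in> {1..T} \<and> e dvd k}) * real e \<le> real T"
        using e by (simp add: field_simps)
      then have "real (card {k. k \<in> {1..T} \<and> e dvd k}) * real e * w e \<le> real T * w e"
        by (intro mult_right_mono) (auto simp: w_def)
      then show "(\<Sum>k | k \<in> {1..T} \<and> e dvd k. w e * real e) \<le> real T * w e"
        by (simp add: mult_ac)
    qed
    also have "\<dots> = real T * (\<Sum>e = 1..T. w e)" by (simp add: sum_distrib_left)
    also have "\<dots> \<le> real T * Z" by (intro mult_left_mono wle) auto
    finally have "(\<Sum>k = 1..T. rho k ^ n) \<le> Z ^ (n - 1) * (real T * Z)"
      using Z by (simp add: mult_left_mono)
    also have "\<dots> = Z ^ n * real T" using n by (simp add: power_eq_if)
    finally show ?thesis .
  qed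
  moreover have "Z ^ n > 0" using Z by simp
  ultimately show ?thesis by blast
qed

section \<open>Counting integer polynomials by their values\<close>

text \<open>The first argument counts coefficients, so that inductions start from the zero
  polynomial; degree at most \<open>d\<close> corresponds to \<open>Suc d\<close>.\<close>

definition poly_box :: "nat \<Rightarrow> nat \<Rightarrow> int poly set" where
  "poly_box m H = {p. (\<forall>k. \<bar>coeff p k\<bar> \<le> int H) \<and> (\<forall>k\<ge>m. coeff p k = 0)}"

lemma poly_box_0: "poly_box 0 H = {0}"
  by (auto simp: poly_box_def poly_eq_iff)

lemma poly_box_Suc:
  "poly_box (Suc m) H = (\<lambda>(c, p). pCons c p) ` ({- int H..int H} \<times> poly_box m H)"
proof (intro equalityI subsetI)
  fix p assume p: "p \<in> poly_box (Suc m) H"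
  obtain c q where q: "p = pCons c q" by (cases p) auto
  have "\<bar>c\<bar> \<le> int H" using p by (auto simp: poly_box_def q dest: spec[of _ 0])
  moreover have "q \<in> poly_box m H"
    unfolding poly_box_def
  proof (intro CollectI conjI allI impI)
    fix k
    have "\<bar>coeff p (Suc k)\<bar> \<le> int H" using p by (simp add: poly_box_def)
    then show "\<bar>coeff q k\<bar> \<le> int H" by (simp add: q)
    assume "m \<le> k"
    then have "coeff p (Suc k) = 0" using p by (simp add: poly_box_def)
    then show "coeff q k = 0" by (simp add: q)
  qed
  ultimately show "p \<in> (\<lambda>(c, p). pCons c p) ` ({- int H..int H} \<times> poly_box m H)"
    by (intro image_eqI[of _ _ "(c, q)"]) (auto simp: q)
next
  fix p assume "p \<in> (\<lambda>(c, p). pCons c p) ` ({- int H..int H} \<times> poly_box m H)"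
  then obtain c q where q: "p = pCons c q" "\<bar>c\<bar> \<le> int H" "q \<in> poly_box m H" by auto
  show "p \<in> poly_box (Suc m) H"
    using q unfolding poly_box_def by (auto simp: coeff_pCons split: nat.splits)
qed

lemma inj_pCons_pair: "inj_on (\<lambda>(c, p). pCons c p) A"
  by (auto simp: inj_on_def)

lemma finite_poly_box: "finite (poly_box m H)"
  by (induction m) (auto simp: poly_box_0 poly_box_Suc)

lemma card_poly_box: "card (poly_box m H) = (2 * H + 1) ^ m"
proof (induction m)
  case (Suc m)
  have "card {- int H..int H} = 2 * H + 1" by simp
  then show ?case using Suc unfolding poly_box_Suc
    by (subst card_image[OF inj_pCons_pair]) (simp add: card_cartesian_product)
qed (simp add: poly_box_0)

text \<open>A geometric series, multiplied by t - 1 to remain an inequality between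
  integers.\<close>

lemma poly_box_eval_bound:
  assumes "p \<in> poly_box m H" "t \<ge> (1::nat)"
  shows "(int t - 1) * \<bar>poly p (int t)\<bar> \<le> int H * (int t ^ m - 1)"
  using assms(1)
proof (induction m arbitrary: p)
  case 0
  then show ?case by (simp add: poly_box_0)
next
  case (Suc m)
  then obtain c q where q: "p = pCons c q" "\<bar>c\<bar> \<le> int H" "q \<in> poly_box m H"
    by (auto simp: poly_box_Suc)
  have "\<bar>poly p (int t)\<bar> \<le> \<bar>c\<bar> + \<bar>int t * poly q (int t)\<bar>" by (simp add: q abs_triangle_ineq)
  also have "\<dots> \<le> int H + int t * \<bar>poly q (int t)\<bar>" using q(2) by (simp add: abs_mult)
  finally have "(int t - 1) * \<bar>poly p (int t)\<bar> \<le> (int t - 1) * (int H + int t * \<bar>poly q (int t)\<bar>)"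
    using assms(2) by (intro mult_left_mono) auto
  also have "\<dots> = (int t - 1) * int H + int t * ((int t - 1) * \<bar>poly q (int t)\<bar>)" by (simp add: algebra_simps)
  also have "\<dots> \<le> (int t - 1) * int H + int t * (int H * (int t ^ m - 1))"
    using Suc.IH[OF q(3)] by (intro add_left_mono mult_left_mono) auto
  finally show ?case by (simp add: algebra_simps)
qed

text \<open>With one coefficient less, a value of this size is out of reach. Prescribing a large
  value thus enforces the exact degree.\<close>

lemma poly_box_degree:
  assumes p: "p \<in> poly_box (Suc d) H" and t: "t \<ge> (1::nat)" and H: "H > 0"
    and v: "int H * int t ^ d \<le> (int t - 1) * \<bar>poly p (int t)\<bar>"
  shows "degree p = d"
proof (rule antisym)
  show "degree p \<le> d" using p by (intro degree_le) (auto simp: poly_box_def)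
  show "d \<le> degree p"
  proof (rule ccontr)
    assume "\<not> d \<le> degree p"
    then have "coeff p k = 0" if "k \<ge> d" for k using that by (intro coeff_eq_0) auto
    then have "p \<in> poly_box d H" using p by (auto simp: poly_box_def)
    then have "(int t - 1) * \<bar>poly p (int t)\<bar> \<le> int H * (int t ^ d - 1)"
      using t by (rule poly_box_eval_bound)
    with v H show False by (simp add: algebra_simps)
  qed
qed

lemma finite_int_filter: "finite {c. lo \<le> c \<and> c < (hi::int) \<and> P c}"
  by (rule finite_subset[of _ "{lo..<hi}"]) auto

lemma card_ints_near:
  fixes x r :: real
  shows "finite {c::int. \<bar>real_of_int c - x\<bar> \<le> r}" "real (card {c::int. \<bar>real_of_int c - x\<bar> \<le> r}) \<ge> 2 * r - 1"
proof -
  have "{c::int. \<bar>real_of_int c - x\<bar> \<le> r} = {\<lceil>x - r\<rceil>..\<lfloor>x + r\<rfloor>}"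
    by (auto simp: abs_le_iff le_floor_iff ceiling_le_iff)
  moreover have "real_of_int (\<lfloor>x + r\<rfloor> - \<lceil>x - r\<rceil> + 1) \<ge> 2 * r - 1"
    using ceiling_correct[of "x - r"] floor_correct[of "x + r"] by linarith
  then have "real (nat (\<lfloor>x + r\<rfloor> - \<lceil>x - r\<rceil> + 1)) \<ge> 2 * r - 1" by linarith
  ultimately show "finite {c::int. \<bar>real_of_int c - x\<bar> \<le> r}"
    "real (card {c::int. \<bar>real_of_int c - x\<bar> \<le> r}) \<ge> 2 * r - 1"
    by simp_all
qed

text \<open>The coefficients are chosen greedily from the leading one downwards: each leaves about
  \<open>H / t\<close> possibilities for which the remaining value stays in the admissible range.\<close>

lemma card_poly_box_value:
  fixes t H m :: nat and v :: int
  assumes t: "t \<ge> 1" and H: "2 * t \<le> H" and v: "2 * \<bar>v\<bar> \<le> int H * int t ^ m"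
  shows "real (card {p \<in> poly_box (Suc m) H. poly p (int t) = v}) \<ge> (real H / (2 * real t)) ^ m"
  using v
proof (induction m arbitrary: v)
  case 0
  then have "[:v:] \<in> {p \<in> poly_box (Suc 0) H. poly p (int t) = v}"
    by (auto simp: poly_box_def coeff_pCons split: nat.splits)
  then have "card {p \<in> poly_box (Suc 0) H. poly p (int t) = v} > 0"
    by (intro card_gt_0_iff[THEN iffD2] conjI finite_subset[OF _ finite_poly_box]) auto
  then show ?case by simp
next
  case (Suc m)
  define T where "T = int t ^ Suc m"
  have T: "T > 0" using t by (simp add: T_def)
  \<comment> \<open>With a leading coefficient from this range the remaining value is at most H t^m
    / 2, as the induction requires. With r = H / (2 t) the range has at least 2 r - 1 elements, and
    \<open>2 * t \<le> H\<close> makes this at least r.\<close>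
  define C where "C = {c::int. \<bar>real_of_int c - real_of_int v / real_of_int T\<bar> \<le> real H / (2 * real t)}"
  define F where "F = (\<lambda>c. {p \<in> poly_box (Suc m) H. poly p (int t) = v - c * T})"
  have finC: "finite C" unfolding C_def by (rule card_ints_near)
  have "real (card C) \<ge> 2 * (real H / (2 * real t)) - 1" unfolding C_def by (rule card_ints_near)
  moreover have "real H / (2 * real t) \<ge> 1" using H t by (simp add: field_simps)
  ultimately have cardC: "real (card C) \<ge> real H / (2 * real t)" by simp
  have C1: "2 * \<bar>v - c * T\<bar> \<le> int H * int t ^ m" if "c \<in> C" for c
  proof -
    have "\<bar>real_of_int c - real_of_int v / real_of_int T\<bar> * real_of_int T \<le> real H / (2 * real t) * real_of_int T"
      using that T by (intro mult_right_mono) (auto simp: C_def)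
    moreover have "\<bar>real_of_int c - real_of_int v / real_of_int T\<bar> * real_of_int T = \<bar>real_of_int (v - c * T)\<bar>"
    proof -
      have "\<bar>real_of_int c - real_of_int v / real_of_int T\<bar> * real_of_int T = \<bar>(real_of_int c - real_of_int v / real_of_int T) * real_of_int T\<bar>"
        using T by (simp add: abs_mult)
      also have "(real_of_int c - real_of_int v / real_of_int T) * real_of_int T = - real_of_int (v - c * T)"
        using T by (simp add: field_simps)
      finally show ?thesis by simp
    qed
    moreover have "real H / (2 * real t) * real_of_int T = real H * real t ^ m / 2"
      using t by (simp add: T_def)
    moreover have "2 * c' \<le> d" if "a \<le> b" "a = c'" "b = d / 2" for a b c' d :: real using that by linarith
    ultimately have "2 * \<bar>real_of_int (v - c * T)\<bar> \<le> real H * real t ^ m" by blast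
    then have "real_of_int (2 * \<bar>v - c * T\<bar>) \<le> real_of_int (int H * int t ^ m)" by simp
    then show ?thesis by (simp only: of_int_le_iff)
  qed
  \<comment> \<open>Both \<open>v\<close> and \<open>v - c * T\<close> are at most H T / 2 in
    absolute value, so \<open>c * T\<close> is at most H T.\<close>
  have C2: "\<bar>c\<bar> \<le> int H" if "c \<in> C" for c
  proof -
    have "2 * (\<bar>c\<bar> * T) = 2 * \<bar>c * T\<bar>" using T by (simp add: abs_mult)
    also have "\<dots> \<le> 2 * \<bar>v\<bar> + 2 * \<bar>v - c * T\<bar>"
      using abs_triangle_ineq4[of v "v - c * T"] by simp
    also have "\<dots> \<le> int H * T + int H * int t ^ m" using Suc.prems C1[OF that] by (simp add: T_def)
    also have "int H * int t ^ m \<le> int H * T" using t by (simp add: T_def mult_left_mono)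
    finally have "\<bar>c\<bar> * T \<le> int H * T" by linarith
    then show ?thesis using T by simp
  qed
  define A where "A = (\<lambda>(c, p). monom c (Suc m) + p) ` (SIGMA c:C. F c)"
  have cp: "coeff p (Suc m) = 0" if "p \<in> F c" for c p using that by (auto simp: F_def poly_box_def)
  have inj: "inj_on (\<lambda>(c, p). monom c (Suc m) + p) (SIGMA c:C. F c)"
  proof (rule inj_onI, clarify)
    fix c p c' p' assume h: "p \<in> F c" "p' \<in> F c'" "monom c (Suc m) + p = monom c' (Suc m) + p'"
    from arg_cong[OF h(3), of "\<lambda>q. coeff q (Suc m)"] have "c = c'" using h(1,2) cp by simp
    then show "c = c' \<and> p = p'" using h(3) by simp
  qed
  have "A \<subseteq> {p \<in> poly_box (Suc (Suc m)) H. poly p (int t) = v}"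
  proof
    fix p assume "p \<in> A"
    then obtain c q where cq: "p = monom c (Suc m) + q" "c \<in> C" "q \<in> F c" by (auto simp: A_def)
    have q: "\<And>k. \<bar>coeff q k\<bar> \<le> int H" "\<And>k. k \<ge> Suc m \<Longrightarrow> coeff q k = 0" "poly q (int t) = v - c * T"
      using cq(3) by (auto simp: F_def poly_box_def)
    have "\<bar>coeff p k\<bar> \<le> int H" for k
      using q(1)[of k] q(2)[of k] C2[OF cq(2)] by (cases "k = Suc m") (auto simp: cq(1))
    moreover have "coeff p k = 0" if "k \<ge> Suc (Suc m)" for k using q(2)[of k] that by (simp add: cq(1))
    moreover have "poly p (int t) = v" using q(3) by (simp add: cq(1) poly_monom T_def)
    ultimately show "p \<in> {p \<in> poly_box (Suc (Suc m)) H. poly p (int t) = v}" by (simp add: poly_box_def)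
  qed
  then have "card A \<le> card {p \<in> poly_box (Suc (Suc m)) H. poly p (int t) = v}"
    by (rule card_mono[rotated]) (rule finite_subset[OF _ finite_poly_box], auto)
  moreover have "card A = (\<Sum>c\<in>C. card (F c))"
    unfolding A_def by (subst card_image[OF inj]) (use finC finite_poly_box in \<open>auto simp: F_def card_SigmaI\<close>)
  ultimately have "(\<Sum>c\<in>C. real (card (F c))) \<le> real (card {p \<in> poly_box (Suc (Suc m)) H. poly p (int t) = v})"
    by (simp flip: of_nat_sum)
  moreover have "(\<Sum>c\<in>C. (real H / (2 * real t)) ^ m) \<le> (\<Sum>c\<in>C. real (card (F c)))"
    unfolding F_def by (intro sum_mono Suc.IH C1)
  moreover have "real H / (2 * real t) * (real H / (2 * real t)) ^ m \<le> real (card C) * (real H / (2 * real t)) ^ m"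
    using cardC by (intro mult_right_mono) auto
  ultimately show ?case by simp
qed

section \<open>Values without small prime factors at two points\<close>

text \<open>Primes dividing \<open>u\<close> are exempt because the values to be sieved are a fixed
  multiple, with the prime factors of \<open>u\<close>, of a large prime.\<close>

definition rough :: "nat \<Rightarrow> nat \<Rightarrow> int \<Rightarrow> bool" where
  "rough u z v \<longleftrightarrow> (\<forall>p. prime p \<longrightarrow> p \<le> z \<longrightarrow> \<not> p dvd u \<longrightarrow> \<not> int p dvd v)"

lemma card_rough_progression:
  fixes \<alpha> \<beta> lo N :: int
  assumes z: "z \<ge> 2" and N: "N \<ge> 0" and u: "u > 0" and \<alpha>: "\<alpha> \<noteq> 0"
  shows "real (card {c \<in> {lo..<lo + N}. rough u z (\<alpha> * c + \<beta>)})
     \<le> 2 * rho (nat \<bar>\<alpha>\<bar> * u) * real_of_int N / ln (real z) + real z ^ 4"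
proof -
  define E where "E = prime_factors (nat \<bar>\<alpha>\<bar> * u)"
  have nz: "nat \<bar>\<alpha>\<bar> * u \<noteq> 0" using u \<alpha> by simp
  have inE: "p \<in> E \<longleftrightarrow> int p dvd \<alpha> \<or> p dvd u" if "prime p" for p
  proof -
    have "p dvd nat \<bar>\<alpha>\<bar> \<longleftrightarrow> int p dvd \<alpha>" by (simp add: int_dvd_int_iff[symmetric])
    then show ?thesis using nz that by (simp add: E_def in_prime_factors_iff prime_dvd_mult_iff)
  qed
  have "{c \<in> {lo..<lo + N}. rough u z (\<alpha> * c + \<beta>)} \<subseteq>
      {c \<in> {lo..<lo + N}. \<forall>p. prime p \<longrightarrow> p \<le> z \<longrightarrow> p \<notin> E \<longrightarrow> \<not> int p dvd \<alpha> * c + \<beta>}"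
    using inE by (auto simp: rough_def)
  then have "real (card {c \<in> {lo..<lo + N}. rough u z (\<alpha> * c + \<beta>)}) \<le>
      real (card {c \<in> {lo..<lo + N}. \<forall>p. prime p \<longrightarrow> p \<le> z \<longrightarrow> p \<notin> E \<longrightarrow> \<not> int p dvd \<alpha> * c + \<beta>})"
    by (intro of_nat_mono card_mono) (auto simp: finite_int_filter)
  also have "\<dots> \<le> 2 * (\<Prod>p\<in>E. 1 + 1 / real p) * real_of_int N / ln (real z) + real z ^ 4"
    using z N inE by (intro sieve_progression) (auto simp: E_def)
  finally show ?thesis by (simp add: rho_def E_def)
qed

lemma ints_near_subset_interval:
  fixes y :: int and t H :: nat
  assumes t: "t \<ge> 1"
  shows "\<exists>lo N. N \<ge> 0 \<and> real_of_int N \<le> 2 * real H / real t + 1 \<and>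
    {c. \<bar>y - c * int t\<bar> \<le> int H} \<subseteq> {lo..<lo + N}"
proof -
  define lo where "lo = \<lceil>real_of_int (y - int H) / real t\<rceil>"
  define hi where "hi = \<lfloor>real_of_int (y + int H) / real t\<rfloor>"
  have sub: "{c. \<bar>y - c * int t\<bar> \<le> int H} \<subseteq> {lo..hi}"
  proof
    fix c assume "c \<in> {c. \<bar>y - c * int t\<bar> \<le> int H}"
    then have "y - int H \<le> c * int t" "c * int t \<le> y + int H" by auto
    then have "real_of_int (y - int H) \<le> real_of_int c * real t" "real_of_int c * real t \<le> real_of_int (y + int H)"
      by (metis of_int_le_iff of_int_mult of_int_of_nat_eq)+
    then show "c \<in> {lo..hi}" using t
      by (simp add: lo_def hi_def ceiling_le_iff le_floor_iff divide_le_eq le_divide_eq)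
  qed
  have "real_of_int (y + int H) / real t - real_of_int (y - int H) / real t = 2 * real H / real t"
    by (simp flip: diff_divide_distrib)
  then have len: "real_of_int (hi - lo + 1) \<le> 2 * real H / real t + 1"
    using ceiling_correct[of "real_of_int (y - int H) / real t"] floor_correct[of "real_of_int (y + int H) / real t"]
    unfolding lo_def hi_def by linarith
  have "0 \<le> 2 * real H / real t + 1" by simp
  then show ?thesis using sub len
    by (intro exI[of _ lo] exI[of _ "max 0 (hi - lo + 1)"]) (auto simp: max_def)
qed

text \<open>All but the two lowest coefficients are fixed, and the sieve is applied twice: to the
  value at \<open>t1\<close>, which runs through an interval of length about H t1, and then to the
  linear coefficient, which for a given value at \<open>t1\<close> has about H / t1 choices. In the
  second sieve the primes dividing t2 - t1 cannot be used; hence \<open>rho (k * u)\<close>.\<close>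

lemma card_rough_polys:
  fixes t1 t2 H m z u k :: nat
  assumes z: "z \<ge> 2" and u: "u > 0" and t: "t1 \<ge> 1" "t1 \<noteq> t2" and k: "int k = \<bar>int t2 - int t1\<bar>"
  shows "real (card {p \<in> poly_box (Suc (Suc m)) H. rough u z (poly p (int t1)) \<and> rough u z (poly p (int t2))})
     \<le> real (2 * H + 1) ^ m *
       ((2 * rho u * real (2 * H * (1 + t1) + 1) / ln (real z) + real z ^ 4) *
        (2 * rho (k * u) * (2 * real H / real t1 + 1) / ln (real z) + real z ^ 4))"
proof -
  define a where "a = 2 * rho u * real (2 * H * (1 + t1) + 1) / ln (real z) + real z ^ 4"
  define b where "b = 2 * rho (k * u) * (2 * real H / real t1 + 1) / ln (real z) + real z ^ 4"
  have lnz: "ln (real z) > 0" using z by simp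
  have b0: "b \<ge> 0" using lnz rho_ge_1[of "k * u"] by (simp add: b_def)
  have inner: "real (card {(c0, c1). \<bar>c0\<bar> \<le> int H \<and> \<bar>c1\<bar> \<le> int H \<and>
      rough u z (poly (pCons c0 (pCons c1 r)) (int t1)) \<and> rough u z (poly (pCons c0 (pCons c1 r)) (int t2))}) \<le> a * b" for r
  proof -
    define q1 where "q1 = int t1 * (int t1 * poly r (int t1))"
    define q2 where "q2 = int t2 * (int t2 * poly r (int t2))"
    define S where "S = {(c0, c1). \<bar>c0\<bar> \<le> int H \<and> \<bar>c1\<bar> \<le> int H \<and>
      rough u z (poly (pCons c0 (pCons c1 r)) (int t1)) \<and> rough u z (poly (pCons c0 (pCons c1 r)) (int t2))}"
    define N1 where "N1 = 2 * int H * (1 + int t1) + 1"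
    define lo1 where "lo1 = q1 - int H * (1 + int t1)"
    define W where "W = {w \<in> {lo1..<lo1 + N1}. rough u z w}"
    define V where "V = (\<lambda>w. {c. \<bar>w - q1 - c * int t1\<bar> \<le> int H \<and> rough u z ((int t2 - int t1) * c + (w + q2 - q1))})"
    have finV: "finite (V w)" for w
    proof -
      obtain lo N where "{c. \<bar>(w - q1) - c * int t1\<bar> \<le> int H} \<subseteq> {lo..<lo + N}"
        using ints_near_subset_interval[OF t(1)] by blast
      then show ?thesis by (intro finite_subset[of "V w" "{lo..<lo + N}"]) (auto simp: V_def)
    qed
    have finW: "finite W" by (simp add: W_def finite_int_filter)
    have cardV: "real (card (V w)) \<le> b" for w
    proof -
      obtain lo N where N: "N \<ge> 0" "real_of_int N \<le> 2 * real H / real t1 + 1"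
        "{c. \<bar>(w - q1) - c * int t1\<bar> \<le> int H} \<subseteq> {lo..<lo + N}"
        using ints_near_subset_interval[OF t(1)] by blast
      have "card (V w) \<le> card {c \<in> {lo..<lo + N}. rough u z ((int t2 - int t1) * c + (w + q2 - q1))}"
        using N(3) by (intro card_mono) (auto simp: V_def finite_int_filter)
      then have "real (card (V w)) \<le> real (card {c \<in> {lo..<lo + N}. rough u z ((int t2 - int t1) * c + (w + q2 - q1))})"
        by simp
      also have "\<dots> \<le> 2 * rho (nat \<bar>int t2 - int t1\<bar> * u) * real_of_int N / ln (real z) + real z ^ 4"
        using z N(1) u t by (intro card_rough_progression) auto
      also have "nat \<bar>int t2 - int t1\<bar> = k" using k by linarith
      also have "2 * rho (k * u) * real_of_int N / ln (real z) + real z ^ 4 \<le> b"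
        unfolding b_def using N(2) lnz rho_ge_1[of "k * u"]
        by (intro add_right_mono divide_right_mono mult_left_mono) auto
      finally show ?thesis .
    qed
    have cardW: "real (card W) \<le> a"
    proof -
      have "real (card {c \<in> {lo1..<lo1 + N1}. rough u z (1 * c + 0)})
          \<le> 2 * rho (nat \<bar>1\<bar> * u) * real_of_int N1 / ln (real z) + real z ^ 4"
        using z u by (intro card_rough_progression) (auto simp: N1_def)
      then show ?thesis by (simp add: W_def a_def N1_def algebra_simps)
    qed
    \<comment> \<open>In these coordinates the condition at \<open>t1\<close> concerns the first
      entry alone, and the value at \<open>t2\<close> is linear in \<open>c1\<close> with slope t2 -
      t1.\<close>
    define f where "f = (\<lambda>(c0, c1). (c0 + c1 * int t1 + q1, c1))"
    have "inj_on f S" by (auto simp: inj_on_def f_def)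
    moreover have "f ` S \<subseteq> (SIGMA w:W. V w)"
    proof
      fix x assume "x \<in> f ` S"
      then obtain c0 c1 where c: "x = (c0 + c1 * int t1 + q1, c1)" "\<bar>c0\<bar> \<le> int H" "\<bar>c1\<bar> \<le> int H"
        "rough u z (c0 + c1 * int t1 + q1)" "rough u z (c0 + c1 * int t2 + q2)"
        by (auto simp: f_def S_def q1_def q2_def algebra_simps)
      have "\<bar>c1 * int t1\<bar> \<le> int H * int t1" using c(3) by (simp add: abs_mult mult_right_mono)
      then have "\<bar>c0 + c1 * int t1\<bar> \<le> int H * (1 + int t1)" using c(2) by (simp add: distrib_left)
      then have "c0 + c1 * int t1 + q1 \<in> W" using c(4) by (auto simp: W_def lo1_def N1_def abs_le_iff algebra_simps)
      moreover have "(int t2 - int t1) * c1 + (c0 + c1 * int t1 + q1 + q2 - q1) = c0 + c1 * int t2 + q2"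
        by (simp add: algebra_simps)
      then have "rough u z ((int t2 - int t1) * c1 + (c0 + c1 * int t1 + q1 + q2 - q1))" using c(5) by (simp only:)
      moreover have "\<bar>c0 + c1 * int t1 + q1 - q1 - c1 * int t1\<bar> \<le> int H" using c(2) by simp
      ultimately have "c1 \<in> V (c0 + c1 * int t1 + q1)" unfolding V_def by blast
      with \<open>c0 + c1 * int t1 + q1 \<in> W\<close> show "x \<in> (SIGMA w:W. V w)" using c(1) by simp
    qed
    ultimately have "card S \<le> card (SIGMA w:W. V w)"
      using finW finV by (intro card_inj_on_le) auto
    also have "\<dots> = (\<Sum>w\<in>W. card (V w))" using finW finV by (simp add: card_SigmaI)
    finally have "real (card S) \<le> (\<Sum>w\<in>W. real (card (V w)))" by (simp flip: of_nat_sum)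
    also have "\<dots> \<le> (\<Sum>w\<in>W. b)" by (intro sum_mono cardV)
    also have "\<dots> = real (card W) * b" by simp
    also have "\<dots> \<le> a * b" using cardW b0 by (rule mult_right_mono)
    finally show ?thesis by (simp add: S_def)
  qed
  define X where "X = {p \<in> poly_box (Suc (Suc m)) H. rough u z (poly p (int t1)) \<and> rough u z (poly p (int t2))}"
  define Y where "Y = (\<lambda>r. {(c0, c1). \<bar>c0\<bar> \<le> int H \<and> \<bar>c1\<bar> \<le> int H \<and>
      rough u z (poly (pCons c0 (pCons c1 r)) (int t1)) \<and> rough u z (poly (pCons c0 (pCons c1 r)) (int t2))})"
  have finY: "finite (Y r)" for r
    by (rule finite_subset[of _ "{- int H..int H} \<times> {- int H..int H}"]) (auto simp: Y_def)
  have "X \<subseteq> (\<lambda>(r, c0, c1). pCons c0 (pCons c1 r)) ` (SIGMA r:poly_box m H. Y r)"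
  proof
    fix p assume p: "p \<in> X"
    then have "p \<in> poly_box (Suc (Suc m)) H" by (simp add: X_def)
    then obtain c0 q where q: "p = pCons c0 q" "\<bar>c0\<bar> \<le> int H" "q \<in> poly_box (Suc m) H"
      unfolding poly_box_Suc[of "Suc m"] by auto
    then obtain c1 r where r: "q = pCons c1 r" "\<bar>c1\<bar> \<le> int H" "r \<in> poly_box m H"
      unfolding poly_box_Suc[of m] by auto
    have "(c0, c1) \<in> Y r" using p q r unfolding X_def Y_def by simp
    then show "p \<in> (\<lambda>(r, c0, c1). pCons c0 (pCons c1 r)) ` (SIGMA r:poly_box m H. Y r)"
      using q(1) r(1,3) by (intro image_eqI[of _ _ "(r, c0, c1)"]) auto
  qed
  then have "card X \<le> card (SIGMA r:poly_box m H. Y r)"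
    using finY finite_poly_box by (meson card_image_le card_mono finite_SigmaI finite_imageI order_trans)
  also have "\<dots> = (\<Sum>r\<in>poly_box m H. card (Y r))" using finY finite_poly_box by (simp add: card_SigmaI)
  finally have "real (card X) \<le> (\<Sum>r\<in>poly_box m H. real (card (Y r)))" by (simp flip: of_nat_sum)
  also have "\<dots> \<le> (\<Sum>r\<in>poly_box m H. a * b)" unfolding Y_def by (intro sum_mono inner)
  also have "\<dots> = real (2 * H + 1) ^ m * (a * b)" by (simp add: card_poly_box)
  finally show ?thesis by (simp add: X_def a_def b_def)
qed

text \<open>Cauchy-Schwarz over the union for the number of \<open>t\<close> with x in
  \<open>G t\<close>. The diagonal is kept apart because it is the first moment itself.\<close>

lemma second_moment:
  fixes G :: "'t \<Rightarrow> 'a set"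
  assumes fin\<Omega>: "finite \<Omega>" and finS: "finite S" and sub: "\<And>t. t \<in> S \<Longrightarrow> G t \<subseteq> \<Omega>"
  shows "(\<Sum>t\<in>S. real (card (G t)))\<^sup>2 \<le> real (card (\<Union>t\<in>S. G t)) *
    ((\<Sum>t\<in>S. real (card (G t))) + (\<Sum>t\<in>S. \<Sum>s\<in>S - {t}. real (card (G t \<inter> G s))))"
proof -
  define U where "U = (\<Union>t\<in>S. G t)"
  have finU: "finite U" unfolding U_def using sub fin\<Omega> finS by (meson finite_UN finite_subset)
  have GU: "G t \<subseteq> U" if "t \<in> S" for t using that by (auto simp: U_def)
  define f where "f = (\<lambda>t x. if x \<in> G t then 1 else 0 :: real)"
  have card: "real (card A) = (\<Sum>x\<in>U. if x \<in> A then 1 else 0)" if "A \<subseteq> U" for A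
  proof -
    have "(\<Sum>x\<in>U. if x \<in> A then 1 else 0) = (\<Sum>x\<in>{x\<in>U. x \<in> A}. 1 :: real)"
      by (rule sum.inter_filter[symmetric, OF finU])
    moreover have "{x\<in>U. x \<in> A} = A" using that by blast
    ultimately show ?thesis by simp
  qed
  have "(\<Sum>t\<in>S. real (card (G t))) = (\<Sum>t\<in>S. \<Sum>x\<in>U. f t x)"
    unfolding f_def by (rule sum.cong[OF refl]) (rule card[OF GU])
  also have "\<dots> = (\<Sum>x\<in>U. \<Sum>t\<in>S. f t x)" by (rule sum.swap)
  finally have M1: "(\<Sum>t\<in>S. real (card (G t))) = (\<Sum>x\<in>U. \<Sum>t\<in>S. f t x)" .
  have "(\<Sum>t\<in>S. real (card (G t)))\<^sup>2 \<le> real (card U) * (\<Sum>x\<in>U. (\<Sum>t\<in>S. f t x)\<^sup>2)"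
    unfolding M1 by (rule power2_sum_le)
  also have "(\<Sum>x\<in>U. (\<Sum>t\<in>S. f t x)\<^sup>2) = (\<Sum>t\<in>S. \<Sum>s\<in>S. real (card (G t \<inter> G s)))"
  proof -
    have "(\<Sum>x\<in>U. (\<Sum>t\<in>S. f t x)\<^sup>2) = (\<Sum>x\<in>U. \<Sum>t\<in>S. \<Sum>s\<in>S. f t x * f s x)"
      by (simp only: power2_eq_square sum_product)
    also have "\<dots> = (\<Sum>t\<in>S. \<Sum>x\<in>U. \<Sum>s\<in>S. f t x * f s x)" by (rule sum.swap)
    also have "\<dots> = (\<Sum>t\<in>S. \<Sum>s\<in>S. \<Sum>x\<in>U. f t x * f s x)" by (rule sum.cong[OF refl], rule sum.swap)
    also have "\<dots> = (\<Sum>t\<in>S. \<Sum>s\<in>S. real (card (G t \<inter> G s)))"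
    proof (rule sum.cong[OF refl], rule sum.cong[OF refl])
      fix t s assume "t \<in> S" "s \<in> S"
      then have "real (card (G t \<inter> G s)) = (\<Sum>x\<in>U. if x \<in> G t \<inter> G s then 1 else 0)"
        using GU by (intro card) auto
      also have "\<dots> = (\<Sum>x\<in>U. f t x * f s x)" by (rule sum.cong[OF refl]) (simp add: f_def)
      finally show "(\<Sum>x\<in>U. f t x * f s x) = real (card (G t \<inter> G s))" by simp
    qed
    finally show ?thesis .
  qed
  also have "\<dots> = (\<Sum>t\<in>S. real (card (G t)) + (\<Sum>s\<in>S - {t}. real (card (G t \<inter> G s))))"
  proof (rule sum.cong[OF refl])
    fix t assume "t \<in> S"
    then show "(\<Sum>s\<in>S. real (card (G t \<inter> G s))) = real (card (G t)) + (\<Sum>s\<in>S - {t}. real (card (G t \<inter> G s)))"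
      using sum.remove[OF finS, of t "\<lambda>s. real (card (G t \<inter> G s))"] by simp
  qed
  finally show ?thesis by (simp add: U_def sum.distrib)
qed

section \<open>Asymptotic inputs for large height\<close>

text \<open>Any exponents \<open>A > 1 > B\<close> with \<open>4 A < 5 B\<close> and \<open>A < 2 B\<close> would do in place of
  \<open>11/10\<close> and \<open>9/10\<close>.\<close>

definition symbols_cancel :: "nat \<Rightarrow> real \<Rightarrow> bool" where
  "symbols_cancel H \<eta> \<longleftrightarrow> (\<forall>(P::nat set) (Q::nat set) (\<alpha>::nat \<Rightarrow> real) (\<beta>::nat \<Rightarrow> real).
    finite P \<longrightarrow> finite Q \<longrightarrow>
    (\<forall>p\<in>P. prime p \<and> p mod 4 = 1 \<and> real p \<le> real H powr (11/10)) \<longrightarrow>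
    (\<forall>q\<in>Q. prime q \<and> q mod 4 = 1 \<and> real q \<le> real H powr (11/10)) \<longrightarrow>
    real H powr (9/10) \<le> real (card P) \<longrightarrow> real H powr (9/10) \<le> real (card Q) \<longrightarrow>
    (\<forall>p. \<bar>\<alpha> p\<bar> \<le> 1) \<longrightarrow> (\<forall>p. \<bar>\<beta> p\<bar> \<le> 1) \<longrightarrow>
    \<bar>\<Sum>p\<in>P. \<Sum>q\<in>Q. \<alpha> p * \<beta> q * real_of_int (Legendre p q)\<bar> \<le> \<eta> * (real (card P) * real (card Q)))"

lemma eventually_symbols_cancel:
  assumes \<eta>: "\<eta> > 0"
  shows "\<forall>\<^sub>F H in sequentially. symbols_cancel H \<eta>"
proof -
  have \<eta>8: "\<eta> ^ 8 > 0" using \<eta> by simp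
  define e where "e = \<eta> ^ 8"
  \<comment> \<open>512 is twice the constant 256 of \<open>bilinear_legendre_sum\<close>: each of
    the two terms of that bound may use up half of the target.\<close>
  have "\<forall>\<^sub>F H in sequentially. 512 * ((real H powr (11/10)) ^ 4 + 1) \<le> e * ((real H powr (9/10)) ^ 4 * real H powr (9/10))"
    using \<eta>8 unfolding e_def[symmetric] by real_asymp
  moreover have "\<forall>\<^sub>F H in sequentially. 512 * (real H powr (11/10)) ^ 2 \<le> e * (real H powr (9/10)) ^ 4"
    using \<eta>8 unfolding e_def[symmetric] by real_asymp
  ultimately show ?thesis
  proof eventually_elim
    case (elim H)
    show ?case unfolding symbols_cancel_def
    proof (intro allI impI)
      fix P Q :: "nat set" and \<alpha> \<beta> :: "nat \<Rightarrow> real"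
      assume fin: "finite P" "finite Q"
        and P: "\<forall>p\<in>P. prime p \<and> p mod 4 = 1 \<and> real p \<le> real H powr (11/10)"
        and Q: "\<forall>q\<in>Q. prime q \<and> q mod 4 = 1 \<and> real q \<le> real H powr (11/10)"
        and cP: "real H powr (9/10) \<le> real (card P)" and cQ: "real H powr (9/10) \<le> real (card Q)"
        and \<alpha>: "\<forall>p. \<bar>\<alpha> p\<bar> \<le> 1" and \<beta>: "\<forall>p. \<bar>\<beta> p\<bar> \<le> 1"
      define S where "S = (\<Sum>p\<in>P. \<Sum>q\<in>Q. \<alpha> p * \<beta> q * real_of_int (Legendre p q))"
      define X where "X = nat \<lfloor>real H powr (11/10)\<rfloor>"
      define a where "a = real (card P)"
      define b where "b = real (card Q)"
      have X: "real X \<le> real H powr (11/10)" by (simp add: X_def)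
      have leX: "p \<le> X" if "real p \<le> real H powr (11/10)" for p using that by (simp add: X_def le_nat_floor)
      have "S ^ 8 \<le> 256 * b ^ 6 * a ^ 4 * (b * (real X ^ 4 + 1) + b ^ 2 * real X ^ 2)"
        unfolding S_def a_def b_def
      proof (rule bilinear_legendre_sum[OF fin(1) _ fin(2)])
        fix q assume "q \<in> Q"
        then have q: "prime q" "q mod 4 = 1" "real q \<le> real H powr (11/10)" using Q by auto
        moreover have "q \<noteq> 2" using q(2) by auto
        ultimately show "prime q \<and> 2 < q \<and> q \<le> X" using leX prime_ge_2_nat[of q] by auto
      qed (use P leX \<alpha> \<beta> in auto)
      also have "\<dots> = 256 * b ^ 7 * a ^ 4 * (real X ^ 4 + 1) + 256 * b ^ 8 * a ^ 4 * real X ^ 2"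
        by (simp add: algebra_simps power_numeral_reduce)
      also have "\<dots> \<le> e * a ^ 8 * b ^ 8"
      proof -
        have "512 * (real X ^ 4 + 1) \<le> 512 * ((real H powr (11/10)) ^ 4 + 1)"
          using X by (intro mult_left_mono add_right_mono power_mono) auto
        also have "\<dots> \<le> e * ((real H powr (9/10)) ^ 4 * real H powr (9/10))" by (rule elim)
        also have "\<dots> \<le> e * (a ^ 4 * b)"
          using cP cQ \<eta>8 unfolding a_def b_def e_def by (intro mult_left_mono mult_mono power_mono) auto
        finally have "b ^ 7 * a ^ 4 * (512 * (real X ^ 4 + 1)) \<le> b ^ 7 * a ^ 4 * (e * (a ^ 4 * b))"
          by (intro mult_left_mono) (simp_all add: a_def b_def)
        moreover have "256 * b ^ 7 * a ^ 4 * (real X ^ 4 + 1) * 2 = b ^ 7 * a ^ 4 * (512 * (real X ^ 4 + 1))"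
          by (simp add: algebra_simps)
        ultimately have "256 * b ^ 7 * a ^ 4 * (real X ^ 4 + 1) * 2 \<le> b ^ 7 * a ^ 4 * (e * (a ^ 4 * b))" by linarith
        also have "\<dots> = e * a ^ 8 * b ^ 8" by (simp add: power_numeral_reduce mult_ac)
        finally have 1: "256 * b ^ 7 * a ^ 4 * (real X ^ 4 + 1) * 2 \<le> e * a ^ 8 * b ^ 8" .
        have "512 * real X ^ 2 \<le> 512 * (real H powr (11/10)) ^ 2"
          using X by (intro mult_left_mono power_mono) auto
        also have "\<dots> \<le> e * (real H powr (9/10)) ^ 4" by (rule elim)
        also have "\<dots> \<le> e * a ^ 4"
          using cP \<eta>8 unfolding a_def e_def by (intro mult_left_mono power_mono) auto
        finally have "256 * b ^ 8 * a ^ 4 * real X ^ 2 * 2 \<le> b ^ 8 * a ^ 4 * (e * a ^ 4)"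
          using mult_left_mono[of "512 * real X ^ 2" "e * a ^ 4" "b ^ 8 * a ^ 4"] by (simp add: a_def b_def mult_ac)
        also have "\<dots> = e * a ^ 8 * b ^ 8" by (simp add: power_numeral_reduce mult_ac)
        finally show ?thesis using 1 by linarith
      qed
      also have "\<dots> = (\<eta> * (a * b)) ^ 8" by (simp add: e_def power_mult_distrib)
      finally have "\<bar>S\<bar> ^ 8 \<le> (\<eta> * (a * b)) ^ 8" by (simp add: power_even_abs)
      then have "\<bar>S\<bar> \<le> \<eta> * (a * b)" by (rule power_le_imp_le_base[of _ 7, simplified]) (use \<eta> in \<open>simp add: a_def b_def\<close>)
      then show "\<bar>\<Sum>p\<in>P. \<Sum>q\<in>Q. \<alpha> p * \<beta> q * real_of_int (Legendre p q)\<bar> \<le> \<eta> * (real (card P) * real (card Q))"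
        by (simp add: S_def a_def b_def)
    qed
  qed
qed

text \<open>The exponent keeps the sieve error z^4 below H^(1/4), which is negligible against H / t
  for t up to H^(1/4), while ln z is still a constant times ln H.\<close>

definition sieve_level :: "nat \<Rightarrow> nat" where
  "sieve_level H = nat \<lfloor>real H powr (1 / 16)\<rfloor>"

text \<open>Uniformity in \<open>t1\<close> and \<open>t2\<close> is inside the predicate, since
  both vary with \<open>H\<close>; only \<open>C\<close> stays fixed when \<open>H\<close> tends to
  infinity.\<close>

definition rough_pairs_bounded :: "nat \<Rightarrow> nat \<Rightarrow> real \<Rightarrow> nat \<Rightarrow> bool" where
  "rough_pairs_bounded d u C H \<longleftrightarrow> (\<forall>t1 t2 k. t1 \<ge> 1 \<longrightarrow> t1 \<noteq> t2 \<longrightarrow> real t1 \<le> real H powr (1 / 4) \<longrightarrow>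
    int k = \<bar>int t2 - int t1\<bar> \<longrightarrow>
    real (card {p \<in> poly_box (Suc d) H. rough u (sieve_level H) (poly p (int t1)) \<and> rough u (sieve_level H) (poly p (int t2))})
      \<le> C * rho k * real H ^ (d + 1) / ln (real H) ^ 2)"

text \<open>The two interval lengths H t1 and H / t1 multiply to H^2, so the bound is free of
  \<open>t1\<close>. A positive degree provides the two coefficients that are varied.\<close>

lemma eventually_rough_pairs_bounded:
  fixes d u :: nat
  assumes d: "d \<ge> 1" and u: "u > 0"
  shows "\<exists>C > 0. \<forall>\<^sub>F H in sequentially. rough_pairs_bounded d u C H"
proof -
  obtain m where m: "d = Suc m" using d by (cases d) auto
  \<comment> \<open>320 = 32 * 2 * 5 and 192 = 32 * 2 * 3: the 32 stems from ln z >= ln H / 32, the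
    2 from the sieve, and 5 and 3 bound the interval lengths in units of H t1 and H / t1. Each + 1
    absorbs z^4.\<close>
  define K where "K = (320 * rho u + 1) * (192 * rho u + 1)"
  have r1: "rho u \<ge> 1" by (rule rho_ge_1)
  have K: "K > 0" unfolding K_def using r1 by (intro mult_pos_pos) auto
  have "\<forall>\<^sub>F H in sequentially. real_of_int \<lfloor>real H powr (1 / 16)\<rfloor> \<ge> 2"
    by real_asymp
  moreover have "\<forall>\<^sub>F H in sequentially. ln (real H) / 32 \<le> ln (real H powr (1 / 16) - 1)"
    by real_asymp
  moreover have "\<forall>\<^sub>F H in sequentially. real H powr (1 / 4) * ln (real H) \<le> real H powr (3 / 4)"
    by real_asymp
  moreover have "\<forall>\<^sub>F H in sequentially. real H powr (3 / 4) \<le> real H" by real_asymp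
  moreover have "\<forall>\<^sub>F H in sequentially. H \<ge> (3::nat)" by (rule eventually_ge_at_top)
  ultimately have "\<forall>\<^sub>F H in sequentially. rough_pairs_bounded d u (3 ^ m * K) H"
  proof eventually_elim
    case (elim H)
    define z where "z = sieve_level H"
    define L where "L = ln (real H)"
    have H: "real H \<ge> 3" using elim(5) by simp
    have L: "L > 0" using H by (simp add: L_def)
    have zr: "real z = real_of_int \<lfloor>real H powr (1 / 16)\<rfloor>" by (simp add: z_def sieve_level_def)
    have z2: "z \<ge> 2" using elim(1) zr by linarith
    have "real H powr (1 / 16) - 1 \<le> real z" unfolding zr by linarith
    moreover have "0 < real H powr (1 / 16) - 1" using elim(1) by linarith
    ultimately have "ln (real H powr (1 / 16) - 1) \<le> ln (real z)" by (subst ln_le_cancel_iff) auto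
    with elim(2) have lnz: "L / 32 \<le> ln (real z)" by (simp add: L_def)
    have z4: "real z ^ 4 \<le> real H powr (1 / 4)"
    proof -
      have "real z \<le> real H powr (1 / 16)" unfolding zr by simp
      then have "real z ^ 4 \<le> (real H powr (1 / 16)) ^ 4" by (intro power_mono) auto
      also have "\<dots> = real H powr (1 / 4)" using H by (simp add: powr_powr flip: powr_realpow)
      finally show ?thesis .
    qed
    show ?case unfolding rough_pairs_bounded_def
    proof (intro allI impI)
      fix t1 t2 k :: nat
      assume t: "t1 \<ge> 1" "t1 \<noteq> t2" "real t1 \<le> real H powr (1 / 4)" and k: "int k = \<bar>int t2 - int t1\<bar>"
      define s where "s = real t1"
      have s: "s \<ge> 1" "s \<le> real H powr (1 / 4)" using t by (auto simp: s_def)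
      have k0: "k \<noteq> 0" using k t(2) by auto
      have r: "rho k \<ge> 1" "rho (k * u) \<le> rho k * rho u" using rho_ge_1 rho_mult_le[OF k0] u by auto
      have bnd: "x / ln (real z) \<le> 32 * y / L" if "0 \<le> x" "x \<le> y" for x y
      proof -
        have "x / ln (real z) \<le> x / (L / 32)" using lnz L that by (intro divide_left_mono) auto
        also have "\<dots> = 32 * x / L" by simp
        also have "\<dots> \<le> 32 * y / L" using that L by (intro divide_right_mono) auto
        finally show ?thesis .
      qed
      define Q1 where "Q1 = real H * s / L"
      define Q2 where "Q2 = real H / s / L"
      have Q0: "Q1 \<ge> 0" "Q2 \<ge> 0" using s L by (simp_all add: Q1_def Q2_def)
      have Hs1: "real H * 1 \<le> real H * s" using s by (intro mult_left_mono) auto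
      have Hs: "real H / s \<ge> real H powr (3 / 4)"
      proof -
        have "real H powr (3 / 4) = real H powr (1 - 1 / 4)" by simp
        also have "\<dots> = real H / real H powr (1 / 4)" using H by (subst powr_diff) auto
        also have "\<dots> \<le> real H / s" using s H by (intro divide_left_mono) auto
        finally show ?thesis .
      qed
      have z4L: "real z ^ 4 * L \<le> real H powr (3 / 4)"
      proof -
        have "real z ^ 4 * L \<le> real H powr (1 / 4) * L" using z4 L by (intro mult_right_mono) auto
        with elim(3) show ?thesis by (simp add: L_def)
      qed
      have "real z ^ 4 \<le> Q1"
        using z4L elim(4) Hs1 L unfolding Q1_def by (subst pos_le_divide_eq) auto
      moreover have "2 * rho u * real (2 * H * (1 + t1) + 1) / ln (real z) \<le> (320 * rho u) * Q1"
      proof -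
        have "real (2 * H * (1 + t1) + 1) = 2 * real H + 2 * (real H * s) + 1" by (simp add: s_def algebra_simps)
        also have "\<dots> \<le> 5 * (real H * s)" using Hs1 H by linarith
        finally have "2 * rho u * real (2 * H * (1 + t1) + 1) \<le> 2 * rho u * (5 * (real H * s))"
          using r1 by (intro mult_left_mono) auto
        then have "2 * rho u * real (2 * H * (1 + t1) + 1) / ln (real z) \<le> 32 * (2 * rho u * (5 * (real H * s))) / L"
          using r1 by (intro bnd) auto
        also have "\<dots> = (320 * rho u) * Q1" by (simp add: Q1_def)
        finally show ?thesis .
      qed
      ultimately have A1: "2 * rho u * real (2 * H * (1 + t1) + 1) / ln (real z) + real z ^ 4
          \<le> (320 * rho u + 1) * Q1" unfolding distrib_right mult_1 by (intro add_mono)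
      have "real z ^ 4 \<le> Q2"
        using z4L Hs L unfolding Q2_def by (subst pos_le_divide_eq) auto
      moreover have "1 * Q2 \<le> rho k * Q2" using r(1) Q0(2) by (rule mult_right_mono)
      ultimately have "real z ^ 4 \<le> rho k * Q2" by linarith
      moreover have "2 * rho (k * u) * (2 * real H / real t1 + 1) / ln (real z) \<le> (192 * rho u) * (rho k * Q2)"
      proof -
        have "1 \<le> real H powr (3 / 4)" using H by (intro ge_one_powr_ge_zero) auto
        with Hs have "1 \<le> real H / s" by linarith
        then have "2 * real H / real t1 + 1 \<le> 3 * (real H / s)" by (simp add: s_def)
        then have "2 * rho (k * u) * (2 * real H / real t1 + 1) \<le> 2 * (rho k * rho u) * (3 * (real H / s))"
          using r r1 s rho_ge_1[of "k * u"] by (intro mult_mono) auto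
        then have "2 * rho (k * u) * (2 * real H / real t1 + 1) / ln (real z) \<le> 32 * (2 * (rho k * rho u) * (3 * (real H / s))) / L"
          using rho_ge_1[of "k * u"] by (intro bnd) auto
        also have "\<dots> = (192 * rho u) * (rho k * Q2)" by (simp add: Q2_def)
        finally show ?thesis .
      qed
      ultimately have A2: "2 * rho (k * u) * (2 * real H / real t1 + 1) / ln (real z) + real z ^ 4
          \<le> (192 * rho u + 1) * (rho k * Q2)" unfolding distrib_right mult_1 by (intro add_mono)
      have "real (card {p \<in> poly_box (Suc d) H. rough u z (poly p (int t1)) \<and> rough u z (poly p (int t2))})
        \<le> real (2 * H + 1) ^ m *
       ((2 * rho u * real (2 * H * (1 + t1) + 1) / ln (real z) + real z ^ 4) *
        (2 * rho (k * u) * (2 * real H / real t1 + 1) / ln (real z) + real z ^ 4))"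
        unfolding m by (rule card_rough_polys[OF z2 u t(1,2) k])
      also have "\<dots> \<le> (3 * real H) ^ m * (((320 * rho u + 1) * Q1) * ((192 * rho u + 1) * (rho k * Q2)))"
      proof (intro mult_mono power_mono A1 A2)
        show "real (2 * H + 1) \<le> 3 * real H" using H by simp
        show "0 \<le> (2 * rho (k * u) * (2 * real H / real t1 + 1) / ln (real z) + real z ^ 4)"
          using rho_ge_1[of "k * u"] lnz L by (intro add_nonneg_nonneg divide_nonneg_nonneg) auto
        show "0 \<le> (320 * rho u + 1) * Q1" using r1 Q0 by simp
        have "0 \<le> 2 * rho u * real (2 * H * (1 + t1) + 1) / ln (real z) + real z ^ 4"
          using r1 lnz L by (intro add_nonneg_nonneg divide_nonneg_nonneg) auto
        then show "0 \<le> (2 * rho u * real (2 * H * (1 + t1) + 1) / ln (real z) + real z ^ 4) *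
           (2 * rho (k * u) * (2 * real H / real t1 + 1) / ln (real z) + real z ^ 4)"
          using \<open>0 \<le> (2 * rho (k * u) * (2 * real H / real t1 + 1) / ln (real z) + real z ^ 4)\<close> by (rule mult_nonneg_nonneg)
      qed auto
      also have "\<dots> = (3 ^ m * K) * rho k * real H ^ (d + 1) / L ^ 2"
      proof -
        have "Q1 * Q2 = real H ^ 2 / L ^ 2" using s by (simp add: Q1_def Q2_def power2_eq_square)
        moreover have "(3 * real H) ^ m * ((x * Q1) * (y * (rho k * Q2))) = (3 ^ m * (x * y)) * rho k * (real H ^ m * (Q1 * Q2))" for x y
          by (simp add: power_mult_distrib)
        ultimately show ?thesis by (simp add: K_def m power2_eq_square)
      qed
      finally show "real (card {p \<in> poly_box (Suc d) H. rough u (sieve_level H) (poly p (int t1)) \<and> rough u (sieve_level H) (poly p (int t2))})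
        \<le> (3 ^ m * K) * rho k * real H ^ (d + 1) / ln (real H) ^ 2" by (simp add: z_def L_def)
    qed
  qed
  moreover have "3 ^ m * K > 0" using K by simp
  ultimately show ?thesis by blast
qed

section \<open>The second moment argument\<close>

definition bounded_polys :: "nat \<Rightarrow> nat \<Rightarrow> int poly set" where
  "bounded_polys d H = {p. degree p = d \<and> (\<forall>k. \<bar>coeff p k\<bar> \<le> int H)}"

lemma bounded_polys_subset: "bounded_polys d H \<subseteq> poly_box (Suc d) H"
  by (auto simp: bounded_polys_def poly_box_def coeff_eq_0)

lemma finite_bounded_polys: "finite (bounded_polys d H)"
  by (rule finite_subset[OF bounded_polys_subset finite_poly_box])

lemma card_bounded_polys_le: "card (bounded_polys d H) \<le> (2 * H + 1) ^ (d + 1)"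
  using card_mono[OF finite_poly_box bounded_polys_subset, of d H] by (simp add: card_poly_box)

text \<open>The lower limit on \<open>v\<close> rules out smaller degrees, so every polynomial
  counted in the box has degree exactly \<open>d\<close>.\<close>

lemma card_bounded_polys_value:
  fixes t H d :: nat and v :: int
  assumes t: "t \<ge> 1" and H: "2 * t \<le> H" and v: "2 * \<bar>v\<bar> \<le> int H * int t ^ d"
    and v': "int H * int t ^ d \<le> (int t - 1) * \<bar>v\<bar>"
  shows "real (card {p \<in> bounded_polys d H. poly p (int t) = v}) \<ge> (real H / (2 * real t)) ^ d"
proof -
  have "{p \<in> poly_box (Suc d) H. poly p (int t) = v} \<subseteq> {p \<in> bounded_polys d H. poly p (int t) = v}"
  proof (rule subsetI, rule CollectI, elim CollectE conjE, rule conjI)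
    fix p assume p: "p \<in> poly_box (Suc d) H" "poly p (int t) = v"
    have "H > 0" using H t by linarith
    moreover have "int H * int t ^ d \<le> (int t - 1) * \<bar>poly p (int t)\<bar>" using v' unfolding p(2)[symmetric] .
    ultimately have "degree p = d" by (rule poly_box_degree[OF p(1) t])
    with p(1) show "p \<in> bounded_polys d H"
      unfolding bounded_polys_def poly_box_def by blast
  qed
  then have "card {p \<in> poly_box (Suc d) H. poly p (int t) = v} \<le> card {p \<in> bounded_polys d H. poly p (int t) = v}"
    by (rule card_mono[rotated]) (rule finite_subset[OF _ finite_bounded_polys], auto)
  then show ?thesis using card_poly_box_value[OF t H v] by linarith
qed

text \<open>Each distance from \<open>t\<close> occurs at most once on either side and is at most
  \<open>T\<close>.\<close>

lemma sum_distances_le: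
  fixes f :: "nat \<Rightarrow> real"
  assumes f: "\<And>k. f k \<ge> 0" and t: "t \<in> {T..<2 * T}"
  shows "(\<Sum>s\<in>{T..<2 * T} - {t}. f (nat \<bar>int s - int t\<bar>)) \<le> 2 * (\<Sum>k = 1..T. f k)"
proof -
  define h where "h = (\<lambda>s. f (nat \<bar>int s - int t\<bar>))"
  have tT: "T \<le> t" "t < 2 * T" using t by simp_all
  have f0: "\<forall>k\<in>{1..T}. 0 \<le> f k" using f by blast
  have set: "{T..<2 * T} - {t} = {T..<t} \<union> {t<..<2 * T}" using tT by (simp add: Set.set_eq_iff) linarith
  have "(\<Sum>s\<in>{T..<t} \<union> {t<..<2 * T}. h s) = (\<Sum>s\<in>{T..<t}. h s) + (\<Sum>s\<in>{t<..<2 * T}. h s)"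
    by (rule sum.union_disjoint) (simp_all add: disjoint_iff)
  moreover have "(\<Sum>s\<in>{T..<t}. h s) \<le> (\<Sum>k = 1..T. f k)"
  proof (rule sum_le_included[where i = "\<lambda>k. t - k", OF _ _ f0])
    show "\<forall>s\<in>{T..<t}. \<exists>k\<in>{1..T}. t - k = s \<and> h s \<le> f k"
    proof
      fix s assume s: "s \<in> {T..<t}"
      then have "nat \<bar>int s - int t\<bar> = t - s" "t - s \<in> {1..T}" "t - (t - s) = s" using tT by (simp_all, linarith+)
      then show "\<exists>k\<in>{1..T}. t - k = s \<and> h s \<le> f k" unfolding h_def by (intro bexI[of _ "t - s"]) simp_all
    qed
  qed simp_all
  moreover have "(\<Sum>s\<in>{t<..<2 * T}. h s) \<le> (\<Sum>k = 1..T. f k)"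
  proof (rule sum_le_included[where i = "\<lambda>k. t + k", OF _ _ f0])
    show "\<forall>s\<in>{t<..<2 * T}. \<exists>k\<in>{1..T}. t + k = s \<and> h s \<le> f k"
    proof
      fix s assume s: "s \<in> {t<..<2 * T}"
      then have "nat \<bar>int s - int t\<bar> = s - t" "s - t \<in> {1..T}" "t + (s - t) = s" using tT by (simp_all, linarith+)
      then show "\<exists>k\<in>{1..T}. t + k = s \<and> h s \<le> f k" unfolding h_def by (intro bexI[of _ "s - t"]) simp_all
    qed
  qed simp_all
  ultimately show ?thesis unfolding set h_def by linarith
qed

lemma rough_prime_multiple:
  fixes u :: int and p z :: nat
  assumes "prime p" "z < p"
  shows "rough (nat \<bar>u\<bar>) z (u * int p)"
  unfolding rough_def
proof (intro allI impI notI)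
  fix q assume q: "prime q" "q \<le> z" "\<not> q dvd nat \<bar>u\<bar>" "int q dvd u * int p"
  then have "int q dvd u \<or> int q dvd int p" using q(1) prime_dvd_mult_iff[of "int q" u "int p"] by simp
  moreover have "\<not> int q dvd u" using q(3) by (metis abs_ge_zero dvd_abs_iff int_dvd_int_iff nat_0_le)
  moreover have "int q dvd int p \<longrightarrow> q = p"
    using primes_dvd_imp_eq[OF q(1) assms(1)] int_dvd_int_iff by blast
  ultimately show False using q(2) assms(2) by linarith
qed

definition prime_window :: "real \<Rightarrow> real \<Rightarrow> nat set" where
  "prime_window \<delta> Y = {p. prime p \<and> p mod 4 = 1 \<and> \<delta> * Y < real p \<and> real p \<le> Y}"

lemma finite_prime_window: "finite (prime_window \<delta> Y)"
  by (rule finite_subset[of _ "{..nat \<lfloor>Y\<rfloor>}"]) (auto simp: prime_window_def le_nat_floor)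

text \<open>With three groups this is local solubility at each \<open>p i\<close>: the product of
  the two other coefficients is a square there. Signs are invisible since the primes will be 1
  modulo 4.\<close>

definition symbols_trivial :: "'i set \<Rightarrow> ('i \<Rightarrow> nat) \<Rightarrow> ('i \<Rightarrow> nat) \<Rightarrow> bool" where
  "symbols_trivial I g p \<longleftrightarrow> (\<forall>i\<in>I. (\<Prod>j\<in>{j\<in>I. g j \<noteq> g i}. Legendre (int (p j)) (int (p i))) = 1)"

text \<open>Injectivity of \<open>p\<close> makes the three products squarefree and pairwise
  coprime.\<close>

definition prime_values :: "'i set \<Rightarrow> ('i \<Rightarrow> nat) \<Rightarrow> ('i \<Rightarrow> int) \<Rightarrow> ('i \<Rightarrow> int poly) \<Rightarrow> nat \<Rightarrow> bool" where
  "prime_values I g u P t \<longleftrightarrow> (\<exists>p. inj_on p I \<and> symbols_trivial I g p \<and>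
     (\<forall>i\<in>I. prime (p i) \<and> p i mod 4 = 1 \<and> poly (P i) (int t) = u i * int (p i)))"

text \<open>The values determine the primes because \<open>u i\<close> is nonzero, so different
  prime tuples in \<open>A\<close> have disjoint fibres; extensionality makes a tuple the same as
  its values on \<open>I\<close>. Each fibre is a product over \<open>I\<close>.\<close>

lemma card_tuples_with_values:
  fixes I :: "'i set" and d :: "'i \<Rightarrow> nat" and u :: "'i \<Rightarrow> int"
  assumes fin: "finite I" and u: "\<And>i. i \<in> I \<Longrightarrow> u i \<noteq> 0" and t: "t \<ge> 1" and H: "2 * t \<le> H"
    and A: "finite A" "A \<subseteq> extensional I"
    and val: "\<And>p i. p \<in> A \<Longrightarrow> i \<in> I \<Longrightarrow> 2 * \<bar>u i * int (p i)\<bar> \<le> int H * int t ^ d i \<and>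
       int H * int t ^ d i \<le> (int t - 1) * \<bar>u i * int (p i)\<bar>"
  shows "real (card A) * (\<Prod>i\<in>I. (real H / (2 * real t)) ^ d i) \<le>
    real (card {P \<in> PiE I (\<lambda>i. bounded_polys (d i) H). \<exists>p\<in>A. \<forall>i\<in>I. poly (P i) (int t) = u i * int (p i)})"
proof -
  define F where "F = (\<lambda>p. PiE I (\<lambda>i. {q \<in> bounded_polys (d i) H. poly q (int t) = u i * int (p i)}))"
  define G where "G = {P \<in> PiE I (\<lambda>i. bounded_polys (d i) H). \<exists>p\<in>A. \<forall>i\<in>I. poly (P i) (int t) = u i * int (p i)}"
  have finF: "finite (F p)" for p
    unfolding F_def using fin by (intro finite_PiE) (auto intro: finite_subset[OF _ finite_bounded_polys])
  have finG: "finite G"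
    by (rule finite_subset[of _ "PiE I (\<lambda>i. bounded_polys (d i) H)"])
      (auto simp: G_def intro!: finite_PiE fin finite_bounded_polys)
  have disj: "F p \<inter> F q = {}" if "p \<in> A" "q \<in> A" "p \<noteq> q" for p q
  proof (rule ccontr)
    assume "F p \<inter> F q \<noteq> {}"
    then obtain P where P: "P \<in> F p" "P \<in> F q" by blast
    have "p i = q i" if i: "i \<in> I" for i
    proof -
      have "poly (P i) (int t) = u i * int (p i)" "poly (P i) (int t) = u i * int (q i)"
        using P i by (auto simp: F_def PiE_iff)
      then show ?thesis using u[OF i] by simp
    qed
    then have "p = q" using that(1,2) A(2) by (intro extensionalityI[of _ I]) auto
    then show False using that by simp
  qed
  have "(\<Prod>i\<in>I. (real H / (2 * real t)) ^ d i) \<le> real (card (F p))" if p: "p \<in> A" for p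
  proof -
    have "(\<Prod>i\<in>I. (real H / (2 * real t)) ^ d i) \<le>
        (\<Prod>i\<in>I. real (card {q \<in> bounded_polys (d i) H. poly q (int t) = u i * int (p i)}))"
    proof (rule prod_mono)
      fix i assume i: "i \<in> I"
      show "0 \<le> (real H / (2 * real t)) ^ d i \<and> (real H / (2 * real t)) ^ d i
          \<le> real (card {q \<in> bounded_polys (d i) H. poly q (int t) = u i * int (p i)})"
        using card_bounded_polys_value[OF t H] val[OF p i] by simp
    qed
    also have "\<dots> = real (card (F p))" using fin by (simp add: F_def card_PiE)
    finally show ?thesis .
  qed
  then have "(\<Sum>p\<in>A. (\<Prod>i\<in>I. (real H / (2 * real t)) ^ d i)) \<le> (\<Sum>p\<in>A. real (card (F p)))"
    by (rule sum_mono)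
  also have "\<dots> = real (card (\<Union>p\<in>A. F p))"
    using A(1) finF disj by (subst card_UN_disjoint) auto
  also have "card (\<Union>p\<in>A. F p) \<le> card G"
  proof (rule card_mono[OF finG])
    show "(\<Union>p\<in>A. F p) \<subseteq> G" by (auto simp: F_def G_def PiE_iff)
  qed
  finally show ?thesis by (simp add: G_def)
qed

text \<open>\<open>t\<close> is of the size of a power of ln H, so H t^d stays below H^(21/20),
  safely within the range of \<open>symbols_cancel\<close>.\<close>

lemma eventually_log_power_le: "\<forall>\<^sub>F H in sequentially. (2 * real (nat \<lceil>ln (real H) ^ n\<rceil>)) ^ D \<le> real H powr (1 / 20)"
proof -
  \<comment> \<open>The summand 1 keeps \<epsilon> meaningful when \<open>n * D\<close> is 0. The
    logarithms use up the exponent 1/40, and another 1/40 is left for the constant 4^D.\<close>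
  define N where "N = real (n * D) + 1"
  have N: "N > 0" "real (n * D) \<le> N" by (simp_all add: N_def add_nonneg_pos)
  define \<epsilon> where "\<epsilon> = 1 / (40 * N)"
  have \<epsilon>: "\<epsilon> > 0" using N by (simp add: \<epsilon>_def)
  have "\<epsilon> * real (n * D) \<le> \<epsilon> * N" using N \<epsilon> by (intro mult_left_mono) auto
  also have "\<dots> = 1 / 40" using N by (simp add: \<epsilon>_def)
  finally have \<epsilon>N: "\<epsilon> * real (n * D) \<le> 1 / 40" .
  have "\<forall>\<^sub>F H in sequentially. ln (real H) \<le> real H powr \<epsilon>" using \<epsilon> by real_asymp
  moreover have "\<forall>\<^sub>F H in sequentially. 4 ^ D * real H powr (1 / 40) \<le> real H powr (1 / 20)"
  proof -
    define c where "c = (4::real) ^ D"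
    have "c > 0" by (simp add: c_def)
    then show ?thesis unfolding c_def[symmetric] by real_asymp
  qed
  moreover have "\<forall>\<^sub>F H in sequentially. H \<ge> (3::nat)" by (rule eventually_ge_at_top)
  ultimately show ?thesis
  proof eventually_elim
    case (elim H)
    have H: "real H \<ge> 3" using elim(3) by simp
    have lnH: "ln (real H) \<ge> 1"
    proof -
      have "exp 1 \<le> real H" using exp_le H by linarith
      then show ?thesis using H by (subst ln_ge_iff) auto
    qed
    have "real (nat \<lceil>ln (real H) ^ n\<rceil>) \<le> ln (real H) ^ n + 1" using lnH by (simp add: of_nat_ceiling)
    also have "\<dots> \<le> 2 * ln (real H) ^ n" using one_le_power[OF lnH, of n] by simp
    finally have "(2 * real (nat \<lceil>ln (real H) ^ n\<rceil>)) ^ D \<le> (4 * ln (real H) ^ n) ^ D"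
      by (intro power_mono) auto
    also have "\<dots> = 4 ^ D * ln (real H) ^ (n * D)" by (simp add: power_mult_distrib power_mult)
    also have "\<dots> \<le> 4 ^ D * (real H powr \<epsilon>) ^ (n * D)"
      using elim(1) lnH by (intro mult_left_mono power_mono) auto
    also have "(real H powr \<epsilon>) ^ (n * D) = real H powr (\<epsilon> * real (n * D))"
      using H by (simp add: powr_powr flip: powr_realpow)
    also have "\<dots> \<le> real H powr (1 / 40)"
      using H \<epsilon>N by (intro powr_mono) auto
    finally show ?case using elim(2) by (simp add: mult_left_mono)
  qed
qed

lemma prime_window_disjoint:
  assumes "Y' \<le> \<delta> * Y"
  shows "prime_window \<delta> Y \<inter> prime_window \<delta> Y' = {}"
  using assms by (auto simp: prime_window_def)

text \<open>The scales \<open>\<kappa> i\<close> are distinct powers of \<open>\<delta>\<close>, so that the windows for different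
  indices of equal degree are disjoint; for different degrees the factor \<open>t\<close> separates them.\<close>

lemma card_union_lower_bound:
  fixes I :: "'i set" and g d :: "'i \<Rightarrow> nat" and u :: "'i \<Rightarrow> int"
    and \<delta> c0 Y0 \<kappa>0 \<kappa>m Cr :: real and \<kappa> C :: "'i \<Rightarrow> real" and e :: "'i \<Rightarrow> nat" and H T D n :: nat
  defines "L \<equiv> ln (real H)"
  assumes fin: "finite I" and n: "n = card I" and d: "\<And>i. i \<in> I \<Longrightarrow> d i \<ge> 1" and u: "\<And>i. i \<in> I \<Longrightarrow> u i \<noteq> 0"
    and two: "i1 \<in> I" "i2 \<in> I" "g i1 \<noteq> g i2"
    and \<delta>: "0 < \<delta>" "\<delta> < 1" and c0: "c0 > 0"
    and Y0: "\<And>Y. Y \<ge> Y0 \<Longrightarrow> c0 * Y / ln Y \<le> real (card (prime_window \<delta> Y))"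
    and e: "inj_on e I" and \<kappa>: "\<And>i. i \<in> I \<Longrightarrow> \<kappa> i = \<kappa>0 * \<delta> ^ e i"
    and \<kappa>m: "0 < \<kappa>m" "\<And>i. i \<in> I \<Longrightarrow> \<kappa>m \<le> \<kappa> i" and \<kappa>0: "\<And>i. i \<in> I \<Longrightarrow> 2 * \<bar>real_of_int (u i)\<bar> * \<kappa>0 \<le> 1"
    and D: "D \<ge> 1" "\<And>i. i \<in> I \<Longrightarrow> d i \<le> D"
    and Cr: "(\<Sum>k = 1..T. rho k ^ n) \<le> Cr * real T" and C: "\<And>i. i \<in> I \<Longrightarrow> C i > 0"
    and T: "T \<ge> 1" "L ^ n \<le> real T" "real T \<le> 2 * L ^ n"
    and F1: "H \<ge> 3" and F2: "(2 * real T) ^ D \<le> real H powr (1 / 20)"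
    and F3: "1 \<le> (real T - 1) * \<delta> * \<kappa>m" "\<kappa>0 \<le> real T * \<delta> * \<kappa>m"
    and F4: "symbols_cancel H (1 / 2 ^ (n + 1))"
    and F5: "\<And>i. i \<in> I \<Longrightarrow> rough_pairs_bounded (d i) (nat \<bar>u i\<bar>) (C i) H"
    and F6: "Y0 \<le> \<kappa>m * real H" "3 \<le> \<kappa>m * real H"
    and F7: "\<kappa>0 * real H powr (21 / 20) \<le> real H powr (11 / 10)"
    and F8: "real H powr (9 / 10) \<le> c0 * \<kappa>m * real H / (2 * L)"
    and F9: "real (sieve_level H) < \<delta> * (\<kappa>m * real H)"
    and F11: "2 * real H powr (1 / 20) \<le> real H"
  defines "c2 \<equiv> (\<Prod>i\<in>I. c0 * \<kappa>m / 2 / 2 ^ d i) / 2 ^ (n + 1)" and "b \<equiv> 8 * Cr * (\<Prod>i\<in>I. C i)"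
    and "W \<equiv> (\<Prod>i\<in>I. real H ^ (d i + 1))"
  shows "c2 / (1 + b / c2) * W \<le> real (card {P \<in> PiE I (\<lambda>i. bounded_polys (d i) H). \<exists>t. prime_values I g u P t})"
proof -
  define S where "S = {T..<2 * T}"
  define \<Omega> where "\<Omega> = PiE I (\<lambda>i. bounded_polys (d i) H)"
  \<comment> \<open>Up to a constant, H t^(d i) is the natural size of the value of the i-th
    polynomial at \<open>t\<close>.\<close>
  define Y where "Y = (\<lambda>i t. \<kappa> i * real H * real t ^ d i)"
  define Q where "Q = (\<lambda>t i. prime_window \<delta> (Y i t))"
  define Good where "Good = (\<lambda>t. {p \<in> PiE I (Q t). symbols_trivial I g p})"
  define G where "G = (\<lambda>t. {P \<in> \<Omega>. \<exists>p\<in>Good t. \<forall>i\<in>I. poly (P i) (int t) = u i * int (p i)})"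
  have H3: "real H \<ge> 3" using F1 by simp
  have L1: "L \<ge> 1"
  proof -
    have "exp 1 \<le> real H" using exp_le H3 by linarith
    then show ?thesis unfolding L_def using H3 by (subst ln_ge_iff) auto
  qed
  have fin\<Omega>: "finite \<Omega>" unfolding \<Omega>_def using fin by (intro finite_PiE finite_bounded_polys)
  have \<kappa>0pos: "\<kappa>0 > 0"
  proof -
    have "0 < \<kappa> i1" using \<kappa>m two(1) by (meson less_le_trans)
    then show ?thesis using \<kappa>[OF two(1)] \<delta> by (simp add: zero_less_mult_iff)
  qed
  have \<kappa>le: "\<kappa> i \<le> \<kappa>0" "\<kappa> i > 0" if "i \<in> I" for i
  proof -
    show "\<kappa> i > 0" using \<kappa>m that by (meson less_le_trans)
    have "\<delta> ^ e i \<le> 1" using \<delta> by (simp add: power_le_one)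
    then show "\<kappa> i \<le> \<kappa>0" using \<kappa>[OF that] \<kappa>0pos by (simp add: mult_left_le)
  qed
  have tS: "t \<ge> 1" "T \<le> t" "real t \<le> 2 * real T" if "t \<in> S" for t
    using that T(1) by (auto simp: S_def)
  have tpow: "real t ^ j \<le> real H powr (1 / 20)" if "t \<in> S" "j \<le> D" for t j
  proof -
    have "real t ^ j \<le> (2 * real T) ^ j" using tS[OF that(1)] by (intro power_mono) auto
    also have "\<dots> \<le> (2 * real T) ^ D" using T(1) that(2) by (intro power_increasing) auto
    finally show ?thesis using F2 by linarith
  qed
  have tle: "real t \<le> real H powr (1 / 20)" if "t \<in> S" for t using tpow[OF that D(1)] by simp
  have tH: "2 * t \<le> H" if "t \<in> S" for t
  proof -
    have "real (2 * t) \<le> real H" using tle[OF that] F11 by simp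
    then show ?thesis by (simp only: of_nat_le_iff)
  qed
  have tq: "real t \<le> real H powr (1 / 4)" if "t \<in> S" for t
    using tle[OF that] powr_mono[of "1 / 20" "1 / 4" "real H"] H3 by linarith
  have tp1: "1 \<le> real t ^ d i" if "t \<in> S" for t i using tS[OF that] by (intro one_le_power) auto
  have Ylow: "\<kappa>m * real H * real t ^ d i \<le> Y i t" "\<kappa>m * real H \<le> Y i t" if "t \<in> S" "i \<in> I" for t i
  proof -
    show 1: "\<kappa>m * real H * real t ^ d i \<le> Y i t" unfolding Y_def using \<kappa>m(2)[OF that(2)] by (intro mult_right_mono) auto
    have "\<kappa>m * real H * 1 \<le> \<kappa>m * real H * real t ^ d i" using tp1[OF that(1)] \<kappa>m by (intro mult_left_mono) auto
    with 1 show "\<kappa>m * real H \<le> Y i t" by linarith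
  qed
  have Yup: "Y i t \<le> real H powr (11 / 10)" if "t \<in> S" "i \<in> I" for t i
  proof -
    have "Y i t \<le> \<kappa>0 * real H * real H powr (1 / 20)"
      unfolding Y_def using tpow[OF that(1) D(2)[OF that(2)]] \<kappa>le[OF that(2)] \<kappa>0pos
      by (intro mult_mono mult_nonneg_nonneg) auto
    also have "\<dots> = \<kappa>0 * real H powr (21 / 20)"
      using H3 powr_add[of "real H" 1 "1 / 20"] by simp
    finally show ?thesis using F7 by linarith
  qed
  have Qbig: "c0 * \<kappa>m / 2 * (real H * real t ^ d i / L) \<le> real (card (Q t i))" if t: "t \<in> S" and i: "i \<in> I" for t i
  proof -
    have y: "Y i t \<ge> Y0" "Y i t \<ge> 3" using Ylow(2)[OF t i] F6 by linarith+
    have "ln (Y i t) \<le> ln (real H powr (11 / 10))" using Yup[OF t i] y H3 by (subst ln_le_cancel_iff) auto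
    also have "\<dots> = 11 / 10 * L" using H3 by (simp add: ln_powr L_def)
    finally have lnY: "ln (Y i t) \<le> 2 * L" using L1 by linarith
    have lnY0: "ln (Y i t) > 0" using y by (intro ln_gt_zero) auto
    have "c0 * \<kappa>m / 2 * (real H * real t ^ d i / L) = c0 * (\<kappa>m * real H * real t ^ d i) / (2 * L)" by simp
    also have "\<dots> \<le> c0 * Y i t / (2 * L)"
      using Ylow(1)[OF t i] c0 L1 by (intro divide_right_mono mult_left_mono) auto
    also have "\<dots> \<le> c0 * Y i t / ln (Y i t)"
      using lnY lnY0 y c0 L1 by (intro divide_left_mono) auto
    also have "\<dots> \<le> real (card (Q t i))" unfolding Q_def by (rule Y0[OF y(1)])
    finally show ?thesis .
  qed
  have Qbig': "real H powr (9 / 10) \<le> real (card (Q t i))" if t: "t \<in> S" and i: "i \<in> I" for t i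
  proof -
    have "c0 * \<kappa>m * real H / (2 * L) = c0 * \<kappa>m / 2 * (real H * 1 / L)" by simp
    also have "\<dots> \<le> c0 * \<kappa>m / 2 * (real H * real t ^ d i / L)"
      using tp1[OF t] c0 \<kappa>m L1 by (intro mult_left_mono divide_right_mono) auto
    finally show ?thesis using F8 Qbig[OF t i] by linarith
  qed
  have finQ: "finite (Q t i)" for t i by (simp add: Q_def finite_prime_window)
  have Qp: "prime p \<and> p mod 4 = 1" "real p \<le> Y i t" "\<delta> * Y i t < real p" if "p \<in> Q t i" for p t i
    using that by (auto simp: Q_def prime_window_def)
  have Qdisj: "Q t i \<inter> Q t j = {}" if t: "t \<in> S" and ij: "i \<in> I" "j \<in> I" "i \<noteq> j" for t i j
  proof -
    have *: "Q t i \<inter> Q t j = {}" if ij: "i \<in> I" "j \<in> I" and less: "d i < d j \<or> d i = d j \<and> e j < e i" for i j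
    proof -
      have "Y i t \<le> \<delta> * Y j t"
      proof (cases "d i = d j")
        case True
        with less have "e j < e i" by auto
        then have "\<delta> ^ e i \<le> \<delta> ^ Suc (e j)" using \<delta> by (intro power_decreasing) auto
        then have "\<kappa>0 * \<delta> ^ e i \<le> \<kappa>0 * (\<delta> * \<delta> ^ e j)" using \<kappa>0pos by (intro mult_left_mono) auto
        then have "\<kappa> i * (real H * real t ^ d i) \<le> (\<delta> * \<kappa> j) * (real H * real t ^ d i)"
          using \<kappa> ij by (intro mult_right_mono) (auto simp: mult_ac)
        then show ?thesis using True by (simp add: Y_def mult_ac)
      next
        case False
        with less have "Suc (d i) \<le> d j" by auto
        then have tt: "real t * real t ^ d i \<le> real t ^ d j"
          using tS[OF t] power_increasing[of "Suc (d i)" "d j" "real t"] by simp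
        have "Y i t \<le> \<kappa>0 * (real H * real t ^ d i)"
          unfolding Y_def mult.assoc using \<kappa>le[OF ij(1)] by (intro mult_right_mono) auto
        also have "\<dots> \<le> (real t * \<delta> * \<kappa>m) * (real H * real t ^ d i)"
        proof (rule mult_right_mono)
          have "real T * (\<delta> * \<kappa>m) \<le> real t * (\<delta> * \<kappa>m)" using tS[OF t] \<delta> \<kappa>m by (intro mult_right_mono) auto
          then show "\<kappa>0 \<le> real t * \<delta> * \<kappa>m" using F3(2) by (simp add: mult.assoc)
        qed simp
        also have "\<dots> = \<delta> * (\<kappa>m * real H * (real t * real t ^ d i))" by (simp add: mult_ac)
        also have "\<dots> \<le> \<delta> * (\<kappa>m * real H * real t ^ d j)"
          using tt \<delta> \<kappa>m by (intro mult_left_mono mult_nonneg_nonneg) auto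
        also have "\<dots> \<le> \<delta> * Y j t" using Ylow(1)[OF t ij(2)] \<delta> by (intro mult_left_mono) auto
        finally show ?thesis .
      qed
      then show ?thesis unfolding Q_def using prime_window_disjoint by blast
    qed
    have "e i \<noteq> e j" using e ij by (auto simp: inj_on_def)
    then have "(d i < d j \<or> d i = d j \<and> e j < e i) \<or> (d j < d i \<or> d j = d i \<and> e i < e j)" by linarith
    then show ?thesis using *[OF ij(1,2)] *[OF ij(2,1)] by blast
  qed
  have finGood: "finite (Good t)" for t
    unfolding Good_def using fin finQ by (intro finite_subset[OF _ finite_PiE[of I "Q t"]]) auto
  have pinj: "inj_on p I" if "t \<in> S" "p \<in> PiE I (Q t)" for t p
  proof (rule inj_onI, rule ccontr)
    fix i j assume ij: "i \<in> I" "j \<in> I" "p i = p j" "i \<noteq> j"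
    have "p i \<in> Q t i" "p j \<in> Q t j" using that(2) ij by (auto simp: PiE_iff)
    then show False using Qdisj[OF that(1) ij(1,2,4)] ij(3) by auto
  qed
  \<comment> \<open>With \<eta> = 1 / 2^(n + 1) the main factor 1 - 2^n \<eta> of
    \<open>card_symbol_tuples\<close> is 1/2.\<close>
  have GoodB: "(\<Prod>i\<in>I. real (card (Q t i))) \<le> 2 ^ (n + 1) * real (card (Good t))" if t: "t \<in> S" for t
  proof -
    have "(1 - 2 ^ card I * (1 / 2 ^ (n + 1))) * (\<Prod>i\<in>I. real (card (Q t i))) \<le>
      2 ^ card I * real (card {p \<in> PiE I (Q t). \<forall>i\<in>I. (\<Prod>j\<in>{j\<in>I. g j \<noteq> g i}. Legendre (p j) (p i)) = 1})"
    proof (rule card_symbol_tuples[OF fin finQ _ _ two])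
      fix i q assume "i \<in> I" "q \<in> Q t i"
      then show "prime q \<and> q mod 4 = 1" using Qp by blast
    next
      fix i j and \<alpha> \<beta> :: "nat \<Rightarrow> real"
      assume ij: "i \<in> I" "j \<in> I" and ab: "\<And>p. \<bar>\<alpha> p\<bar> \<le> (1::real)" "\<And>p. \<bar>\<beta> p\<bar> \<le> (1::real)"
      have "prime p \<and> p mod 4 = 1 \<and> real p \<le> real H powr (11/10)" if "p \<in> Q t i" "i \<in> I" for p i
        using Qp[OF that(1)] Yup[OF t that(2)] by auto
      then show "\<bar>\<Sum>p\<in>Q t i. \<Sum>q\<in>Q t j. \<alpha> p * \<beta> q * real_of_int (Legendre p q)\<bar> \<le>
          1 / 2 ^ (n + 1) * (real (card (Q t i)) * real (card (Q t j)))"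
        using ij ab Qbig'[OF t] by (intro F4[unfolded symbols_cancel_def, rule_format] finQ) auto
    qed (use Qdisj[OF t] in auto)
    moreover have "1 - 2 ^ card I * (1 / 2 ^ (n + 1)) = (1 / 2 :: real)" by (simp add: n)
    ultimately show ?thesis by (simp add: Good_def symbols_trivial_def n)
  qed
  have W0: "W > 0" unfolding W_def using H3 by (intro prod_pos) auto
  have c2: "c2 > 0" unfolding c2_def using c0 \<kappa>m by (intro divide_pos_pos prod_pos) auto
  have uabs: "\<bar>real_of_int (u i)\<bar> \<ge> 1" if "i \<in> I" for i
  proof -
    have "\<bar>u i\<bar> \<ge> 1" using u[OF that] by linarith
    then show ?thesis by linarith
  qed
  \<comment> \<open>The upper limit holds because \<open>\<kappa>0\<close> is at most 1 / (2 |u i|).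
    For the lower one, \<open>F3\<close> puts the bottom of the window at or above H t^d / (t -
    1).\<close>
  have val: "2 * \<bar>u i * int (p i)\<bar> \<le> int H * int t ^ d i \<and> int H * int t ^ d i \<le> (int t - 1) * \<bar>u i * int (p i)\<bar>"
    if t: "t \<in> S" and p: "p \<in> Good t" and i: "i \<in> I" for t p i
  proof
    have pq: "p i \<in> Q t i" using p i by (auto simp: Good_def PiE_iff)
    have "2 * \<bar>real_of_int (u i)\<bar> * real (p i) \<le> 2 * \<bar>real_of_int (u i)\<bar> * Y i t"
      using Qp(2)[OF pq] by (intro mult_left_mono) auto
    also have "\<dots> \<le> 2 * \<bar>real_of_int (u i)\<bar> * (\<kappa>0 * (real H * real t ^ d i))"
      unfolding Y_def mult.assoc using \<kappa>le[OF i] by (intro mult_left_mono mult_right_mono) auto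
    also have "\<dots> = (2 * \<bar>real_of_int (u i)\<bar> * \<kappa>0) * (real H * real t ^ d i)" by simp
    also have "\<dots> \<le> 1 * (real H * real t ^ d i)" using \<kappa>0[OF i] by (intro mult_right_mono) auto
    finally have "real_of_int (2 * \<bar>u i * int (p i)\<bar>) \<le> real_of_int (int H * int t ^ d i)"
      by (simp add: abs_mult)
    then show "2 * \<bar>u i * int (p i)\<bar> \<le> int H * int t ^ d i" by (simp only: of_int_le_iff)
    have "1 * (real H * real t ^ d i) \<le> ((real t - 1) * \<delta> * \<kappa>m) * (real H * real t ^ d i)"
    proof (rule mult_right_mono)
      have "(real T - 1) * (\<delta> * \<kappa>m) \<le> (real t - 1) * (\<delta> * \<kappa>m)"
        using tS[OF t] \<delta> \<kappa>m by (intro mult_right_mono) auto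
      then show "1 \<le> (real t - 1) * \<delta> * \<kappa>m" using F3(1) by (simp add: mult.assoc)
    qed simp
    also have "\<dots> = (real t - 1) * (\<delta> * (\<kappa>m * real H * real t ^ d i))" by simp
    also have "\<dots> \<le> (real t - 1) * (\<delta> * Y i t)"
      using Ylow(1)[OF t i] \<delta> tS[OF t] by (intro mult_left_mono) auto
    also have "\<dots> \<le> (real t - 1) * (\<bar>real_of_int (u i)\<bar> * real (p i))"
    proof (rule mult_left_mono)
      have "1 * real (p i) \<le> \<bar>real_of_int (u i)\<bar> * real (p i)" using uabs[OF i] by (intro mult_right_mono) auto
      then show "\<delta> * Y i t \<le> \<bar>real_of_int (u i)\<bar> * real (p i)" using Qp(3)[OF pq] by linarith
    qed (use tS[OF t] in simp)
    finally have "real_of_int (int H * int t ^ d i) \<le> real_of_int ((int t - 1) * \<bar>u i * int (p i)\<bar>)"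
      by (simp add: abs_mult)
    then show "int H * int t ^ d i \<le> (int t - 1) * \<bar>u i * int (p i)\<bar>" by (simp only: of_int_le_iff)
  qed
  \<comment> \<open>The powers of \<open>t\<close> cancel: the i-th window has at least a constant
    times H t^(d i) / L primes, and each resulting value is taken by at least (H / (2 t))^(d i)
    polynomials.\<close>
  have first: "c2 * W / L ^ n \<le> real (card (G t))" if t: "t \<in> S" for t
  proof -
    have "c2 * W / L ^ n = (\<Prod>i\<in>I. (c0 * \<kappa>m / 2 * (real H * real t ^ d i / L)) * (real H / (2 * real t)) ^ d i) / 2 ^ (n + 1)"
    proof -
      have "(c0 * \<kappa>m / 2 * (real H * real t ^ d i / L)) * (real H / (2 * real t)) ^ d i =
          (c0 * \<kappa>m / 2 / 2 ^ d i) * real H ^ (d i + 1) / L" if "i \<in> I" for i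
        using tS[OF t] L1 by (simp add: power_divide power_mult_distrib mult_ac)
      then have "(\<Prod>i\<in>I. (c0 * \<kappa>m / 2 * (real H * real t ^ d i / L)) * (real H / (2 * real t)) ^ d i) =
          (\<Prod>i\<in>I. (c0 * \<kappa>m / 2 / 2 ^ d i) * real H ^ (d i + 1) / L)" by (intro prod.cong) auto
      also have "\<dots> = (\<Prod>i\<in>I. c0 * \<kappa>m / 2 / 2 ^ d i) * W / L ^ n"
        unfolding W_def n by (simp add: prod_dividef prod.distrib)
      finally show ?thesis by (simp add: c2_def)
    qed
    also have "\<dots> \<le> (\<Prod>i\<in>I. real (card (Q t i)) * (real H / (2 * real t)) ^ d i) / 2 ^ (n + 1)"
    proof (intro divide_right_mono prod_mono)
      fix i assume i: "i \<in> I"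
      have A0: "0 \<le> c0 * \<kappa>m / 2 * (real H * real t ^ d i / L)" using c0 \<kappa>m L1 by simp
      have B0: "0 \<le> (real H / (2 * real t)) ^ d i" by simp
      show "0 \<le> c0 * \<kappa>m / 2 * (real H * real t ^ d i / L) * (real H / (2 * real t)) ^ d i \<and>
         c0 * \<kappa>m / 2 * (real H * real t ^ d i / L) * (real H / (2 * real t)) ^ d i
         \<le> real (card (Q t i)) * (real H / (2 * real t)) ^ d i"
        by (rule conjI, rule mult_nonneg_nonneg[OF A0 B0], rule mult_right_mono[OF Qbig[OF t i] B0])
    qed auto
    also have "\<dots> = (\<Prod>i\<in>I. real (card (Q t i))) / 2 ^ (n + 1) * (\<Prod>i\<in>I. (real H / (2 * real t)) ^ d i)"
      by (simp add: prod.distrib)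
    also have "\<dots> \<le> real (card (Good t)) * (\<Prod>i\<in>I. (real H / (2 * real t)) ^ d i)"
    proof (rule mult_right_mono)
      show "(\<Prod>i\<in>I. real (card (Q t i))) / 2 ^ (n + 1) \<le> real (card (Good t))"
        using GoodB[OF t] by (simp add: divide_le_eq mult.commute)
    qed (intro prod_nonneg, simp)
    also have "\<dots> \<le> real (card (G t))" unfolding G_def \<Omega>_def
    proof (rule card_tuples_with_values[OF fin u tS(1)[OF t] tH[OF t] finGood])
      show "Good t \<subseteq> extensional I" by (auto simp: Good_def PiE_def)
    qed (use val[OF t] in blast)+
    finally show ?thesis .
  qed
  \<comment> \<open>Of each prime only its size above the sieve level is kept. Without the symbols
    the conditions at different indices are independent, so the count factors over
    \<open>I\<close>.\<close>
  have pair: "real (card (G t \<inter> G s)) \<le> (\<Prod>i\<in>I. C i) * rho (nat \<bar>int s - int t\<bar>) ^ n * W / L ^ (2 * n)"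
    if t: "t \<in> S" and s: "s \<in> S" and ts: "t \<noteq> s" for t s
  proof -
    define k where "k = nat \<bar>int s - int t\<bar>"
    define R where "R = (\<lambda>i. {p \<in> poly_box (Suc (d i)) H. rough (nat \<bar>u i\<bar>) (sieve_level H) (poly p (int t)) \<and>
        rough (nat \<bar>u i\<bar>) (sieve_level H) (poly p (int s))})"
    have finR: "finite (R i)" for i by (simp add: R_def finite_poly_box)
    have rough: "rough (nat \<bar>u i\<bar>) (sieve_level H) (u i * int (p i))" if "r \<in> S" "p \<in> Good r" "i \<in> I" for r p i
    proof -
      have pq: "p i \<in> Q r i" using that by (auto simp: Good_def PiE_iff)
      have "\<delta> * (\<kappa>m * real H) \<le> \<delta> * Y i r" using Ylow(2)[OF that(1,3)] \<delta> by (intro mult_left_mono) auto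
      then have "real (sieve_level H) < real (p i)" using F9 Qp(3)[OF pq] by linarith
      then show ?thesis using Qp(1)[OF pq] by (intro rough_prime_multiple) auto
    qed
    have "G t \<inter> G s \<subseteq> PiE I R"
    proof
      fix P assume P: "P \<in> G t \<inter> G s"
      then obtain p p' where p: "p \<in> Good t" "\<forall>i\<in>I. poly (P i) (int t) = u i * int (p i)"
        and p': "p' \<in> Good s" "\<forall>i\<in>I. poly (P i) (int s) = u i * int (p' i)" by (auto simp: G_def)
      have P\<Omega>: "P \<in> \<Omega>" using P by (auto simp: G_def)
      show "P \<in> PiE I R"
      proof (rule PiE_I)
        fix i assume i: "i \<in> I"
        have "P i \<in> bounded_polys (d i) H" using P\<Omega> i by (auto simp: \<Omega>_def PiE_iff)
        then have "P i \<in> poly_box (Suc (d i)) H" using bounded_polys_subset by blast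
        then show "P i \<in> R i" unfolding R_def using p(2) p'(2) i rough[OF t p(1) i] rough[OF s p'(1) i] by simp
      next
        fix i assume "i \<notin> I"
        then show "P i = undefined" using P\<Omega> by (auto simp: \<Omega>_def PiE_iff extensional_def)
      qed
    qed
    then have "card (G t \<inter> G s) \<le> card (PiE I R)" using fin finR by (intro card_mono finite_PiE)
    then have "real (card (G t \<inter> G s)) \<le> real (card (PiE I R))" by simp
    also have "\<dots> = (\<Prod>i\<in>I. real (card (R i)))" using fin by (simp add: card_PiE)
    also have "\<dots> \<le> (\<Prod>i\<in>I. C i * rho k * real H ^ (d i + 1) / L ^ 2)"
    proof (rule prod_mono)
      fix i assume i: "i \<in> I"
      have "int k = \<bar>int s - int t\<bar>" by (simp add: k_def)
      then show "0 \<le> real (card (R i)) \<and> real (card (R i)) \<le> C i * rho k * real H ^ (d i + 1) / L ^ 2"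
        unfolding R_def using F5[OF i] tS(1)[OF t] ts tq[OF t]
        by (simp add: rough_pairs_bounded_def L_def)
    qed
    also have "\<dots> = (\<Prod>i\<in>I. C i) * rho k ^ n * W / (L ^ 2) ^ n"
      unfolding W_def n by (simp add: prod_dividef prod.distrib)
    finally show ?thesis by (simp add: k_def power_mult)
  qed
  define K where "K = (\<Prod>i\<in>I. C i) * W / L ^ (2 * n)"
  have Cpos: "(\<Prod>i\<in>I. C i) > 0" using C by (intro prod_pos) auto
  have K0: "K \<ge> 0" unfolding K_def using Cpos W0 L1 by simp
  \<comment> \<open>Every \<open>t\<close> meets each distance at most twice, so the moment of
    \<open>rho\<close> bounds the sum by 2 Cr T^2 K. As T is at most 2 L^n, the L^(2 n) in
    \<open>K\<close> cancels, and 8 Cr results.\<close>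
  have off: "(\<Sum>t\<in>S. \<Sum>s\<in>S - {t}. real (card (G t \<inter> G s))) \<le> b * W"
  proof -
    have "(\<Sum>t\<in>S. \<Sum>s\<in>S - {t}. real (card (G t \<inter> G s))) \<le>
        (\<Sum>t\<in>S. \<Sum>s\<in>S - {t}. K * rho (nat \<bar>int s - int t\<bar>) ^ n)"
    proof (intro sum_mono)
      fix t s assume "t \<in> S" "s \<in> S - {t}"
      then show "real (card (G t \<inter> G s)) \<le> K * rho (nat \<bar>int s - int t\<bar>) ^ n"
        using pair[of t s] by (simp add: K_def mult_ac)
    qed
    also have "\<dots> \<le> (\<Sum>t\<in>S. K * (2 * (Cr * real T)))"
    proof (rule sum_mono)
      fix t assume t: "t \<in> S"
      have "(\<Sum>s\<in>S - {t}. rho (nat \<bar>int s - int t\<bar>) ^ n) \<le> 2 * (\<Sum>k = 1..T. rho k ^ n)"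
        unfolding S_def
      proof (rule sum_distances_le[where f = "\<lambda>k. rho k ^ n"])
        fix k show "0 \<le> rho k ^ n" using rho_ge_1[of k] by simp
      qed (use t in \<open>simp add: S_def\<close>)
      also have "\<dots> \<le> 2 * (Cr * real T)" using Cr by simp
      finally show "(\<Sum>s\<in>S - {t}. K * rho (nat \<bar>int s - int t\<bar>) ^ n) \<le> K * (2 * (Cr * real T))"
        unfolding sum_distrib_left[symmetric] using K0 by (rule mult_left_mono)
    qed
    also have "\<dots> = 2 * Cr * (real T)\<^sup>2 * K" by (simp add: S_def power2_eq_square)
    also have "\<dots> \<le> 2 * Cr * (4 * L ^ (2 * n)) * K"
    proof -
      have "0 \<le> Cr * real T" using order_trans[OF sum_nonneg Cr] rho_ge_1 by (meson order_trans zero_le_one zero_le_power)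
      then have "0 \<le> Cr" using T(1) by (simp add: zero_le_mult_iff)
      moreover have "(real T)\<^sup>2 \<le> (2 * L ^ n)\<^sup>2" using T by (intro power_mono) auto
      moreover have "(2 * L ^ n)\<^sup>2 = 4 * L ^ (2 * n)" by (simp add: power_mult_distrib power_even_eq)
      ultimately show ?thesis using K0 by (intro mult_right_mono mult_left_mono) auto
    qed
    also have "\<dots> = b * W" unfolding K_def b_def using L1 by simp
    finally show ?thesis .
  qed
  define M where "M = (\<Sum>t\<in>S. real (card (G t)))"
  \<comment> \<open>Here the number of values of \<open>t\<close> has to be at least L^n.\<close>
  have M1: "c2 * W \<le> M"
  proof -
    have "c2 * W * 1 \<le> c2 * W * (real T / L ^ n)" using T(2) L1 c2 W0 by (intro mult_left_mono) auto
    also have "\<dots> = (\<Sum>t\<in>S. c2 * W / L ^ n)" by (simp add: S_def)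
    also have "\<dots> \<le> M" unfolding M_def by (intro sum_mono first)
    finally show ?thesis by simp
  qed
  have Mpos: "M > 0" using M1 c2 W0 by (meson less_le_trans mult_pos_pos)
  define N where "N = real (card (\<Union>t\<in>S. G t))"
  have "0 \<le> Cr * real T" using order_trans[OF sum_nonneg Cr] rho_ge_1 by (meson order_trans zero_le_one zero_le_power)
  then have "0 \<le> Cr" using T(1) by (simp add: zero_le_mult_iff)
  then have b0: "b \<ge> 0" unfolding b_def using Cpos by simp
  have "M\<^sup>2 \<le> N * (M + (\<Sum>t\<in>S. \<Sum>s\<in>S - {t}. real (card (G t \<inter> G s))))"
    unfolding M_def N_def by (rule second_moment[OF fin\<Omega>]) (auto simp: S_def G_def)
  also have "\<dots> \<le> N * (M + b * W)" using off by (intro mult_left_mono add_left_mono) (auto simp: N_def)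
  \<comment> \<open>Since \<open>M\<close> is at least \<open>c2 * W\<close>, the off-diagonal part
    is at most b / c2 times \<open>M\<close>. One factor \<open>M\<close> then cancels against the
    left side.\<close>
  also have "\<dots> \<le> N * (M * (1 + b / c2))"
  proof (rule mult_left_mono)
    have "b * W = (b / c2) * (c2 * W)" using c2 by simp
    also have "\<dots> \<le> (b / c2) * M" using M1 b0 c2 by (intro mult_left_mono) auto
    finally show "M + b * W \<le> M * (1 + b / c2)" by (simp add: distrib_left mult.commute)
  qed (simp add: N_def)
  finally have "M * M \<le> M * (N * (1 + b / c2))" by (simp add: power2_eq_square mult_ac)
  then have "M \<le> N * (1 + b / c2)" using Mpos by simp
  then have "c2 * W \<le> N * (1 + b / c2)" using M1 by linarith
  moreover have "1 + b / c2 > 0" using b0 c2 by (intro add_pos_nonneg divide_nonneg_pos) auto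
  ultimately have "c2 / (1 + b / c2) * W \<le> N" by (simp add: pos_divide_le_eq)
  also have "N \<le> real (card {P \<in> \<Omega>. \<exists>t. prime_values I g u P t})"
  proof -
    have "(\<Union>t\<in>S. G t) \<subseteq> {P \<in> \<Omega>. \<exists>t. prime_values I g u P t}"
    proof
      fix P assume "P \<in> (\<Union>t\<in>S. G t)"
      then obtain t p where tp: "t \<in> S" "P \<in> \<Omega>" "p \<in> Good t" "\<forall>i\<in>I. poly (P i) (int t) = u i * int (p i)"
        by (auto simp: G_def)
      have pP: "p \<in> PiE I (Q t)" "symbols_trivial I g p" using tp(3) by (auto simp: Good_def)
      have "prime (p i) \<and> p i mod 4 = 1" if "i \<in> I" for i
        using pP(1) that Qp(1) by (meson PiE_mem)
      then have "prime_values I g u P t"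
        unfolding prime_values_def using pinj[OF tp(1) pP(1)] pP(2) tp(4) by blast
      then show "P \<in> {P \<in> \<Omega>. \<exists>t. prime_values I g u P t}" using tp(2) by blast
    qed
    then show ?thesis unfolding N_def using fin\<Omega> by (simp add: card_mono)
  qed
  finally show ?thesis by (simp add: \<Omega>_def)
qed

text \<open>The constants are fixed in the order of their dependence: \<delta> and \<open>c0\<close>
  from the primes, then the scales, then the sieve constants. What is left are finitely many
  asymptotic conditions on \<open>H\<close>.\<close>

theorem positive_density_prime_values:
  fixes I :: "'i set" and g d :: "'i \<Rightarrow> nat" and u :: "'i \<Rightarrow> int"
  assumes fin: "finite I" and d: "\<And>i. i \<in> I \<Longrightarrow> d i \<ge> 1" and u: "\<And>i. i \<in> I \<Longrightarrow> u i \<noteq> 0"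
    and two: "i1 \<in> I" "i2 \<in> I" "g i1 \<noteq> g i2"
  shows "\<exists>c > 0. \<forall>\<^sub>F H in sequentially. c * (\<Prod>i\<in>I. real H ^ (d i + 1)) \<le>
    real (card {P \<in> PiE I (\<lambda>i. bounded_polys (d i) H). \<exists>t. prime_values I g u P t})"
proof -
  define n where "n = card I"
  have n1: "n \<ge> 1" using fin two(1) by (auto simp: n_def Suc_le_eq card_gt_0_iff)
  obtain \<delta> c0 where \<delta>: "0 < \<delta>" "\<delta> < 1" and c0: "0 < c0"
    and ev: "\<forall>\<^sub>F Y in at_top. c0 * Y / ln Y \<le> real (card (prime_window \<delta> Y))"
    using primes_mod4_in_interval unfolding prime_window_def by blast
  obtain Y0 where Y0: "\<And>Y. Y \<ge> Y0 \<Longrightarrow> c0 * Y / ln Y \<le> real (card (prime_window \<delta> Y))"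
    using ev unfolding eventually_at_top_linorder by blast
  define U where "U = (\<Sum>i\<in>I. \<bar>real_of_int (u i)\<bar>)"
  have uU: "\<bar>real_of_int (u i)\<bar> \<le> U" if "i \<in> I" for i
    unfolding U_def using fin that by (intro member_le_sum) auto
  have U: "U > 0" using uU[OF two(1)] u[OF two(1)] by linarith
  \<comment> \<open>As \<open>U\<close> bounds every |u i|, a prime from a window times its
    multiplier is at most H t^d / 2.\<close>
  define \<kappa>0 where "\<kappa>0 = 1 / (2 * U)"
  have \<kappa>0: "\<kappa>0 > 0" using U by (simp add: \<kappa>0_def)
  have \<kappa>0u: "2 * \<bar>real_of_int (u i)\<bar> * \<kappa>0 \<le> 1" if "i \<in> I" for i
    using uU[OF that] U by (simp add: \<kappa>0_def)
  \<comment> \<open>Enumerating \<open>I\<close> gives the scales distinct exponents below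
    \<open>n\<close>, so that \<open>\<kappa>m\<close> bounds them all from below.\<close>
  obtain e where e: "bij_betw e I {0..<card I}" using ex_bij_betw_finite_nat[OF fin] by blast
  define \<kappa> where "\<kappa> = (\<lambda>i. \<kappa>0 * \<delta> ^ e i)"
  define \<kappa>m where "\<kappa>m = \<kappa>0 * \<delta> ^ n"
  have \<kappa>m: "\<kappa>m > 0" using \<kappa>0 \<delta> by (simp add: \<kappa>m_def)
  have \<kappa>m_le: "\<kappa>m \<le> \<kappa> i" if "i \<in> I" for i
  proof -
    have "e i < n" using bij_betwE[OF e] that by (auto simp: n_def)
    then have "\<delta> ^ n \<le> \<delta> ^ e i" using \<delta> by (intro power_decreasing) auto
    then show ?thesis unfolding \<kappa>m_def \<kappa>_def using \<kappa>0 by (intro mult_left_mono) auto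
  qed
  obtain Cr where Cr: "\<And>T. (\<Sum>k = 1..T. rho k ^ n) \<le> Cr * real T" using rho_moment[OF n1] by blast
  have "\<forall>i\<in>I. \<exists>C > 0. \<forall>\<^sub>F H in sequentially. rough_pairs_bounded (d i) (nat \<bar>u i\<bar>) C H"
    using d u by (intro ballI eventually_rough_pairs_bounded) auto
  then obtain C where C: "\<And>i. i \<in> I \<Longrightarrow> C i > 0" "\<And>i. i \<in> I \<Longrightarrow> \<forall>\<^sub>F H in sequentially. rough_pairs_bounded (d i) (nat \<bar>u i\<bar>) (C i) H"
    by metis
  define D where "D = Suc (\<Sum>i\<in>I. d i)"
  have D: "d i \<le> D" if "i \<in> I" for i
    using member_le_sum[of i I d] fin that by (simp add: D_def)
  define T where "T = (\<lambda>H::nat. nat \<lceil>ln (real H) ^ n\<rceil>)"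
  \<comment> \<open>Chosen for both inequalities \<open>F3\<close> at once: T >= t0 gives (T - 1)
    \<delta> \<kappa>m >= 1 + \<kappa>0.\<close>
  define t0 where "t0 = 1 + (1 + \<kappa>0) / (\<delta> * \<kappa>m)"
  define c2 where "c2 = (\<Prod>i\<in>I. c0 * \<kappa>m / 2 / 2 ^ d i) / 2 ^ (n + 1)"
  define b where "b = 8 * Cr * (\<Prod>i\<in>I. C i)"
  have c2: "c2 > 0" unfolding c2_def using c0 \<kappa>m by (intro divide_pos_pos prod_pos) auto
  have "rho 1 ^ n \<le> Cr" using Cr[of 1] by simp
  then have "Cr \<ge> 0" using rho_ge_1[of 1] by (meson order_trans zero_le_one zero_le_power)
  then have b: "b \<ge> 0" unfolding b_def using C(1) by (intro mult_nonneg_nonneg prod_nonneg) (auto intro: less_imp_le)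
  have "c0 * \<kappa>m > 0" "\<delta> * \<kappa>m > 0" using c0 \<kappa>m \<delta> by auto
  have "\<forall>\<^sub>F H in sequentially. \<forall>i\<in>I. rough_pairs_bounded (d i) (nat \<bar>u i\<bar>) (C i) H"
    using fin C(2) by (simp add: eventually_ball_finite)
  moreover have "\<forall>\<^sub>F H in sequentially. symbols_cancel H (1 / 2 ^ (n + 1))"
    by (rule eventually_symbols_cancel) simp
  moreover have "\<forall>\<^sub>F H in sequentially. (2 * real (T H)) ^ D \<le> real H powr (1 / 20)"
    unfolding T_def by (rule eventually_log_power_le)
  moreover have "\<forall>\<^sub>F H in sequentially. t0 \<le> ln (real H)" by real_asymp
  moreover have "\<forall>\<^sub>F H in sequentially. H \<ge> (3::nat)" by (rule eventually_ge_at_top)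
  moreover have "\<forall>\<^sub>F H in sequentially. Y0 \<le> \<kappa>m * real H" using \<kappa>m by real_asymp
  moreover have "\<forall>\<^sub>F H in sequentially. 3 \<le> \<kappa>m * real H" using \<kappa>m by real_asymp
  moreover have "\<forall>\<^sub>F H in sequentially. \<kappa>0 * real H powr (21 / 20) \<le> real H powr (11 / 10)"
    using \<kappa>0 by real_asymp
  moreover have "\<forall>\<^sub>F H in sequentially. real H powr (9 / 10) \<le> c0 * \<kappa>m * real H / (2 * ln (real H))"
  proof -
    define c where "c = c0 * \<kappa>m"
    have "c > 0" using c0 \<kappa>m by (simp add: c_def)
    then show ?thesis unfolding c_def[symmetric] by real_asymp
  qed
  moreover have "\<forall>\<^sub>F H in sequentially. real H powr (1 / 16) < \<delta> * (\<kappa>m * real H)"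
  proof -
    define c where "c = \<delta> * \<kappa>m"
    have "c > 0" using \<delta> \<kappa>m by (simp add: c_def)
    then show ?thesis unfolding mult.assoc[symmetric] c_def[symmetric] by real_asymp
  qed
  moreover have "\<forall>\<^sub>F H in sequentially. 2 * real H powr (1 / 20) \<le> real H" by real_asymp
  ultimately have "\<forall>\<^sub>F H in sequentially. c2 / (1 + b / c2) * (\<Prod>i\<in>I. real H ^ (d i + 1)) \<le>
    real (card {P \<in> PiE I (\<lambda>i. bounded_polys (d i) H). \<exists>t. prime_values I g u P t})"
  proof eventually_elim
    case (elim H)
    have t0: "t0 \<ge> 1" unfolding t0_def using \<kappa>0 \<kappa>m \<delta> by simp
    then have L1: "ln (real H) \<ge> 1" using elim(4) by linarith
    have Tge: "ln (real H) ^ n \<le> real (T H)" unfolding T_def using L1 by simp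
    have Tle: "real (T H) \<le> 2 * ln (real H) ^ n"
    proof -
      have "real (T H) \<le> ln (real H) ^ n + 1" unfolding T_def using L1 by (simp add: of_nat_ceiling)
      then show ?thesis using one_le_power[OF L1, of n] by linarith
    qed
    have "ln (real H) ^ 1 \<le> ln (real H) ^ n" using L1 n1 by (intro power_increasing) auto
    then have Tt0: "t0 \<le> real (T H)" using elim(4) Tge by simp
    have "(1 + \<kappa>0) / (\<delta> * \<kappa>m) * (\<delta> * \<kappa>m) \<le> (real (T H) - 1) * (\<delta> * \<kappa>m)"
      using Tt0 \<delta> \<kappa>m by (intro mult_right_mono) (auto simp: t0_def)
    then have "1 + \<kappa>0 \<le> (real (T H) - 1) * (\<delta> * \<kappa>m)" using \<delta> \<kappa>m by simp
    moreover have "(real (T H) - 1) * (\<delta> * \<kappa>m) \<le> real (T H) * (\<delta> * \<kappa>m)"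
      using \<delta> \<kappa>m by (intro mult_right_mono) auto
    ultimately have F3: "1 \<le> (real (T H) - 1) * \<delta> * \<kappa>m" "\<kappa>0 \<le> real (T H) * \<delta> * \<kappa>m"
      using \<kappa>0 unfolding mult.assoc by linarith+
    have F9: "real (sieve_level H) < \<delta> * (\<kappa>m * real H)"
    proof -
      have "real (sieve_level H) \<le> real H powr (1 / 16)" by (simp add: sieve_level_def)
      then show ?thesis using elim(10) by linarith
    qed
    show ?case unfolding c2_def b_def
    proof (rule card_union_lower_bound[where \<kappa> = \<kappa> and e = e and ?\<kappa>0.0 = \<kappa>0 and T = "T H" and D = D and ?Y0.0 = Y0 and \<delta> = \<delta>])
      show "n = card I" by (rule n_def)
      show "inj_on e I" using e by (rule bij_betw_imp_inj_on)
      show "1 \<le> T H" using Tt0 t0 by linarith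
      show "1 \<le> D" by (simp add: D_def)
    next
      fix i assume i: "i \<in> I"
      show "\<kappa> i = \<kappa>0 * \<delta> ^ e i" by (simp only: \<kappa>_def)
      show "\<kappa>m \<le> \<kappa> i" by (rule \<kappa>m_le[OF i])
      show "2 * \<bar>real_of_int (u i)\<bar> * \<kappa>0 \<le> 1" by (rule \<kappa>0u[OF i])
      show "d i \<le> D" by (rule D[OF i])
      show "C i > 0" by (rule C(1)[OF i])
      show "rough_pairs_bounded (d i) (nat \<bar>u i\<bar>) (C i) H" using elim(1) i by blast
      show "d i \<ge> 1" by (rule d[OF i])
      show "u i \<noteq> 0" by (rule u[OF i])
    next
      fix Y assume "Y0 \<le> Y"
      then show "c0 * Y / ln Y \<le> real (card (prime_window \<delta> Y))" by (rule Y0)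
    next
      show "(\<Sum>k = 1..T H. rho k ^ n) \<le> Cr * real (T H)" by (rule Cr)
    qed (rule fin two \<delta> c0 \<kappa>m Tge Tle F3 F9 elim)+
  qed
  moreover have "c2 / (1 + b / c2) > 0" using c2 b by (intro divide_pos_pos add_pos_nonneg) auto
  ultimately show ?thesis by blast
qed

section \<open>From prime values to rational points on the surface\<close>

lemma poly_map_of_int_nat: "poly (map_poly rat_of_int p) (rat_of_nat t) = rat_of_int (poly p (int t))"
  by (induction p) (auto simp: map_poly_pCons)

text \<open>The index set is nonempty so that the height is the \<open>Max\<close> of a nonempty
  set. Coefficients beyond the degree vanish and satisfy the bound as well.\<close>

lemma poly_tuples_le_eq:
  assumes "tuple_index n \<noteq> {}"
  shows "poly_tuples_le n d H = PiE (tuple_index n) (\<lambda>ij. bounded_polys (case_prod d ij) H)"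
proof -
  have fin: "finite (tuple_index n)" by (simp add: tuple_index_def)
  have "tuple_height n P \<le> int H \<longleftrightarrow> (\<forall>ij\<in>tuple_index n. \<forall>k. \<bar>coeff (P ij) k\<bar> \<le> int H)" for P
  proof -
    define A where "A = (\<Union>ij\<in>tuple_index n. {\<bar>coeff (P ij) k\<bar> | k. k \<le> degree (P ij)})"
    have finA: "finite A" unfolding A_def using fin by auto
    obtain ij where "ij \<in> tuple_index n" using assms by blast
    then have "\<bar>coeff (P ij) 0\<bar> \<in> A" unfolding A_def by blast
    then have neA: "A \<noteq> {}" by blast
    have "tuple_height n P \<le> int H \<longleftrightarrow> (\<forall>x\<in>A. x \<le> int H)"
      unfolding tuple_height_def A_def[symmetric] using finA neA by simp
    also have "\<dots> \<longleftrightarrow> (\<forall>ij\<in>tuple_index n. \<forall>k \<le> degree (P ij). \<bar>coeff (P ij) k\<bar> \<le> int H)"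
      unfolding A_def by blast
    also have "\<dots> \<longleftrightarrow> (\<forall>ij\<in>tuple_index n. \<forall>k. \<bar>coeff (P ij) k\<bar> \<le> int H)"
    proof (intro ball_cong refl iffI allI impI)
      fix ij k assume h: "\<forall>k \<le> degree (P ij). \<bar>coeff (P ij) k\<bar> \<le> int H"
      show "\<bar>coeff (P ij) k\<bar> \<le> int H"
        using h by (cases "k \<le> degree (P ij)") (auto simp: coeff_eq_0)
    qed auto
    finally show ?thesis .
  qed
  note height = this
  show ?thesis
  proof (rule Set.set_eqI)
    fix P
    have "P \<in> poly_tuples_le n d H \<longleftrightarrow> P \<in> extensional (tuple_index n) \<and>
        (\<forall>ij\<in>tuple_index n. degree (P ij) = case_prod d ij) \<and> (\<forall>ij\<in>tuple_index n. \<forall>k. \<bar>coeff (P ij) k\<bar> \<le> int H)"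
      unfolding poly_tuples_le_def poly_tuples_def mem_Collect_eq height PiE_iff by (auto simp: case_prod_beta)
    also have "\<dots> \<longleftrightarrow> P \<in> PiE (tuple_index n) (\<lambda>ij. bounded_polys (case_prod d ij) H)"
      unfolding PiE_iff bounded_polys_def mem_Collect_eq by blast
    finally show "P \<in> poly_tuples_le n d H \<longleftrightarrow> P \<in> PiE (tuple_index n) (\<lambda>ij. bounded_polys (case_prod d ij) H)" .
  qed
qed

text \<open>With \<open>P\<^sub>1\<^sub>1\<close> and \<open>P\<^sub>2\<^sub>1\<close> taking the values \<open>-a\<^sub>1a\<^sub>3p\<close> and \<open>-a\<^sub>2a\<^sub>3p\<close>, the substitution
  \<open>x \<mapsto> x/a\<^sub>1\<close>, \<open>y \<mapsto> y/a\<^sub>2\<close> turns the fibre into a conic without the coefficients \<open>a\<^sub>i\<close>.\<close>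

definition conic_multiplier :: "(nat \<Rightarrow> int) \<Rightarrow> nat \<times> nat \<Rightarrow> int" where
  "conic_multiplier a ij = (if snd ij = 1 \<and> fst ij \<noteq> 3 then - (a (fst ij) * a 3) else 1)"

text \<open>At \<open>t\<close> the coefficients are \<open>- (a i)^2 * a 3 * A i\<close> for i = 1,
  2 and \<open>a 3 * A 3\<close>. They are nonzero, and up to the common factor \<open>a 3\<close>
  and squares the fibre is the conic of \<open>conic_of_primes\<close>, with the sign that makes it
  indefinite.\<close>

lemma conic_point_of_prime_values:
  assumes n: "n 1 > 0" "n 2 > 0" and a: "\<And>i. i \<in> {1, 2, 3} \<Longrightarrow> a i \<noteq> 0"
    and pv: "prime_values (tuple_index n) fst (conic_multiplier a) P t"
  shows "\<exists>xyz t. on_surface a n P xyz t \<and> smooth_fibre a n P t"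
proof -
  define I where "I = tuple_index n"
  obtain p where inj: "inj_on p I" and sym: "symbols_trivial I fst p"
    and p: "\<And>ij. ij \<in> I \<Longrightarrow> prime (p ij) \<and> p ij mod 4 = 1 \<and> poly (P ij) (int t) = conic_multiplier a ij * int (p ij)"
    using pv unfolding prime_values_def I_def by blast
  have I: "I = (SIGMA i:{1, 2, 3}. {1..n i})" by (simp add: I_def tuple_index_def)
  have fin: "finite I" by (simp add: I)
  define A where "A = (\<lambda>i. \<Prod>ij\<in>{ij\<in>I. fst ij = i}. p ij)"
  have "\<exists>x y z::int. (x, y, z) \<noteq> (0, 0, 0) \<and> int (A 1) * x\<^sup>2 + int (A 2) * y\<^sup>2 = int (A 3) * z\<^sup>2"
    unfolding A_def
  proof (rule conic_of_primes[OF fin inj])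
    show "(1, 1) \<in> I" using n by (simp add: I)
  next
    fix ij assume ij: "ij \<in> I"
    show "prime (p ij)" "p ij mod 4 = 1" using p[OF ij] by blast+
    show "fst ij \<in> {1, 2, 3}" using ij by (auto simp: I)
    show "(\<Prod>j\<in>{j\<in>I. fst j \<noteq> fst ij}. Legendre (int (p j)) (int (p ij))) = 1"
      using sym ij unfolding symbols_trivial_def by blast
  qed simp
  then obtain x y z :: int where nz: "(x, y, z) \<noteq> (0, 0, 0)"
    and eq: "int (A 1) * x\<^sup>2 + int (A 2) * y\<^sup>2 = int (A 3) * z\<^sup>2" by blast
  have Apos: "A i > 0" for i
    unfolding A_def
  proof (rule prod_pos)
    fix ij assume "ij \<in> {ij\<in>I. fst ij = i}"
    then show "0 < p ij" using p[of ij] prime_gt_0_nat by blast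
  qed
  have val: "poly (conic_coeff a n P i) (rat_of_nat t) =
      rat_of_int (a i * (if i = 3 then 1 else - (a i * a 3)) * int (A i))" if i: "i \<in> {1, 2, 3}" for i
  proof -
    have "(\<Prod>j = 1..n i. poly (P (i, j)) (int t)) = (\<Prod>j = 1..n i. conic_multiplier a (i, j) * int (p (i, j)))"
    proof (rule prod.cong[OF refl])
      fix j assume "j \<in> {1..n i}"
      then have "(i, j) \<in> I" using i by (simp only: I mem_Sigma_iff)
      then show "poly (P (i, j)) (int t) = conic_multiplier a (i, j) * int (p (i, j))" using p by blast
    qed
    also have "\<dots> = (\<Prod>j = 1..n i. conic_multiplier a (i, j)) * int (\<Prod>j = 1..n i. p (i, j))"
      by (simp add: prod.distrib)
    also have "(\<Prod>j = 1..n i. p (i, j)) = A i"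
    proof -
      have "{ij\<in>I. fst ij = i} = (\<lambda>j. (i, j)) ` {1..n i}" using i by (auto simp: I)
      then show ?thesis unfolding A_def by (simp add: prod.reindex inj_on_def)
    qed
    \<comment> \<open>Only the first polynomial of groups 1 and 2 carries a multiplier, and it
      exists because \<open>n 1\<close> and \<open>n 2\<close> are positive. Group 3 carries none
      and may be empty.\<close>
    also have "(\<Prod>j = 1..n i. conic_multiplier a (i, j)) = (if i = 3 then 1 else - (a i * a 3))"
    proof (cases "i = 3")
      case False
      then have "1 \<in> {1..n i}" using i n by auto
      then have "(\<Prod>j = 1..n i. conic_multiplier a (i, j)) =
          conic_multiplier a (i, 1) * (\<Prod>j\<in>{1..n i} - {1}. conic_multiplier a (i, j))"
        by (intro prod.remove) auto
      also have "(\<Prod>j\<in>{1..n i} - {1}. conic_multiplier a (i, j)) = 1"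
        by (intro prod.neutral) (auto simp: conic_multiplier_def)
      finally show ?thesis using False by (simp add: conic_multiplier_def)
    qed (simp add: conic_multiplier_def)
    finally have "poly (smult (a i) (\<Prod>j = 1..n i. P (i, j))) (int t) =
        a i * (if i = 3 then 1 else - (a i * a 3)) * int (A i)"
      by (simp add: poly_prod)
    then show ?thesis unfolding conic_coeff_def poly_map_of_int_nat by (simp only:)
  qed
  define xyz where "xyz = (rat_of_int x / rat_of_int (a 1), rat_of_int y / rat_of_int (a 2), rat_of_int z)"
  have a0: "rat_of_int (a 1) \<noteq> 0" "rat_of_int (a 2) \<noteq> 0" "rat_of_int (a 3) \<noteq> 0" using a by auto
  have "rat_of_int (int (A 1) * x\<^sup>2 + int (A 2) * y\<^sup>2) = rat_of_int (int (A 3) * z\<^sup>2)" using eq by (simp only:)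
  then have eqr: "rat_of_nat (A 1) * (rat_of_int x)\<^sup>2 + rat_of_nat (A 2) * (rat_of_int y)\<^sup>2 = rat_of_nat (A 3) * (rat_of_int z)\<^sup>2"
    by simp
  have "on_surface a n P xyz (rat_of_nat t)"
  proof -
    have "rat_of_int (a 1 * - (a 1 * a 3) * int (A 1)) * (rat_of_int x / rat_of_int (a 1))\<^sup>2 +
        rat_of_int (a 2 * - (a 2 * a 3) * int (A 2)) * (rat_of_int y / rat_of_int (a 2))\<^sup>2 +
        rat_of_int (a 3 * 1 * int (A 3)) * (rat_of_int z)\<^sup>2 =
        rat_of_int (a 3) * (rat_of_nat (A 3) * (rat_of_int z)\<^sup>2 -
          (rat_of_nat (A 1) * (rat_of_int x)\<^sup>2 + rat_of_nat (A 2) * (rat_of_int y)\<^sup>2))"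
      using a0 by (simp add: power_divide power2_eq_square algebra_simps)
    also have "\<dots> = 0" unfolding eqr by simp
    finally show ?thesis
      using nz a0 val[of 1] val[of 2] val[of 3] by (simp add: on_surface_def xyz_def)
  qed
  moreover have "smooth_fibre a n P (rat_of_nat t)"
    unfolding smooth_fibre_def
  proof
    fix i :: nat assume i: "i \<in> {1, 2, 3}"
    have "a i \<noteq> 0" "a 3 \<noteq> 0" using a i by auto
    moreover have "A i \<noteq> 0" using Apos[of i] by simp
    ultimately show "poly (conic_coeff a n P i) (rat_of_nat t) \<noteq> 0" unfolding val[OF i] by simp
  qed
  ultimately show ?thesis by blast
qed

text \<open>Both counts are compared with \<open>W H\<close>, the order of magnitude of the box of
  coefficients: the numerator is at least \<open>c * W H\<close>, and the denominator at most
  \<open>3 ^ m * W H\<close>, because each of the \<open>m\<close> coefficients has at most 2 H + 1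
  <= 3 H values.\<close>

theorem theorem1p4:
  fixes n :: "nat \<Rightarrow> nat" and a :: "nat \<Rightarrow> int" and d :: "nat \<Rightarrow> nat \<Rightarrow> nat"
  assumes "n 1 > 0" and "n 2 > 0"
    and "\<And>i. i \<in> {1, 2, 3} \<Longrightarrow> a i \<noteq> 0"
    and "\<And>i j. i \<in> {1, 2, 3} \<Longrightarrow> j \<in> {1..n i} \<Longrightarrow> d i j > 0"
  shows "positive_proportion n d
           (\<lambda>P. \<exists>xyz t. on_surface a n P xyz t \<and> smooth_fibre a n P t)"
proof -
  define I where "I = tuple_index n"
  define Q where "Q = (\<lambda>P. \<exists>xyz t. on_surface a n P xyz t \<and> smooth_fibre a n P t)"
  define e where "e = case_prod d"
  define W where "W = (\<lambda>H. \<Prod>ij\<in>I. real H ^ (e ij + 1))"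
  have I: "I = (SIGMA i:{1, 2, 3}. {1..n i})" by (simp add: I_def tuple_index_def)
  have fin: "finite I" by (simp add: I)
  have in1: "(1, 1) \<in> I" and in2: "(2, 1) \<in> I" using assms(1,2) by (simp_all add: I)
  then have ne: "tuple_index n \<noteq> {}" by (auto simp: I_def)
  have tuples: "poly_tuples_le n d H = PiE I (\<lambda>ij. bounded_polys (e ij) H)" for H
    unfolding e_def I_def using ne by (rule poly_tuples_le_eq)
  have d1: "e ij \<ge> 1" if "ij \<in> I" for ij
  proof -
    obtain i j where ij: "ij = (i, j)" by (cases ij)
    then have "d i j > 0" using that by (intro assms(4)) (simp_all only: I mem_Sigma_iff)
    then show ?thesis by (simp add: ij e_def)
  qed
  have u0: "conic_multiplier a ij \<noteq> 0" if "ij \<in> I" for ij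
  proof -
    have "fst ij \<in> {1, 2, 3}" using that by (auto simp: I)
    then have "a (fst ij) \<noteq> 0" by (rule assms(3))
    moreover have "a 3 \<noteq> 0" by (rule assms(3)) simp
    ultimately show ?thesis by (simp add: conic_multiplier_def)
  qed
  have "\<exists>c > 0. \<forall>\<^sub>F H in sequentially. c * W H \<le>
      real (card {P \<in> PiE I (\<lambda>ij. bounded_polys (e ij) H). \<exists>t. prime_values I fst (conic_multiplier a) P t})"
    unfolding W_def
  proof (rule positive_density_prime_values[OF fin _ _ in1 in2])
    show "fst (1 :: nat, 1 :: nat) \<noteq> fst (2 :: nat, 1 :: nat)" by simp
  qed (fact d1 u0)+
  then obtain c where c: "c > 0" and ev: "\<forall>\<^sub>F H in sequentially. c * W H \<le>
      real (card {P \<in> PiE I (\<lambda>ij. bounded_polys (e ij) H). \<exists>t. prime_values I fst (conic_multiplier a) P t})"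
    by blast
  define m where "m = (\<Sum>ij\<in>I. e ij + 1)"
  have "\<forall>\<^sub>F H in sequentially. ereal (c / 3 ^ m) \<le>
      ereal (real (card {P \<in> poly_tuples_le n d H. Q P}) / real (card (poly_tuples_le n d H)))"
    using ev eventually_ge_at_top[of 1]
  proof eventually_elim
    case (elim H)
    define all where "all = poly_tuples_le n d H"
    have finall: "finite all"
      unfolding all_def tuples using fin by (intro finite_PiE finite_bounded_polys)
    have "{P \<in> all. \<exists>t. prime_values I fst (conic_multiplier a) P t} \<subseteq> {P \<in> all. Q P}"
      unfolding Q_def I_def using conic_point_of_prime_values[of n a, OF assms(1-3)] by blast
    then have "card {P \<in> all. \<exists>t. prime_values I fst (conic_multiplier a) P t} \<le> card {P \<in> all. Q P}"
      using finall by (intro card_mono) auto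
    then have lower: "c * W H \<le> real (card {P \<in> all. Q P})"
      using elim(1) unfolding all_def tuples by linarith
    have W0: "W H > 0" unfolding W_def using elim(2) by (intro prod_pos) auto
    have "card {P \<in> all. Q P} \<le> card all" using finall by (intro card_mono) auto
    moreover have "0 < c * W H" using c W0 by simp
    ultimately have allpos: "real (card all) > 0" using lower by linarith
    have "real (card all) = (\<Prod>ij\<in>I. real (card (bounded_polys (e ij) H)))"
      unfolding all_def tuples using fin by (simp add: card_PiE)
    also have "\<dots> \<le> (\<Prod>ij\<in>I. (3 * real H) ^ (e ij + 1))"
    proof (rule prod_mono)
      fix ij assume "ij \<in> I"
      have "real (card (bounded_polys (e ij) H)) \<le> real ((2 * H + 1) ^ (e ij + 1))"
        using card_bounded_polys_le[of "e ij" H] by (simp only: of_nat_le_iff)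
      also have "\<dots> = real (2 * H + 1) ^ (e ij + 1)" by (rule of_nat_power)
      also have "\<dots> \<le> (3 * real H) ^ (e ij + 1)" using elim(2) by (intro power_mono) auto
      finally show "0 \<le> real (card (bounded_polys (e ij) H)) \<and>
        real (card (bounded_polys (e ij) H)) \<le> (3 * real H) ^ (e ij + 1)" by simp
    qed
    also have "\<dots> = 3 ^ m * W H" unfolding W_def m_def by (simp only: power_mult_distrib prod.distrib power_sum)
    finally have upper: "real (card all) \<le> 3 ^ m * W H" .
    have "c / 3 ^ m * real (card all) \<le> c / 3 ^ m * (3 ^ m * W H)"
      using upper c by (intro mult_left_mono) auto
    also have "\<dots> = c * W H" by simp
    finally have "c / 3 ^ m * real (card all) \<le> real (card {P \<in> all. Q P})" using lower by linarith
    then have "c / 3 ^ m \<le> real (card {P \<in> all. Q P}) / real (card all)"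
      using allpos by (simp only: pos_le_divide_eq)
    then show ?case by (simp add: all_def)
  qed
  then have "ereal (c / 3 ^ m) \<le> liminf (\<lambda>H. ereal (real (card {P \<in> poly_tuples_le n d H. Q P}) / real (card (poly_tuples_le n d H))))"
    by (rule Liminf_bounded)
  moreover have "0 < ereal (c / 3 ^ m)" using c by simp
  ultimately show ?thesis unfolding positive_proportion_def Q_def by (meson less_le_trans)
qed

end
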